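(* Let $F\subseteq\mathbb Z^d$ be nonempty and finite, with $d\geq 2$. Suppose the shift action of $\mathbb Z^d$ on the tiling space $X_F$ admits an ergodic invariant Borel probability measure $\mu$ for which the spectral measure of $1_D$, where $D=\{a\in X_F:a(0)=1\}$, is supported on finitely many rational affine circles (that is, its support is contained in a finite union of rational affine circles in $\widehat{\mathbb Z^d}$). Then $F$ admits a fully periodic tiling complement.
   Context: Tiling space: $X_F=\{a\in\{0,1\}^{\mathbb Z^d}:\sum_{f\in F}a(x-f)=1\text{ for every }x\in\mathbb Z^d\}$, with the subspace topology from the product topology on $\{0,1\}^{\mathbb Z^d}$. The group $\mathbb Z^d$ acts on $X_F$ by shifts $(T_ga)(x)=a(x+g)$; invariance and ergodicity refer to this action. For an invariant Borel probability measure $\mu$, define unitaries on $L^2(X_F,\mu)$ by $U_g\phi=\phi\circ T_{-g}$. With the inner product $\langle\phi,\psi\rangle=\int\overline\phi\,\psi\,d\mu$, the spectral measure of $v\in L^2(X_F,\mu)$ is the unique finite positive Borel measure $\sigma_v$ on the dual group $\widehat{\mathbb Z^d}=\operatorname{Hom}(\mathbb Z^d,\{z\in\mathbb C:|z|=1\})$ with $\langle v,U_gv\rangle=\int\theta(g)\,d\sigma_v(\theta)$ for all $g\in\mathbb Z^d$. A rational affine circle in $\widehat{\mathbb Z^d}$ is a translate, by a torsion (finite-order) character, of a connected one-dimensional subtorus of $\widehat{\mathbb Z^d}$. A fully periodic tiling complement of $F$ is a set $A\subseteq\mathbb Z^d$ such that every $x\in\mathbb Z^d$ is uniquely $x=f+a$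 with $f\in F,a\in A$, and $A+\Gamma=A$ for some finite-index subgroup $\Gamma\leq\mathbb Z^d$. *)

theory Defs
  imports "HOL-Probability.Probability"
begin

type_synonym 'd lattice = "(int, 'd) vec"

definition tiling_space :: "'d::finite lattice set \<Rightarrow> ('d lattice \<Rightarrow> nat) set" where
  "tiling_space F = {a. range a \<subseteq> {0, 1} \<and> (\<forall>x. (\<Sum>f\<in>F. a (x - f)) = 1)}"

definition finite_index_subgroup :: "'d::finite lattice set \<Rightarrow> bool" where
  "finite_index_subgroup G \<longleftrightarrow>
     0 \<in> G \<and> (\<forall>x\<in>G. \<forall>y\<in>G. x + y \<in> G) \<and> (\<forall>x\<in>G. - x \<in> G) \<and>
     finite (range (\<lambda>x. (+) x ` G))"

definition tiling_complement :: "'d::finite lattice set \<Rightarrow> 'd lattice set \<Rightarrow> bool" where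
  "tiling_complement F A \<longleftrightarrow> (\<forall>x. \<exists>!(f, a). f \<in> F \<and> a \<in> A \<and> x = f + a)"

definition fully_periodic :: "'d::finite lattice set \<Rightarrow> bool" where
  "fully_periodic A \<longleftrightarrow>
     (\<exists>G. finite_index_subgroup G \<and> {a + g | a g. a \<in> A \<and> g \<in> G} = A)"

definition shift :: "'d::finite lattice \<Rightarrow> ('d lattice \<Rightarrow> nat) \<Rightarrow> ('d lattice \<Rightarrow> nat)" where
  "shift g a = (\<lambda>x. a (x + g))"

text \<open>
  The type class topology on a function type is the product topology, and the topology of
  \<^typ>\<open>nat\<close> is discrete, so \<^term>\<open>restrict_space borel (tiling_space F)\<close> carries the Borel sets of
  the subspace topology.
\<close>

definition borel_prob_on_tilings ::
  "'d::finite lattice set \<Rightarrow> ('d lattice \<Rightarrow> nat) measure \<Rightarrow> bool" where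
  "borel_prob_on_tilings F M \<longleftrightarrow>
     prob_space M \<and> sets M = sets (restrict_space borel (tiling_space F))"

definition shift_invariant :: "('d::finite lattice \<Rightarrow> nat) measure \<Rightarrow> bool" where
  "shift_invariant M \<longleftrightarrow>
     (\<forall>g. \<forall>A\<in>sets M. emeasure M (shift g -` A \<inter> space M) = emeasure M A)"

definition shift_ergodic :: "('d::finite lattice \<Rightarrow> nat) measure \<Rightarrow> bool" where
  "shift_ergodic M \<longleftrightarrow>
     (\<forall>A\<in>sets M. (\<forall>g. shift g -` A \<inter> space M = A) \<longrightarrow>
        emeasure M A = 0 \<or> emeasure M A = 1)"

text \<open>
  Characters are functions on the lattice; the topology of the dual group is that of pointwise
  convergence, i.e. the subspace topology of the product topology.
\<close>

definition dual_group :: "('d::finite lattice \<Rightarrow> complex) set" where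
  "dual_group = {\<theta>. (\<forall>g. cmod (\<theta> g) = 1) \<and> (\<forall>g h. \<theta> (g + h) = \<theta> g * \<theta> h)}"

definition torsion_character :: "('d::finite lattice \<Rightarrow> complex) \<Rightarrow> bool" where
  "torsion_character \<tau> \<longleftrightarrow> \<tau> \<in> dual_group \<and> (\<exists>n>0. \<forall>g. \<tau> g ^ n = 1)"

text \<open>
  A connected one-dimensional subtorus is a subgroup that is isomorphic, as a topological group,
  to the unit circle; it is then automatically compact (hence closed) and connected.
\<close>

definition one_dim_subtorus :: "('d::finite lattice \<Rightarrow> complex) set \<Rightarrow> bool" where
  "one_dim_subtorus H \<longleftrightarrow>
     H \<subseteq> dual_group \<and>
     (\<exists>\<phi> \<psi>. homeomorphism (sphere (0::complex) 1) H \<phi> \<psi> \<and>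
        (\<forall>z\<in>sphere 0 1. \<forall>w\<in>sphere 0 1. \<forall>g. \<phi> (z * w) g = \<phi> z g * \<phi> w g))"

definition rational_affine_circle :: "('d::finite lattice \<Rightarrow> complex) set \<Rightarrow> bool" where
  "rational_affine_circle C \<longleftrightarrow>
     (\<exists>\<tau> H. torsion_character \<tau> \<and> one_dim_subtorus H \<and> C = (\<lambda>\<theta> g. \<tau> g * \<theta> g) ` H)"

definition koopman :: "'d::finite lattice \<Rightarrow> (('d lattice \<Rightarrow> nat) \<Rightarrow> complex) \<Rightarrow>
    (('d lattice \<Rightarrow> nat) \<Rightarrow> complex)" where
  "koopman g \<phi> = \<phi> \<circ> shift (- g)"

definition square_integrable :: "'a measure \<Rightarrow> ('a \<Rightarrow> complex) \<Rightarrow> bool" where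
  "square_integrable M \<phi> \<longleftrightarrow>
     \<phi> \<in> borel_measurable M \<and> integrable M (\<lambda>a. (cmod (\<phi> a))\<^sup>2)"

definition l2_inner :: "'a measure \<Rightarrow> ('a \<Rightarrow> complex) \<Rightarrow> ('a \<Rightarrow> complex) \<Rightarrow> complex" where
  "l2_inner M \<phi> \<psi> = (\<integral>a. cnj (\<phi> a) * \<psi> a \<partial>M)"

text \<open>
  The measure \<open>\<sigma>\<close> is unique when it exists, and for an invariant \<open>M\<close> and a square-integrable \<open>v\<close>
  it exists (Herglotz-Bochner); this predicate says that \<open>\<sigma>\<close> is the spectral measure of \<open>v\<close>.
\<close>

definition is_spectral_measure ::
  "('d::finite lattice \<Rightarrow> nat) measure \<Rightarrow> (('d lattice \<Rightarrow> nat) \<Rightarrow> complex) \<Rightarrow>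
   ('d lattice \<Rightarrow> complex) measure \<Rightarrow> bool" where
  "is_spectral_measure M v \<sigma> \<longleftrightarrow>
     square_integrable M v \<and>
     finite_measure \<sigma> \<and> sets \<sigma> = sets (restrict_space borel dual_group) \<and>
     (\<forall>g. l2_inner M v (koopman g v) = (\<integral>\<theta>. \<theta> g \<partial>\<sigma>))"

text \<open>
  For \<open>\<sigma>\<close> with \<^term>\<open>sets \<sigma> = sets (restrict_space borel S)\<close>, the sets \<^term>\<open>U \<inter> space \<sigma>\<close> with
  \<^term>\<open>open U\<close> are exactly the relatively open subsets of \<^term>\<open>S\<close>.
\<close>

definition measure_support :: "'a::topological_space measure \<Rightarrow> 'a set" where
  "measure_support \<sigma> =
     {\<theta> \<in> space \<sigma>. \<forall>U. open U \<and> \<theta> \<in> U \<longrightarrow> emeasure \<sigma> (U \<inter> space \<sigma>) > 0}"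

end

theory Submission
  imports Defs "HOL-Computational_Algebra.Polynomial"
begin

text \<open>
  Since \<open>\<sigma>\<close> lives on finitely many rational affine circles, the mixed differences of \<open>1\<^sub>D\<close> along vectors
  \<open>h\<^sub>1, \<dots>, h\<^sub>m\<close>, one from (a multiple of) the kernel of the level function \<open>k\<^sub>i : \<int>\<^sup>d \<rightarrow> \<int>\<close> of each circle, vanish
  almost everywhere. Averaging over these kernels (conditional expectations) gives for almost every tiling
  \<open>a\<close> a decomposition \<open>a = \<Psi> + \<Sum> g\<^sub>i\<close> with \<open>\<Psi>\<close> fully periodic and \<open>g\<^sub>i\<close> with values in \<open>[0, 1]\<close> invariant
  along \<open>ker k\<^sub>i\<close>, where moreover \<open>g\<^sub>i(x) \<in> {0, 1}\<close> forces \<open>a(x) = g\<^sub>i(x)\<close>. As \<open>a\<close> is integer valued, each \<open>g\<^sub>i\<close> is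
  modulo 1 a polynomial in \<open>k\<^sub>i\<close> on every coset of some \<open>N \<int>\<^sup>d\<close>.

  If all nonconstant coefficients are rational, every coset carries either a constant or a
  \<open>ker k\<^sub>i\<close>-invariant piece of the tiling. In general one passes to a limit of the dilates \<open>x \<mapsto> a(M x)\<close> with
  \<open>M \<equiv> 1\<close> modulo \<open>N\<close> and modulo \<open>\<bar>F\<bar>!\<close>. These are again tilings by \<open>F\<close>, and by Weyl's theorem \<open>M\<close> can be
  chosen such that all coefficients tend to rational numbers modulo 1. A translation makes the constant
  coefficients irrational beforehand, so that in the limit the \<open>g\<^sub>i\<close> are still determined by
  their values modulo 1.

  The resulting tiling splits into pieces, each periodic in all but one direction. The
  part of \<open>\<int>\<^sup>d\<close> covered by each piece is fully periodic, so by the pigeonhole principle the pieces may be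
  replaced by fully periodic ones independently of each other.
\<close>

section \<open>Weyl equidistribution\<close>

text \<open>The factor M is 1 modulo N so that x and M x lie in the same coset of N Z^d: the
  periodic part is unchanged there, and the phase polynomial of the coset is evaluated at M k(x),
  which multiplies its coefficient of degree i by M^i. These multiples are what Weyl's theorem moves
  towards rationals. M is 1 modulo |F|! so that no prime up to |F| divides it, as the congruence
  argument for dilated tilings requires. The obstacle is that phases know the summands only modulo
  1, and a summand close to an integer may jump between 0 and 1 in the limit. A nonconstant phase is
  kept off the integers by its irrational constant coefficient, a nonintegral constant phase stays
  off them anyway. On a coset with an integral constant phase the summand takes only the values 0
  and 1; there the tiling equals that summand and inherits its invariance, whatever the other
  summands do. Conditional expectations are suited to this because a nonnegative function vanishes
  almost everywhere on the set where its conditional expectation does.\<close>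

definition unit_exp :: "real \<Rightarrow> complex" where
  "unit_exp t = cis (2 * pi * t)"

lemma norm_unit_exp [simp]: "cmod (unit_exp t) = 1"
  by (simp add: unit_exp_def)

lemma unit_exp_add: "unit_exp (s + t) = unit_exp s * unit_exp t"
  by (simp add: unit_exp_def cis_mult algebra_simps)

lemma unit_exp_diff: "unit_exp (s - t) = unit_exp s * cnj (unit_exp t)"
  by (simp add: unit_exp_def cis_cnj cis_mult algebra_simps)

lemma unit_exp_of_nat_mult: "unit_exp (real n * t) = unit_exp t ^ n"
  by (induction n) (simp_all add: unit_exp_def cis_mult[symmetric] algebra_simps cis_mult)

lemma unit_exp_eq_1_iff: "unit_exp t = 1 \<longleftrightarrow> t \<in> \<int>"
proof
  assume "unit_exp t = 1"
  then have "cos (2 * pi * t) = 1"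
    by (simp add: unit_exp_def complex_eq_iff)
  then obtain n :: int where "2 * pi * t = of_int n * 2 * pi"
    using cos_one_2pi_int by auto
  then have "t = of_int n" by simp
  then show "t \<in> \<int>" by simp
next
  assume "t \<in> \<int>"
  then obtain n :: int where "t = of_int n" by (elim Ints_cases)
  then show "unit_exp t = 1"
    by (simp add: unit_exp_def cis_multiple_2pi)
qed

lemma unit_exp_add_of_int [simp]: "unit_exp (t + of_int z) = unit_exp t"
  using unit_exp_eq_1_iff[of "of_int z"] by (simp add: unit_exp_add)

lemma continuous_on_unit_exp: "continuous_on S unit_exp"
  unfolding unit_exp_def by (intro continuous_intros)

lemma unit_exp_near_1:
  assumes "\<epsilon> > 0"
  obtains \<delta> where "\<delta> > 0" "\<And>t. cmod (unit_exp t - 1) < \<delta> \<Longrightarrow> \<exists>z::int. \<bar>t - of_int z\<bar> < \<epsilon>"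
proof -
  \<comment> \<open>\<open>K\<close> is one period of \<open>unit_exp\<close> without the
    \<open>\<epsilon>\<close>-neighbourhood of 0. By compactness the distance from 1 has a positive
    minimum there; for \<open>\<epsilon> > 1/2\<close> the set is empty and any
    \<open>\<delta>\<close> serves.\<close>
  define K where "K = {-1/2..-\<epsilon>} \<union> {\<epsilon>..1/2::real}"
  obtain \<delta> where \<delta>: "\<delta> > 0" "\<And>y. y \<in> K \<Longrightarrow> \<delta> \<le> cmod (unit_exp y - 1)"
  proof (cases "K = {}")
    case False
    have "compact K" unfolding K_def by (intro compact_Un compact_Icc)
    moreover have "continuous_on K (\<lambda>y. cmod (unit_exp y - 1))"
      by (intro continuous_intros continuous_on_unit_exp)
    ultimately obtain y0 where y0: "y0 \<in> K" "\<And>y. y \<in> K \<Longrightarrow> cmod (unit_exp y0 - 1) \<le> cmod (unit_exp y - 1)"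
      using continuous_attains_inf[OF _ False] by metis
    have "y0 \<notin> \<int>"
    proof
      assume "y0 \<in> \<int>"
      then obtain n :: int where n: "y0 = of_int n" by (elim Ints_cases)
      have "\<bar>y0\<bar> < 1" "y0 \<noteq> 0" using y0(1) \<open>\<epsilon> > 0\<close> unfolding K_def by auto
      then show False using n by simp
    qed
    then have "cmod (unit_exp y0 - 1) > 0" using unit_exp_eq_1_iff by simp
    then show thesis using that y0(2) by blast
  qed (use that[of 1] in auto)
  show thesis
  proof (rule that[OF \<delta>(1)])
    fix t assume t: "cmod (unit_exp t - 1) < \<delta>"
    define y where "y = t - of_int (round t)"
    have "unit_exp y = unit_exp t"
      using unit_exp_add_of_int[of t "- round t"] by (simp add: y_def)
    then have "y \<notin> K" using \<delta>(2) t by force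
    moreover have "\<bar>y\<bar> \<le> 1/2"
      using of_int_round_abs_le[of t] by (simp add: y_def abs_minus_commute)
    ultimately have "\<bar>y\<bar> < \<epsilon>" unfolding K_def by auto
    then show "\<exists>z::int. \<bar>t - of_int z\<bar> < \<epsilon>" unfolding y_def by blast
  qed
qed

lemma norm_geometric_sum_le:
  fixes z :: complex
  assumes "cmod z = 1" "z \<noteq> 1"
  shows "cmod (\<Sum>n<N. z ^ n) \<le> 2 / cmod (z - 1)"
proof -
  have "cmod (z ^ N - 1) \<le> 2"
    using norm_triangle_ineq4[of "z ^ N" 1] assms(1) by (simp add: norm_power)
  then show ?thesis
    using assms by (simp add: geometric_sum norm_divide divide_right_mono)
qed

definition mean_tends_to_0 :: "(nat \<Rightarrow> complex) \<Rightarrow> bool" where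
  "mean_tends_to_0 u \<longleftrightarrow> (\<lambda>N. (\<Sum>n<N. u n) / of_nat N) \<longlonglongrightarrow> 0"

lemma cauchy_schwarz_sum_norm:
  fixes w :: "nat \<Rightarrow> complex"
  shows "(cmod (\<Sum>n<N. w n))\<^sup>2 \<le> real N * (\<Sum>n<N. (cmod (w n))\<^sup>2)"
proof -
  have "(cmod (\<Sum>n<N. w n))\<^sup>2 \<le> (\<Sum>n<N. cmod (w n))\<^sup>2"
    by (intro power_mono norm_sum) simp
  also have "\<dots> \<le> (\<Sum>n<N. 1) * (\<Sum>n<N. (cmod (w n))\<^sup>2)"
    using Cauchy_Schwarz_ineq_sum[of "\<lambda>_. 1" "\<lambda>n. cmod (w n)" "{..<N}"] by simp
  finally show ?thesis by simp
qed

lemma norm_shifted_sum_diff: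
  fixes u :: "nat \<Rightarrow> complex"
  assumes "\<And>n. cmod (u n) \<le> 1"
  shows "cmod ((\<Sum>n<N. u (n + h)) - (\<Sum>n<N. u n)) \<le> 2 * real h"
proof (induction h)
  case (Suc h)
  have "(\<Sum>n<N. u (n + Suc h)) - (\<Sum>n<N. u (n + h)) = u (N + h) - u h"
    using sum_lessThan_telescope[of "\<lambda>n. u (n + h)" N] by (simp add: sum_subtractf)
  then have "cmod ((\<Sum>n<N. u (n + Suc h)) - (\<Sum>n<N. u (n + h))) \<le> 2"
    using norm_triangle_ineq4[of "u (N + h)" "u h"] assms[of "N + h"] assms[of h] by simp
  then have "cmod (((\<Sum>n<N. u (n + Suc h)) - (\<Sum>n<N. u (n + h))) + ((\<Sum>n<N. u (n + h)) - (\<Sum>n<N. u n)))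
      \<le> 2 + 2 * real h"
    by (intro order_trans[OF norm_triangle_ineq] add_mono Suc.IH)
  then show ?case by simp
qed simp

text \<open>Replacing the sum of \<open>u\<close> by its average over \<open>H\<close> shifts costs
  a bounded amount for fixed \<open>H\<close>. Cauchy-Schwarz turns the square of that average into
  correlations, of which only the \<open>H\<close> diagonal ones out of \<open>H\<^sup>2\<close>
  survive for large \<open>N\<close>; this leaves a mean of order one over the square root of
  \<open>H\<close>.\<close>

lemma van_der_corput:
  fixes u :: "nat \<Rightarrow> complex"
  assumes le1: "\<And>n. cmod (u n) \<le> 1"
    and corr: "\<And>h h'. h \<noteq> h' \<Longrightarrow> mean_tends_to_0 (\<lambda>n. u (n + h) * cnj (u (n + h')))"
  shows "mean_tends_to_0 u"
  unfolding mean_tends_to_0_def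
proof (rule LIMSEQ_I)
  fix \<epsilon> :: real assume "\<epsilon> > 0"
  \<comment> \<open>\<open>H\<close> is large enough for
    \<open>2 * H * N\<^sup>2 < (\<epsilon>/2 * H * N)\<^sup>2\<close>, which bounds the main term.
    Below, \<open>N1\<close> bounds the off-diagonal correlations by 1 in total, and
    \<open>N2\<close> absorbs the shift error \<open>2 * H\<close>.\<close>
  obtain H0 :: nat where H0: "4 / (\<epsilon>/2)\<^sup>2 < real H0" using reals_Archimedean2 by blast
  define H where "H = Suc H0"
  have H: "H > 0" "4 / (\<epsilon>/2)\<^sup>2 < real H" using H0 by (auto simp: H_def)
  define w where "w n = (\<Sum>h<H. u (n + h))" for n
  define c where "c N h h' = (\<Sum>n<N. u (n + h) * cnj (u (n + h'))) / of_nat N" for N h h'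
  have "(\<lambda>N. \<Sum>h<H. \<Sum>h'<H. if h = h' then 0 else c N h h') \<longlonglongrightarrow> (\<Sum>h<H. \<Sum>h'<H. 0)"
  proof (intro tendsto_sum)
    fix h h'
    show "(\<lambda>N. if h = h' then 0 else c N h h') \<longlonglongrightarrow> 0"
      using corr[of h h'] by (cases "h = h'") (auto simp: c_def mean_tends_to_0_def)
  qed
  then have "(\<lambda>N. \<Sum>h<H. \<Sum>h'<H. if h = h' then 0 else c N h h') \<longlonglongrightarrow> 0" by simp
  from LIMSEQ_D[OF this zero_less_one] obtain N1
    where N1: "\<And>N. N \<ge> N1 \<Longrightarrow> cmod (\<Sum>h<H. \<Sum>h'<H. if h = h' then 0 else c N h h') < 1" by auto
  obtain N2 :: nat where N2: "4 * real H / \<epsilon> < real N2" using reals_Archimedean2 by blast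
  have "cmod ((\<Sum>n<N. u n) / of_nat N) < \<epsilon>" if N: "N \<ge> max N1 N2" for N
  proof -
    have Npos: "real N > 0"
      using N2 N \<open>\<epsilon> > 0\<close> H by (smt (verit) divide_nonneg_pos max.bounded_iff of_nat_0_le_iff of_nat_mono)
    have eq: "of_real (\<Sum>n<N. (cmod (w n))\<^sup>2) / of_nat N = (\<Sum>h<H. \<Sum>h'<H. c N h h')"
    proof -
      have "of_real (\<Sum>n<N. (cmod (w n))\<^sup>2) = (\<Sum>n<N. w n * cnj (w n))"
        by (simp only: of_real_sum complex_norm_square)
      also have "\<dots> = (\<Sum>n<N. \<Sum>h<H. \<Sum>h'<H. u (n + h) * cnj (u (n + h')))"
        by (simp add: w_def sum_product)
      also have "\<dots> = (\<Sum>h<H. \<Sum>h'<H. \<Sum>n<N. u (n + h) * cnj (u (n + h')))"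
      by (rule trans[OF sum.swap]) (rule sum.cong[OF refl], rule sum.swap)
      finally show ?thesis by (simp only: c_def sum_divide_distrib [symmetric])
    qed
    have diag: "(\<Sum>h'<H. c N h h') = c N h h + (\<Sum>h'<H. if h = h' then 0 else c N h h')" if "h < H" for h
    proof -
      have "(\<Sum>h'<H. c N h h')
          = (\<Sum>h'<H. (if h' = h then c N h h' else 0) + (if h = h' then 0 else c N h h'))"
        by (rule sum.cong) auto
      also have "\<dots> = (\<Sum>h'<H. if h' = h then c N h h' else 0)
          + (\<Sum>h'<H. if h = h' then 0 else c N h h')"
        by (rule sum.distrib)
      finally show ?thesis using that by (simp only: sum.delta finite_lessThan lessThan_iff if_True)
    qed
    have "cmod (c N h h) \<le> 1" for h
    proof -
      have "cmod (\<Sum>n<N. u (n + h) * cnj (u (n + h))) \<le> (\<Sum>n<N. 1)"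
        by (intro order_trans[OF norm_sum] sum_mono) (simp add: norm_mult mult_le_one le1)
      then show ?thesis using Npos by (simp add: c_def norm_divide)
    qed
    then have "cmod (\<Sum>h<H. c N h h) \<le> (\<Sum>h<H. 1)"
      by (intro order_trans[OF norm_sum] sum_mono) auto
    moreover have "(\<Sum>h<H. \<Sum>h'<H. c N h h') = (\<Sum>h<H. c N h h) + (\<Sum>h<H. \<Sum>h'<H. if h = h' then 0 else c N h h')"
      by (simp add: diag sum.distrib)
    ultimately have "cmod (\<Sum>h<H. \<Sum>h'<H. c N h h') \<le> real H + 1"
      using N1[of N] N norm_triangle_ineq[of "\<Sum>h<H. c N h h" "\<Sum>h<H. \<Sum>h'<H. if h = h' then 0 else c N h h'"]
      by simp
    then have "cmod (of_real (\<Sum>n<N. (cmod (w n))\<^sup>2) / of_nat N) \<le> real H + 1"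
      by (simp only: eq)
    moreover have "cmod (of_real (\<Sum>n<N. (cmod (w n))\<^sup>2) / of_nat N) = (\<Sum>n<N. (cmod (w n))\<^sup>2) / real N"
      by (simp only: norm_divide norm_of_real norm_of_nat) (simp add: sum_nonneg)
    ultimately have "(\<Sum>n<N. (cmod (w n))\<^sup>2) / real N \<le> real H + 1"
      by simp
    then have sq: "(\<Sum>n<N. (cmod (w n))\<^sup>2) \<le> (real H + 1) * real N"
      using Npos by (simp add: pos_divide_le_eq)
    have b1: "(cmod (\<Sum>n<N. w n))\<^sup>2 \<le> real N * ((real H + 1) * real N)"
      by (rule order_trans[OF cauchy_schwarz_sum_norm mult_left_mono[OF sq]]) simp
    have b2: "real N * ((real H + 1) * real N) \<le> 2 * real H * (real N)\<^sup>2"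
    proof -
      have "(real H + 1) * (real N * real N) \<le> 2 * real H * (real N * real N)"
        using H(1) by (intro mult_right_mono) auto
      then show ?thesis by (simp only: power2_eq_square mult_ac)
    qed
    have b3: "2 * real H * (real N)\<^sup>2 < (\<epsilon>/2 * real H * real N)\<^sup>2"
    proof -
      have "4 < real H * (\<epsilon>/2)\<^sup>2"
        using H(2) \<open>\<epsilon> > 0\<close> pos_divide_less_eq[of "(\<epsilon>/2)\<^sup>2" 4 "real H"] by (metis half_gt_zero zero_less_power)
      then have "2 * real H * (real N)\<^sup>2 < (real H * (\<epsilon>/2)\<^sup>2) * real H * (real N)\<^sup>2"
        using H(1) Npos by (intro mult_strict_right_mono) auto
      moreover have "(x * y * z)\<^sup>2 = (y * x\<^sup>2) * y * z\<^sup>2" for x y z :: real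
        by (simp add: power2_eq_square)
      ultimately show ?thesis by metis
    qed
    have wle: "cmod (\<Sum>n<N. w n) < \<epsilon>/2 * real H * real N"
      using \<open>\<epsilon> > 0\<close> by (intro power2_less_imp_less[OF le_less_trans[OF b1 le_less_trans[OF b2 b3]]]) auto
    have "(\<Sum>n<N. w n) = (\<Sum>h<H. \<Sum>n<N. u (n + h))"
      unfolding w_def by (rule sum.swap)
    then have "of_nat H * (\<Sum>n<N. u n) - (\<Sum>n<N. w n) = (\<Sum>h<H. (\<Sum>n<N. u n) - (\<Sum>n<N. u (n + h)))"
      by (simp add: sum_subtractf)
    also have "cmod \<dots> \<le> (\<Sum>h<H. 2 * real H)"
    proof (intro order_trans[OF norm_sum] sum_mono)
      fix h assume "h \<in> {..<H}"
      then show "cmod ((\<Sum>n<N. u n) - (\<Sum>n<N. u (n + h))) \<le> 2 * real H"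
        using norm_shifted_sum_diff[where u = u and N = N and h = h, OF le1] by (simp add: norm_minus_commute)
    qed
    finally have "cmod (of_nat H * (\<Sum>n<N. u n)) \<le> 2 * real H * real H + cmod (\<Sum>n<N. w n)"
      using norm_triangle_ineq2[of "of_nat H * (\<Sum>n<N. u n)" "\<Sum>n<N. w n"] by simp
    then have "real H * cmod (\<Sum>n<N. u n) < real H * (2 * real H + \<epsilon>/2 * real N)"
      using wle by (simp add: norm_mult algebra_simps)
    then have "cmod (\<Sum>n<N. u n) < 2 * real H + \<epsilon>/2 * real N"
      using H by simp
    moreover have "2 * real H \<le> \<epsilon>/2 * real N"
    proof -
      have "4 * real H / \<epsilon> < real N" using N2 N by (metis less_le_trans max.bounded_iff of_nat_le_iff)
      then show ?thesis using \<open>\<epsilon> > 0\<close> by (simp add: pos_divide_less_eq algebra_simps)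
    qed
    ultimately show ?thesis using Npos by (simp add: norm_divide pos_divide_less_eq)
  qed
  then show "\<exists>no. \<forall>N\<ge>no. norm ((\<Sum>n<N. u n) / of_nat N - 0) < \<epsilon>" by (intro exI[of _ "max N1 N2"]) simp
qed

lemma coeff_pcompose_shift:
  fixes p :: "real poly"
  shows "coeff (pcompose p [:c, 1:]) k = (\<Sum>i\<le>degree p. coeff p i * (of_nat (i choose k) * c ^ (i - k)))"
proof -
  have "pcompose p [:c, 1:] = (\<Sum>i\<le>degree p. smult (coeff p i) ([:c, 1:] ^ i))"
    by (simp add: pcompose_altdef poly_altdef coeff_map_poly degree_map_poly smult_conv_map_poly)
  moreover have "coeff ([:c, 1:] ^ i) k = of_nat (i choose k) * c ^ (i - k)" for i
    by (cases "k \<le> i") (simp_all add: coeff_linear_poly_power coeff_eq_0 degree_power_eq binomial_eq_0)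
  ultimately show ?thesis by (simp add: coeff_sum)
qed

text \<open>The shifts agree above degree \<open>d\<close>, and in degree \<open>d\<close> the
  binomial expansion leaves \<open>Suc d * (c - c')\<close> times the leading coefficient. So the
  degree drops by exactly one, and for integer shifts an irrational leading coefficient stays
  irrational.\<close>

lemma degree_shift_diff:
  fixes p :: "real poly"
  assumes "degree p = Suc d" "c \<noteq> c'"
  defines "q \<equiv> pcompose p [:c, 1:] - pcompose p [:c', 1:]"
  shows "degree q = d" "lead_coeff q = real (Suc d) * (c - c') * lead_coeff p"
proof -
  have *: "coeff (pcompose p [:c, 1:]) d = coeff p d + coeff p (Suc d) * (real (Suc d) * c)" for c
  proof -
    have "coeff (pcompose p [:c, 1:]) d = (\<Sum>i\<in>{d, Suc d}. coeff p i * (of_nat (i choose d) * c ^ (i - d)))"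
      unfolding coeff_pcompose_shift assms(1)
      by (rule sum.mono_neutral_right) (auto simp: binomial_eq_0)
    then show ?thesis by simp
  qed
  have **: "coeff (pcompose p [:c, 1:]) k = coeff p k" if "k > d" for k c
  proof -
    have "coeff (pcompose p [:c, 1:]) k = (\<Sum>i\<in>{Suc d}. coeff p i * (of_nat (i choose k) * c ^ (i - k)))"
      unfolding coeff_pcompose_shift assms(1)
      by (rule sum.mono_neutral_right) (use that in \<open>auto simp: binomial_eq_0\<close>)
    also have "\<dots> = coeff p k"
      using that assms(1) by (cases "k = Suc d") (auto simp: binomial_eq_0 coeff_eq_0)
    finally show ?thesis .
  qed
  have d: "coeff q d = real (Suc d) * (c - c') * lead_coeff p"
    unfolding q_def coeff_diff * using assms(1) by (simp add: algebra_simps)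
  have "lead_coeff p \<noteq> 0" using assms(1) by (metis degree_0 leading_coeff_0_iff nat.distinct(1))
  then have "coeff q d \<noteq> 0" using d assms(2) by simp
  moreover have "coeff q k = 0" if "k > d" for k
    using ** that by (simp add: q_def)
  ultimately show "degree q = d"
    by (metis le_degree linorder_not_less not_less_iff_gr_or_eq leading_coeff_0_iff degree_0 less_nat_zero_code coeff_0)
  then show "lead_coeff q = real (Suc d) * (c - c') * lead_coeff p" using d by simp
qed

lemma Rats_mult_cancel:
  fixes x :: real
  assumes "q * x \<in> \<rat>" "q \<in> \<rat>" "q \<noteq> 0"
  shows "x \<in> \<rat>"
  using Rats_divide[OF assms(1,2)] assms(3) by simp

text \<open>Correlating the sequence with a shift of itself replaces \<open>p\<close> by a
  difference of two shifts of \<open>p\<close>, so \<open>van_der_corput\<close> lowers the degree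
  by one. In degree one the sums are geometric.\<close>

lemma weyl_polynomial_mean:
  fixes p :: "real poly"
  assumes "degree p = Suc d" "lead_coeff p \<notin> \<rat>"
  shows "mean_tends_to_0 (\<lambda>n. unit_exp (poly p (real n)))"
  using assms
proof (induction d arbitrary: p)
  case 0
  then obtain a b where p: "p = [:b, a:]"
    by (metis One_nat_def degree_eq_zeroE degree_pCons_eq_if nat.inject pCons_cases zero_neq_one)
  then have "a \<notin> \<rat>" using 0 by (simp split: if_splits)
  then have "a \<notin> \<int>" using Ints_subset_Rats by blast
  then have z: "unit_exp a \<noteq> 1" by (simp add: unit_exp_eq_1_iff)
  define C where "C = 2 / cmod (unit_exp a - 1)"
  have "(\<Sum>n<N. unit_exp (poly p (real n))) = unit_exp b * (\<Sum>n<N. unit_exp a ^ n)" for N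
    by (simp add: p unit_exp_add unit_exp_of_nat_mult sum_distrib_left)
  then have le: "cmod ((\<Sum>n<N. unit_exp (poly p (real n))) / of_nat N) \<le> C * inverse (real N)" for N
    using divide_right_mono[OF norm_geometric_sum_le[OF _ z, of N], of "real N"]
    by (simp add: norm_mult norm_divide C_def) (simp add: divide_inverse mult_ac)
  have lim: "(\<lambda>N. C * inverse (real N)) \<longlonglongrightarrow> 0"
    using tendsto_mult[OF tendsto_const[of C] lim_inverse_n[where 'a = real]] by simp
  show ?case
    unfolding mean_tends_to_0_def
    by (rule Lim_null_comparison[OF always_eventually[OF allI[OF le]] lim])
next
  case (Suc d)
  show ?case
  proof (rule van_der_corput)
    fix h h' :: nat assume hh: "h \<noteq> h'"
    define q where "q = pcompose p [:real h, 1:] - pcompose p [:real h', 1:]"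
    have deg: "degree q = Suc d" "lead_coeff q = real (Suc (Suc d)) * (real h - real h') * lead_coeff p"
      using degree_shift_diff[OF Suc.prems(1), of "real h" "real h'"] hh unfolding q_def by auto
    have "lead_coeff q \<notin> \<rat>"
    proof
      assume "lead_coeff q \<in> \<rat>"
      then have "lead_coeff p \<in> \<rat>"
        unfolding deg(2) by (rule Rats_mult_cancel) (use hh in \<open>auto intro!: Rats_mult Rats_diff\<close>)
      then show False using Suc.prems by simp
    qed
    from Suc.IH[OF deg(1) this]
    have "mean_tends_to_0 (\<lambda>n. unit_exp (poly q (real n)))" .
    then show "mean_tends_to_0 (\<lambda>n. unit_exp (poly p (real (n + h))) * cnj (unit_exp (poly p (real (n + h')))))"
      by (simp add: q_def poly_pcompose unit_exp_diff add.commute)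
  qed simp
qed

text \<open>The average of the Fejer kernel \<open>\<bar>\<Sum>j<K. unit_exp (j * x)\<bar>\<^sup>2\<close> along the sequence would tend
  to \<open>K\<close>, but the kernel is bounded independently of \<open>K\<close> away from the integers.\<close>

lemma ex_near_int_of_means:
  fixes p :: "nat \<Rightarrow> real"
  assumes means: "\<And>k::nat. k > 0 \<Longrightarrow> mean_tends_to_0 (\<lambda>n. unit_exp (real k * p n))"
    and "\<epsilon> > 0"
  shows "\<exists>n. \<exists>z::int. \<bar>p n - of_int z\<bar> < \<epsilon>"
proof (rule ccontr)
  assume neg: "\<not> ?thesis"
  obtain \<delta> where \<delta>: "\<delta> > 0" "\<And>t. cmod (unit_exp t - 1) < \<delta> \<Longrightarrow> \<exists>z::int. \<bar>t - of_int z\<bar> < \<epsilon>"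
    using unit_exp_near_1[OF \<open>\<epsilon> > 0\<close>] by metis
  have far: "\<delta> \<le> cmod (unit_exp (p n) - 1)" for n
    using \<delta>(2)[of "p n"] neg by force
  obtain K :: nat where K: "(2 / \<delta>)\<^sup>2 < real K" using reals_Archimedean2 by blast
  define s where "s n = (\<Sum>j<K. unit_exp (p n) ^ j)" for n
  have s_le: "(cmod (s n))\<^sup>2 \<le> (2 / \<delta>)\<^sup>2" for n
  proof -
    have "unit_exp (p n) \<noteq> 1" using far[of n] \<delta>(1) by auto
    then have "cmod (s n) \<le> 2 / cmod (unit_exp (p n) - 1)"
      unfolding s_def by (intro norm_geometric_sum_le) auto
    also have "\<dots> \<le> 2 / \<delta>" using far[of n] \<delta>(1) by (intro divide_left_mono mult_pos_pos) auto
    finally show ?thesis by (intro power_mono) auto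
  qed
  have corr: "(\<lambda>N. (\<Sum>n<N. unit_exp (p n) ^ j * cnj (unit_exp (p n) ^ j')) / of_nat N)
      \<longlonglongrightarrow> (if j = j' then 1 else 0)" for j j'
  proof -
    have eq: "unit_exp (p n) ^ j * cnj (unit_exp (p n) ^ j') = unit_exp ((real j - real j') * p n)" for n
      by (simp add: left_diff_distrib unit_exp_diff unit_exp_of_nat_mult)
    consider "j = j'" | "j > j'" | "j < j'" by linarith
    then show ?thesis
    proof cases
      case 1
      have "(\<lambda>N. (of_nat N :: complex) / of_nat N) \<longlonglongrightarrow> 1"
        by (rule tendsto_eventually) (auto simp: eventually_sequentially intro!: exI[of _ 1])
      then show ?thesis using 1 unfolding eq by (simp add: unit_exp_def)
    next
      case 2
      then show ?thesis
        using means[of "j - j'"] unfolding eq mean_tends_to_0_def by (simp add: of_nat_diff)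
    next
      case 3
      then have "(\<lambda>N. cnj ((\<Sum>n<N. unit_exp (real (j' - j) * p n)) / of_nat N)) \<longlonglongrightarrow> cnj 0"
        using means[of "j' - j"] unfolding mean_tends_to_0_def by (intro tendsto_cnj) auto
      moreover have "cnj (unit_exp (real (j' - j) * p n)) = unit_exp ((real j - real j') * p n)" for n
        using 3 by (simp add: unit_exp_def cis_cnj of_nat_diff algebra_simps)
      ultimately show ?thesis using 3 unfolding eq by simp
    qed
  qed
  have "(\<lambda>N. \<Sum>j<K. \<Sum>j'<K. (\<Sum>n<N. unit_exp (p n) ^ j * cnj (unit_exp (p n) ^ j')) / of_nat N)
      \<longlonglongrightarrow> (\<Sum>j<K. \<Sum>j'<K. if j = j' then 1 else 0)"
    by (intro tendsto_sum corr)
  moreover have "(\<Sum>j<K. \<Sum>j'<K. (\<Sum>n<N. unit_exp (p n) ^ j * cnj (unit_exp (p n) ^ j')) / of_nat N)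
      = of_real ((\<Sum>n<N. (cmod (s n))\<^sup>2) / real N)" for N
  proof -
    have "of_real (\<Sum>n<N. (cmod (s n))\<^sup>2) = (\<Sum>n<N. s n * cnj (s n))"
      by (simp only: of_real_sum complex_norm_square)
    also have "\<dots> = (\<Sum>n<N. \<Sum>j<K. \<Sum>j'<K. unit_exp (p n) ^ j * cnj (unit_exp (p n) ^ j'))"
      by (simp add: s_def sum_product)
    also have "\<dots> = (\<Sum>j<K. \<Sum>j'<K. \<Sum>n<N. unit_exp (p n) ^ j * cnj (unit_exp (p n) ^ j'))"
      by (rule trans[OF sum.swap]) (rule sum.cong[OF refl], rule sum.swap)
    finally show ?thesis by (simp only: sum_divide_distrib [symmetric] of_real_divide of_real_of_nat_eq)
  qed
  moreover have "(\<Sum>j<K. \<Sum>j'<K. if j = j' then 1 else 0) = (complex_of_real (real K))" by simp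
  ultimately have "(\<lambda>N. complex_of_real ((\<Sum>n<N. (cmod (s n))\<^sup>2) / real N)) \<longlonglongrightarrow> of_real (real K)"
    by simp
  then have "(\<lambda>N. (\<Sum>n<N. (cmod (s n))\<^sup>2) / real N) \<longlonglongrightarrow> real K"
    by (simp only: tendsto_of_real_iff)
  moreover have "(\<Sum>n<N. (cmod (s n))\<^sup>2) / real N \<le> (2 / \<delta>)\<^sup>2" for N
  proof (cases "N = 0")
    case False
    have "(\<Sum>n<N. (cmod (s n))\<^sup>2) \<le> (\<Sum>n<N. (2 / \<delta>)\<^sup>2)" by (intro sum_mono s_le)
    then show ?thesis using False by (simp add: pos_divide_le_eq mult.commute)
  qed simp
  ultimately have "real K \<le> (2 / \<delta>)\<^sup>2"
    by (intro LIMSEQ_le_const2[of _ "real K"]) auto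
  then show False using K by simp
qed

text \<open>As a polynomial in \<open>t\<close> the phase has leading coefficient
  \<open>\<alpha> * N ^ l\<close>, whose positive integer multiples are all irrational, so Weyl's
  theorem covers every frequency of the Fejer kernel.\<close>

lemma ex_power_multiple_near_int:
  fixes \<alpha> :: real
  assumes "\<alpha> \<notin> \<rat>" "l > 0" "N > 0" "\<epsilon> > 0"
  shows "\<exists>t::nat. \<exists>z::int. \<bar>\<alpha> * real (1 + N * t) ^ l - of_int z\<bar> < \<epsilon>"
proof -
  define p :: "real poly" where "p = smult \<alpha> ([:1, real N:] ^ l)"
  have "\<alpha> \<noteq> 0" using assms(1) by auto
  have [simp]: "lead_coeff ([:1, real N:] ^ l) = real N ^ l"
    using assms(3) by (subst lead_coeff_power) simp
  have "mean_tends_to_0 (\<lambda>n. unit_exp (real k * poly p (real n)))" if "k > 0" for k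
  proof -
    have deg: "degree (smult (real k) p) = Suc (l - 1)"
      using that \<open>\<alpha> \<noteq> 0\<close> assms(2,3) by (simp add: p_def degree_power_eq)
    have "lead_coeff (smult (real k) p) = (real k * real N ^ l) * \<alpha>"
      using that by (simp add: p_def)
    then have "lead_coeff (smult (real k) p) \<notin> \<rat>"
      using assms(1,3) that Rats_mult_cancel[of "real k * real N ^ l" \<alpha>] by (auto simp: mult.assoc)
    from weyl_polynomial_mean[OF deg this] show ?thesis by simp
  qed
  from ex_near_int_of_means[OF this \<open>\<epsilon> > 0\<close>] show ?thesis
    by (simp add: p_def poly_power mult.commute)
qed

section \<open>Simultaneous recurrence of powers and polynomials modulo 1\<close>

lemma ex_convergent_subseq_finite:
  fixes f :: "'i \<Rightarrow> nat \<Rightarrow> real"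
  assumes "finite I" "\<And>i n. i \<in> I \<Longrightarrow> \<bar>f i n\<bar> \<le> B"
  obtains r where "strict_mono r" "\<And>i. i \<in> I \<Longrightarrow> convergent (f i \<circ> r)"
  using assms
proof (induction I arbitrary: thesis rule: finite_induct)
  case empty
  then show ?case using strict_mono_id by blast
next
  case (insert i I)
  obtain r where r: "strict_mono r" "\<And>j. j \<in> I \<Longrightarrow> convergent (f j \<circ> r)"
    using insert.IH insert.prems(2) by blast
  have "bounded (range (f i \<circ> r))"
    using insert.prems(2) by (auto simp: bounded_iff)
  then obtain l s where s: "strict_mono s" "((f i \<circ> r) \<circ> s) \<longlonglongrightarrow> l"
    using bounded_imp_convergent_subsequence by metis
  have "convergent (f j \<circ> (r \<circ> s))" if "j \<in> insert i I" for j
  proof (cases "j = i")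
    case True
    then show ?thesis using s(2) by (auto simp: comp_assoc convergent_def)
  next
    case False
    then show ?thesis
      using convergent_subseq_convergent[OF r(2) s(1)] that by (simp add: comp_assoc)
  qed
  then show ?case using insert.prems(1) strict_mono_o[OF r(1) s(1)] by blast
qed

text \<open>\<open>\<beta>\<close> lies in the closure modulo 1 of the orbit of
  \<open>\<alpha>\<close> under the multipliers \<open>m = 1 + N * t\<close>, where \<open>m\<close>
  acts on coordinate \<open>i\<close> through \<open>m ^ l i\<close>, as a dilation acts on a
  coefficient of degree \<open>l i\<close>.\<close>

definition power_reaches ::
  "nat \<Rightarrow> 'i set \<Rightarrow> ('i \<Rightarrow> nat) \<Rightarrow> ('i \<Rightarrow> real) \<Rightarrow> ('i \<Rightarrow> real) \<Rightarrow> bool" where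
  "power_reaches N I l \<alpha> \<beta> \<longleftrightarrow>
     (\<forall>\<epsilon>>0. \<exists>t::nat. \<forall>i\<in>I. \<exists>z::int. \<bar>\<alpha> i * real (1 + N * t) ^ l i - \<beta> i - of_int z\<bar> < \<epsilon>)"

lemma power_reaches_refl: "power_reaches N I l \<alpha> \<alpha>"
  unfolding power_reaches_def by (intro allI impI exI[of _ 0] ballI) simp

text \<open>The multipliers are closed under products. The one leading from \<open>\<beta>\<close>
  to \<open>\<gamma>\<close> is fixed first, because it magnifies the error in approximating
  \<open>\<beta>\<close> by up to \<open>S\<close>.\<close>

lemma power_reaches_trans:
  assumes "finite I" "power_reaches N I l \<alpha> \<beta>" "power_reaches N I l \<beta> \<gamma>"
  shows "power_reaches N I l \<alpha> \<gamma>"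
  unfolding power_reaches_def
proof (intro allI impI)
  fix \<epsilon> :: real assume "\<epsilon> > 0"
  then obtain t where t: "\<And>i. i \<in> I \<Longrightarrow> \<exists>z::int. \<bar>\<beta> i * real (1 + N * t) ^ l i - \<gamma> i - of_int z\<bar> < \<epsilon> / 2"
    using assms(3) unfolding power_reaches_def by (meson half_gt_zero)
  define m where "m = real (1 + N * t)"
  define S where "S = (\<Sum>i\<in>I. m ^ l i) + 1"
  have m: "m > 0" by (simp add: m_def add_pos_nonneg)
  then have S: "S > 0" unfolding S_def by (intro add_nonneg_pos sum_nonneg) auto
  have mS: "m ^ l i \<le> S" if "i \<in> I" for i
    using member_le_sum[OF that, of "\<lambda>i. m ^ l i"] assms(1) m by (simp add: S_def)
  obtain s where s: "\<And>i. i \<in> I \<Longrightarrow> \<exists>z::int. \<bar>\<alpha> i * real (1 + N * s) ^ l i - \<beta> i - of_int z\<bar> < \<epsilon> / (2 * S)"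
    using assms(2) S \<open>\<epsilon> > 0\<close> unfolding power_reaches_def by (meson divide_pos_pos mult_pos_pos zero_less_numeral)
  show "\<exists>t. \<forall>i\<in>I. \<exists>z::int. \<bar>\<alpha> i * real (1 + N * t) ^ l i - \<gamma> i - of_int z\<bar> < \<epsilon>"
  proof (intro exI[of _ "s + t + N * s * t"] ballI)
    fix i assume i: "i \<in> I"
    obtain z z' :: int where z: "\<bar>\<alpha> i * real (1 + N * s) ^ l i - \<beta> i - of_int z\<bar> < \<epsilon> / (2 * S)"
      and z': "\<bar>\<beta> i * m ^ l i - \<gamma> i - of_int z'\<bar> < \<epsilon> / 2"
      using s[OF i] t[OF i] unfolding m_def by blast
    define w :: int where "w = z * int (1 + N * t) ^ l i + z'"
    have w: "of_int w = of_int z * m ^ l i + of_int z'" by (simp add: w_def m_def)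
    have prod: "real (1 + N * (s + t + N * s * t)) = real (1 + N * s) * m"
      by (simp add: m_def algebra_simps)
    have split: "a * (u * v) - g - (x * v + y) = (a * u - b - x) * v + (b * v - g - y)"
      for a u v g x y b :: real by (simp add: algebra_simps)
    have "\<alpha> i * real (1 + N * (s + t + N * s * t)) ^ l i - \<gamma> i - of_int w
        = (\<alpha> i * real (1 + N * s) ^ l i - \<beta> i - of_int z) * m ^ l i + (\<beta> i * m ^ l i - \<gamma> i - of_int z')"
      unfolding prod w power_mult_distrib by (rule split)
    also have "\<bar>\<dots>\<bar> \<le> \<bar>\<alpha> i * real (1 + N * s) ^ l i - \<beta> i - of_int z\<bar> * m ^ l i + \<bar>\<beta> i * m ^ l i - \<gamma> i - of_int z'\<bar>"
      using m by (intro order_trans[OF abs_triangle_ineq]) (simp add: abs_mult)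
    also have "\<dots> < \<epsilon> / (2 * S) * S + \<epsilon> / 2"
      using z z' mS[OF i] m by (intro add_le_less_mono mult_mono) auto
    also have "\<dots> = \<epsilon>" using S by simp
    finally show "\<exists>z::int. \<bar>\<alpha> i * real (1 + N * (s + t + N * s * t)) ^ l i - \<gamma> i - of_int z\<bar> < \<epsilon>" by blast
  qed
qed

text \<open>Multipliers that bring coordinate \<open>i0\<close> close to the integers are thinned
  out until all coordinates converge modulo 1. A rational coordinate with denominator
  \<open>b\<close> never leaves the closed set of multiples of \<open>1 / b\<close>, so rationality
  once gained is not lost.\<close>

lemma power_reaches_step:
  assumes "finite I" "N > 0" "i0 \<in> I" "\<alpha> i0 \<notin> \<rat>" "l i0 > 0"
  obtains \<beta> where "power_reaches N I l \<alpha> \<beta>" "\<beta> i0 \<in> \<rat>" "\<And>i. i \<in> I \<Longrightarrow> \<alpha> i \<in> \<rat> \<Longrightarrow> \<beta> i \<in> \<rat>"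
proof -
  have "\<exists>t::nat. \<exists>z::int. \<bar>\<alpha> i0 * real (1 + N * t) ^ l i0 - of_int z\<bar> < inverse (real (Suc n))" for n
    using ex_power_multiple_near_int[OF assms(4,5,2)] by simp
  then obtain t :: "nat \<Rightarrow> nat" and z :: "nat \<Rightarrow> int"
    where tz: "\<And>n. \<bar>\<alpha> i0 * real (1 + N * t n) ^ l i0 - of_int (z n)\<bar> < inverse (real (Suc n))"
    by metis
  define x where "x i n = \<alpha> i * real (1 + N * t n) ^ l i" for i n
  have "\<bar>frac (x i n)\<bar> \<le> 1" for i n
    using frac_lt_1[of "x i n"] by (simp add: abs_of_nonneg less_imp_le)
  then obtain r where r: "strict_mono r" "\<And>i. i \<in> I \<Longrightarrow> convergent ((\<lambda>n. frac (x i n)) \<circ> r)"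
    using ex_convergent_subseq_finite[OF assms(1), of "\<lambda>i n. frac (x i n)" 1] by metis
  define \<beta> where "\<beta> i = lim ((\<lambda>n. frac (x i n)) \<circ> r)" for i
  have lim: "(\<lambda>n. frac (x i (r n))) \<longlonglongrightarrow> \<beta> i" if "i \<in> I" for i
    using r(2)[OF that] by (simp add: \<beta>_def convergent_LIMSEQ_iff o_def)
  show thesis
  proof (rule that)
    show "power_reaches N I l \<alpha> \<beta>"
      unfolding power_reaches_def
    proof (intro allI impI)
      fix \<epsilon> :: real assume "\<epsilon> > 0"
      then have "\<forall>\<^sub>F n in sequentially. \<forall>i\<in>I. \<bar>frac (x i (r n)) - \<beta> i\<bar> < \<epsilon>"
        using lim tendstoD by (intro eventually_ball_finite assms(1) ballI) (fastforce simp: dist_real_def)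
      then obtain n where n: "\<And>i. i \<in> I \<Longrightarrow> \<bar>frac (x i (r n)) - \<beta> i\<bar> < \<epsilon>"
        by (auto simp: eventually_sequentially)
      show "\<exists>t. \<forall>i\<in>I. \<exists>z::int. \<bar>\<alpha> i * real (1 + N * t) ^ l i - \<beta> i - of_int z\<bar> < \<epsilon>"
      proof (intro exI[of _ "t (r n)"] ballI)
        fix i assume "i \<in> I"
        from n[OF this] show "\<exists>z::int. \<bar>\<alpha> i * real (1 + N * t (r n)) ^ l i - \<beta> i - of_int z\<bar> < \<epsilon>"
          by (intro exI[of _ "\<lfloor>x i (r n)\<rfloor>"]) (simp add: frac_def x_def algebra_simps)
      qed
    qed
    have "(\<lambda>n. frac (x i0 (r n)) - of_int (z (r n) - \<lfloor>x i0 (r n)\<rfloor>)) \<longlonglongrightarrow> 0"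
    proof (rule Lim_null_comparison[OF always_eventually[OF allI]])
      fix n
      have "norm (frac (x i0 (r n)) - of_int (z (r n) - \<lfloor>x i0 (r n)\<rfloor>)) \<le> inverse (real (Suc (r n)))"
        using tz[of "r n"] by (simp add: frac_def x_def)
      also have "\<dots> \<le> inverse (real (Suc n))"
        using seq_suble[OF r(1), of n] by (intro le_imp_inverse_le) auto
      finally show "norm (frac (x i0 (r n)) - of_int (z (r n) - \<lfloor>x i0 (r n)\<rfloor>)) \<le> inverse (real (Suc n))" .
    qed (rule LIMSEQ_inverse_real_of_nat)
    from tendsto_diff[OF lim[OF assms(3)] this]
    have "(\<lambda>n. of_int (z (r n) - \<lfloor>x i0 (r n)\<rfloor>)) \<longlonglongrightarrow> \<beta> i0" by simp
    then have "\<beta> i0 \<in> \<int>"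
      by (rule closed_sequentially[OF closed_Ints Ints_of_int])
    then show "\<beta> i0 \<in> \<rat>" using Ints_subset_Rats by blast
    fix i assume i: "i \<in> I" and "\<alpha> i \<in> \<rat>"
    then obtain a b :: int where ab: "b \<noteq> 0" "\<alpha> i = of_int a / of_int b"
      by (metis Rats_cases' less_irrefl)
    have "of_int b * frac (x i n) \<in> \<int>" for n
    proof -
      have "of_int b * frac (x i n) = of_int (a * int (1 + N * t n) ^ l i - b * \<lfloor>x i n\<rfloor>)"
        using ab by (simp add: frac_def x_def algebra_simps)
      then show ?thesis by (metis Ints_of_int)
    qed
    then have "of_int b * \<beta> i \<in> \<int>"
      by (rule closed_sequentially[OF closed_Ints _ tendsto_mult[OF tendsto_const lim[OF i]]])
    then have "of_int b * \<beta> i \<in> \<rat>" using Ints_subset_Rats by blast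
    then show "\<beta> i \<in> \<rat>" by (rule Rats_mult_cancel) (use ab(1) in simp_all)
  qed
qed

text \<open>Treating one irrational coordinate at a time avoids joint equidistribution, which can
  fail for rationally dependent coefficients.\<close>

lemma power_reaches_rational:
  fixes \<alpha> :: "'i \<Rightarrow> real"
  assumes "finite I" "N > 0" "\<And>i. i \<in> I \<Longrightarrow> l i > 0"
  obtains \<rho> where "power_reaches N I l \<alpha> \<rho>" "\<And>i. i \<in> I \<Longrightarrow> \<rho> i \<in> \<rat>"
proof -
  have "\<exists>\<rho>. power_reaches N I l \<alpha> \<rho> \<and> (\<forall>i\<in>I. \<rho> i \<in> \<rat>)"
  proof (induction "card {i\<in>I. \<alpha> i \<notin> \<rat>}" arbitrary: \<alpha> rule: less_induct)
    case less
    show ?case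
    proof (cases "\<forall>i\<in>I. \<alpha> i \<in> \<rat>")
      case True
      then show ?thesis using power_reaches_refl by blast
    next
      case False
      then obtain i0 where i0: "i0 \<in> I" "\<alpha> i0 \<notin> \<rat>" by blast
      obtain \<beta> where \<beta>: "power_reaches N I l \<alpha> \<beta>" "\<beta> i0 \<in> \<rat>" "\<And>i. i \<in> I \<Longrightarrow> \<alpha> i \<in> \<rat> \<Longrightarrow> \<beta> i \<in> \<rat>"
        using power_reaches_step[where \<alpha> = \<alpha> and l = l, OF assms(1,2) i0 assms(3)[OF i0(1)]] by metis
      have "{i\<in>I. \<beta> i \<notin> \<rat>} \<subset> {i\<in>I. \<alpha> i \<notin> \<rat>}" using \<beta> i0 by blast
      then have "card {i\<in>I. \<beta> i \<notin> \<rat>} < card {i\<in>I. \<alpha> i \<notin> \<rat>}"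
        using assms(1) by (intro psubset_card_mono) auto
      from less[OF this] obtain \<rho> where "power_reaches N I l \<beta> \<rho>" "\<forall>i\<in>I. \<rho> i \<in> \<rat>" by blast
      then show ?thesis using power_reaches_trans[OF assms(1) \<beta>(1)] by blast
    qed
  qed
  then show thesis using that by blast
qed

section \<open>Antidifferences and rational values of polynomials\<close>

text \<open>The first difference of the monomial \<open>P\<close> has the degree and leading
  coefficient of \<open>q\<close>, by \<open>degree_shift_diff\<close>; subtracting it lowers the
  degree.\<close>

lemma poly_antidifference:
  fixes q :: "real poly"
  obtains Q where "\<And>x. poly Q (x + 1) - poly Q x = poly q x"
proof -
  have "\<exists>Q. \<forall>x. poly Q (x + 1) - poly Q x = poly q x"
  \<comment> \<open>The measure ranks 0 below the nonzero constants, which have the same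
    degree.\<close>
  proof (induction "if q = 0 then 0 else Suc (degree q)" arbitrary: q rule: less_induct)
    case less
    show ?case
    proof (cases "q = 0")
      case True
      then show ?thesis by (intro exI[of _ 0]) simp
    next
      case False
      define d where "d = degree q"
      define P where "P = monom (lead_coeff q / real (Suc d)) (Suc d)"
      have P: "degree P = Suc d" "lead_coeff P = lead_coeff q / real (Suc d)"
        using False by (simp_all add: P_def degree_monom_eq)
      define D where "D = pcompose P [:1, 1:] - pcompose P [:0, 1:]"
      have D: "degree D = d" "lead_coeff D = lead_coeff q"
        using degree_shift_diff[OF P(1), of 1 0] P(2) unfolding D_def by auto
      have "q - D = 0 \<or> degree (q - D) < d"
        by (metis D d_def eq_iff_diff_eq_0 leading_coeff_0_iff degree_diff_le le_neq_implies_less le_refl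
            coeff_diff)
      then have "(if q - D = 0 then 0 else Suc (degree (q - D))) < (if q = 0 then 0 else Suc (degree q))"
        using False by (auto simp: d_def)
      from less[OF this] obtain Q where Q: "\<And>x. poly Q (x + 1) - poly Q x = poly (q - D) x"
        by blast
      have "poly (Q + P) (x + 1) - poly (Q + P) x = poly q x" for x
        using Q[of x] by (simp add: D_def poly_pcompose algebra_simps)
      then show ?thesis by blast
    qed
  qed
  then show thesis using that by blast
qed

text \<open>Divide \<open>P - P(n0)\<close> by \<open>x - n0\<close>, where \<open>n0\<close> is an
  integer with a rational value. The quotient is rational at all other such integers, so the degree
  drops while infinitely many points remain.\<close>

lemma poly_rational_values:
  fixes P :: "real poly"
  assumes "infinite {n::int. poly P (of_int n) \<in> \<rat>}"
  shows "coeff P i \<in> \<rat>"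
  using assms
proof (induction "degree P" arbitrary: P i)
  case 0
  then obtain c where c: "P = [:c:]" by (metis degree_eq_zeroE)
  then have "c \<in> \<rat>" using 0(2) by (auto split: if_splits)
  then show ?case using c by (cases i) (auto simp: coeff_pCons)
next
  case (Suc d)
  obtain n0 :: int where n0: "poly P (of_int n0) \<in> \<rat>"
    using Suc.prems by (metis (mono_tags, lifting) Collect_empty_eq finite.emptyI)
  define Q where "Q = synthetic_div P (of_int n0)"
  have P: "P = [:- of_int n0, 1:] * Q + [:poly P (of_int n0):]"
    unfolding Q_def using synthetic_div_correct'[of "of_int n0" P] by simp
  have deg: "d = degree Q" using Suc.hyps(2) by (simp add: Q_def degree_synthetic_div)
  have "{n::int. poly P (of_int n) \<in> \<rat>} - {n0} \<subseteq> {n. poly Q (of_int n) \<in> \<rat>}"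
  proof
    fix n assume n: "n \<in> {n::int. poly P (of_int n) \<in> \<rat>} - {n0}"
    have "(of_int n - of_int n0) * poly Q (of_int n) = poly P (of_int n) - poly P (of_int n0)"
      using arg_cong[OF P, of "\<lambda>p. poly p (of_int n)"] by (simp add: algebra_simps)
    moreover have "poly P (of_int n) - poly P (of_int n0) \<in> \<rat>" using n n0 by simp
    ultimately have "(of_int n - of_int n0) * poly Q (of_int n) \<in> \<rat>" by simp
    then have "poly Q (of_int n) \<in> \<rat>" by (rule Rats_mult_cancel) (use n in simp_all)
    then show "n \<in> {n. poly Q (of_int n) \<in> \<rat>}" by simp
  qed
  then have "infinite {n::int. poly Q (of_int n) \<in> \<rat>}"
    using Suc.prems by (meson finite_subset infinite_remove)
  from Suc.hyps(1)[OF deg this] have Q: "coeff Q j \<in> \<rat>" for j .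
  have "coeff ([:- of_int n0, 1:] * Q + [:poly P (of_int n0):]) i \<in> \<rat>"
    using Q n0 by (cases i) (auto simp: coeff_pCons split: nat.splits)
  then show ?case by (simp only: P[symmetric])
qed

section \<open>Sequences with integral or vanishing iterated differences\<close>

definition fdiff :: "'a::ab_group_add \<Rightarrow> ('a \<Rightarrow> 'b::ab_group_add) \<Rightarrow> 'a \<Rightarrow> 'b" where
  "fdiff h f x = f (x + h) - f x"

lemma int_step_const_mod:
  fixes q :: "int \<Rightarrow> real"
  assumes "\<And>t. q (t + 1) - q t \<in> \<int>"
  shows "q t - q 0 \<in> \<int>"
proof (induction t rule: int_induct[where k = 0])
  case (step1 i)
  then show ?case using Ints_add[OF assms[of i] step1(2)] by simp
next
  case (step2 i)
  then show ?case using Ints_diff[OF step2(2) assms[of "i - 1"]] by simp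
qed simp

text \<open>The first difference of \<open>p\<close> is a polynomial modulo 1 by induction.
  Subtracting an antidifference of it leaves a sequence with integral steps, which is constant
  modulo 1.\<close>

lemma poly_mod_1_of_fdiff:
  fixes p :: "int \<Rightarrow> real"
  assumes "\<And>t. (fdiff 1 ^^ m) p t \<in> \<int>"
  obtains Q where "\<And>t. p t - poly Q (of_int t) \<in> \<int>"
proof -
  have "\<exists>Q. \<forall>t. p t - poly Q (of_int t) \<in> \<int>"
    using assms
  proof (induction m arbitrary: p)
    case 0
    then show ?case by (intro exI[of _ 0]) simp
  next
    case (Suc m)
    have "(fdiff 1 ^^ m) (fdiff 1 p) t \<in> \<int>" for t
      using Suc.prems by (simp add: funpow_swap1)
    then obtain Q' where Q': "\<And>t. fdiff 1 p t - poly Q' (of_int t) \<in> \<int>" using Suc.IH by blast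
    obtain Q where Q: "\<And>x. poly Q (x + 1) - poly Q x = poly Q' x" using poly_antidifference by blast
    define q where "q t = p t - poly Q (of_int t)" for t
    have "q (t + 1) - q t \<in> \<int>" for t
      using Q'[of t] Q[of "of_int t"] by (simp add: q_def fdiff_def algebra_simps)
    then have "q t - q 0 \<in> \<int>" for t by (rule int_step_const_mod)
    then show ?case
      by (intro exI[of _ "Q + [:q 0:]"]) (simp add: q_def algebra_simps)
  qed
  then show thesis using that by blast
qed

text \<open>Differences of a bounded sequence are bounded, so by induction the first difference is
  constant. Then the sequence is affine, and boundedness leaves only slope 0.\<close>

lemma bounded_fdiff_zero_const:
  fixes p :: "int \<Rightarrow> real"
  assumes "\<And>t. (fdiff 1 ^^ m) p t = 0" "\<And>t. \<bar>p t\<bar> \<le> B" "m > 0"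
  shows "p t = p 0"
  using assms
proof (induction m arbitrary: p B t)
  case (Suc m)
  have step: "p (t + 1) - p t = 0" for t
  proof (cases "m = 0")
    case True
    then show ?thesis using Suc.prems(1)[of t] by (simp add: fdiff_def)
  next
    case False
    have "(fdiff 1 ^^ m) (fdiff 1 p) t = 0" for t
      using Suc.prems(1) by (simp add: funpow_swap1)
    moreover have "\<bar>fdiff 1 p t\<bar> \<le> 2 * B" for t
      using Suc.prems(2)[of t] Suc.prems(2)[of "t + 1"] by (simp add: fdiff_def)
    ultimately have const: "fdiff 1 p t = fdiff 1 p 0" for t using Suc.IH False by blast
    define c where "c = fdiff 1 p 0"
    have lin: "p (int n) = p 0 + real n * c" for n
    proof (induction n)
      case (Suc n)
      then show ?case using const[of "int n"] by (simp add: fdiff_def c_def algebra_simps)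
    qed simp
    have "c = 0"
    proof (rule ccontr)
      assume "c \<noteq> 0"
      obtain n :: nat where "2 * B / \<bar>c\<bar> < real n" using reals_Archimedean2 by blast
      then have "2 * B < \<bar>real n * c\<bar>" using \<open>c \<noteq> 0\<close> by (simp add: pos_divide_less_eq abs_mult)
      then show False using lin[of n] Suc.prems(2)[of "int n"] Suc.prems(2)[of 0] by linarith
    qed
    then show ?thesis using const[of t] by (simp add: c_def fdiff_def)
  qed
  show ?case
  proof (induction t rule: int_induct[where k = 0])
    case (step1 i)
    then show ?case using step[of i] by simp
  next
    case (step2 i)
    then show ?case using step[of "i - 1"] by simp
  qed simp
qed simp

section \<open>Dilations of tilings\<close>

text \<open>Convolution with \<open>insert f0 F\<close> is translation by \<open>f0\<close> plus
  convolution with \<open>F\<close>; these two operators commute, and this is their binomial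
  theorem.\<close>

lemma conv_pow_insert:
  fixes b :: "'d::finite lattice \<Rightarrow> int"
  defines "conv \<equiv> \<lambda>F (b :: 'd lattice \<Rightarrow> int) x. \<Sum>f\<in>F. b (x - f)"
  assumes "finite F" "f0 \<notin> F"
  shows "(conv (insert f0 F) ^^ n) b x = (\<Sum>k\<le>n. int (n choose k) * (conv F ^^ (n - k)) b (x - int k *s f0))"
proof (induction n arbitrary: x)
  case (Suc n)
  define h where "h k x = (conv F ^^ (Suc n - k)) b (x - int k *s f0)" for k x
  have *: "(\<Sum>f\<in>F. (conv F ^^ (n - k)) b (x - f - int k *s f0)) = h k x" if "k \<le> n" for k x
    using that by (simp add: h_def Suc_diff_le conv_def diff_diff_eq add.commute)
  have "(conv (insert f0 F) ^^ Suc n) b x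
      = (conv (insert f0 F) ^^ n) b (x - f0) + (\<Sum>f\<in>F. (conv (insert f0 F) ^^ n) b (x - f))"
    using assms by (simp add: conv_def)
  also have "(conv (insert f0 F) ^^ n) b (x - f0) = (\<Sum>k\<le>n. int (n choose k) * h (Suc k) x)"
    unfolding Suc.IH h_def
    by (intro sum.cong refl) (simp add: vector_sadd_rdistrib diff_diff_eq)
  also have "(\<Sum>f\<in>F. (conv (insert f0 F) ^^ n) b (x - f)) = (\<Sum>k\<le>n. int (n choose k) * h k x)"
    unfolding Suc.IH by (subst sum.swap) (simp add: sum_distrib_left[symmetric] *)
  also have "(\<Sum>k\<le>n. int (n choose k) * h (Suc k) x) + (\<Sum>k\<le>n. int (n choose k) * h k x)
      = (\<Sum>k\<le>Suc n. int (Suc n choose k) * h k x)"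
  proof -
    have "(\<Sum>k\<le>n. int (n choose k) * h k x) = (\<Sum>k\<le>Suc n. int (n choose k) * h k x)" by simp
    also have "\<dots> = h 0 x + (\<Sum>k\<le>n. int (n choose Suc k) * h (Suc k) x)"
      by (subst sum.atMost_Suc_shift) simp
    finally show ?thesis
      by (subst sum.atMost_Suc_shift) (simp add: sum.distrib distrib_right)
  qed
  finally show ?case by (simp add: h_def)
qed simp

text \<open>The Frobenius identity in the group ring of the lattice: modulo a prime, the
  \<open>p\<close>-th power of a sum of group elements is the sum of their \<open>p\<close>-th
  powers.\<close>

lemma conv_pow_prime_cong:
  fixes b :: "'d::finite lattice \<Rightarrow> int"
  assumes "finite F" "prime (p::nat)"
  shows "int p dvd ((\<lambda>b x. \<Sum>f\<in>F. b (x - f)) ^^ p) b x - (\<Sum>f\<in>F. b (x - int p *s f))"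
  using assms(1)
proof (induction F arbitrary: x rule: finite_induct)
  case empty
  have "p > 0" using assms(2) prime_gt_0_nat by blast
  then obtain q where "p = Suc q" by (cases p) auto
  then show ?case by simp
next
  case (insert f0 F)
  let ?conv = "\<lambda>F (b :: 'd lattice \<Rightarrow> int) x. \<Sum>f\<in>F. b (x - f)"
  let ?t = "\<lambda>k. int (p choose k) * (?conv F ^^ (p - k)) b (x - int k *s f0)"
  have p: "p > 0" using assms(2) prime_gt_0_nat by blast
  then have "{..p} = insert 0 (insert p {1..<p})" by auto
  then have "(?conv (insert f0 F) ^^ p) b x = (?conv F ^^ p) b x + b (x - int p *s f0) + (\<Sum>k\<in>{1..<p}. ?t k)"
    using p by (subst conv_pow_insert[OF insert.hyps]) simp
  moreover have "int p dvd (\<Sum>k\<in>{1..<p}. ?t k)"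
    using assms(2) by (intro dvd_sum dvd_mult2) (auto intro!: dvd_choose_prime)
  ultimately have "int p dvd ((?conv (insert f0 F) ^^ p) b x - (\<Sum>f\<in>insert f0 F. b (x - int p *s f)))"
    using insert.IH[of x] insert.hyps
    by (simp add: algebra_simps) (metis (no_types, lifting) add_diff_eq diff_add_eq dvd_add add.commute)
  then show ?case .
qed

lemma conv_pow_const:
  assumes "\<And>x::'d::finite lattice. (\<Sum>f\<in>F. b (x - f)) = (1::int)"
  shows "((\<lambda>b x. \<Sum>f\<in>F. b (x - f)) ^^ Suc n) b x = int (card F) ^ n"
proof (induction n arbitrary: x)
  case (Suc n)
  then show ?case by (subst funpow.simps) (simp del: funpow.simps)
qed (simp add: assms)

text \<open>Modulo \<open>p\<close> the sum over the dilated set is the \<open>p\<close>-th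
  convolution power of \<open>a\<close>, which equals \<open>card F ^ (p - 1)\<close> and hence 1.
  Since it also lies between 0 and \<open>card F < p\<close>, it is 1 exactly.\<close>

lemma tiling_dilate_prime:
  fixes a :: "'d::finite lattice \<Rightarrow> int"
  assumes F: "finite F" "F \<noteq> {}" and p: "prime p" "card F < p"
    and a01: "\<And>x. a x \<in> {0, 1}" and tile: "\<And>x. (\<Sum>f\<in>F. a (x - f)) = 1"
  shows "(\<Sum>f\<in>F. a (x - int p *s f)) = 1"
proof -
  define s where "s = (\<Sum>f\<in>F. a (x - int p *s f))"
  have c: "card F > 0" using F by (simp add: card_gt_0_iff)
  then have "\<not> p dvd card F" using p by (auto dest: dvd_imp_le)
  then have cop: "coprime (int p) (int (card F))"
    using p(1) by (simp add: prime_imp_coprime)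
  obtain q where q: "p = Suc q" using p(2) by (cases p) auto
  have 1: "int p dvd int (card F) ^ q - s"
    using conv_pow_prime_cong[OF F(1) p(1), of a x] conv_pow_const[OF tile, of q x]
    unfolding q[symmetric] s_def by simp
  \<comment> \<open>Fermat's little theorem, from the same congruence applied to the constant
    function 1.\<close>
  have "((\<lambda>b x. \<Sum>f\<in>F. b (x - f)) ^^ n) (\<lambda>_. 1) x = int (card F) ^ n" for n and x :: "'d lattice"
    by (induction n arbitrary: x) auto
  then have "int p dvd int (card F) ^ p - int (card F)"
    using conv_pow_prime_cong[OF F(1) p(1), of "\<lambda>_. 1" x] by simp
  then have "int p dvd int (card F) * (int (card F) ^ q - 1)"
    by (simp add: q algebra_simps)
  then have "int p dvd int (card F) ^ q - 1"
    using cop coprime_dvd_mult_right_iff by blast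
  from dvd_diff[OF this 1] have dvd: "int p dvd s - 1" by simp
  have "0 \<le> s" unfolding s_def using a01 by (intro sum_nonneg) (metis insertE order_refl singletonD zero_le_one)
  moreover have "s \<le> (\<Sum>f\<in>F. 1)"
    unfolding s_def using a01 by (intro sum_mono) (metis insertE order_refl singletonD zero_le_one)
  ultimately have "\<bar>s - 1\<bar> < int p" using p(2) c by simp
  then have "s - 1 = 0" using dvd by (metis dvd_imp_le_int linorder_not_less abs_of_nat)
  then show ?thesis by (simp add: s_def)
qed

text \<open>A dilate of \<open>F\<close> that tiles with \<open>a\<close> has as many elements as
  \<open>F\<close>, so the prime case applies to it again; the prime factors of \<open>M\<close> are
  used up one by one.\<close>

lemma tiling_dilate:
  fixes a :: "'d::finite lattice \<Rightarrow> int"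
  assumes F: "finite F" "F \<noteq> {}" and "M > 0" and "\<And>p. prime p \<Longrightarrow> p dvd M \<Longrightarrow> card F < p"
    and a01: "\<And>x. a x \<in> {0, 1}" and tile: "\<And>x. (\<Sum>f\<in>F. a (x - f)) = 1"
  shows "(\<Sum>f\<in>F. a (x - int M *s f)) = 1"
  using assms(3,4)
proof (induction M arbitrary: x rule: prime_divisors_induct)
  case (factor p M)
  then have M: "M > 0" "prime p" by auto
  have IH: "(\<Sum>f\<in>F. a (x - int M *s f)) = 1" for x
    using factor.prems by (intro factor.IH M) auto
  define G where "G = (\<lambda>f. int M *s f) ` F"
  have inj: "inj_on (\<lambda>f. int M *s f) F" for F :: "'d lattice set"
    using M by (auto simp: inj_on_def vec_eq_iff)
  have G: "finite G" "G \<noteq> {}" "card G = card F"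
    using F by (auto simp: G_def card_image[OF inj])
  have "(\<Sum>f\<in>G. a (x - f)) = 1" for x
    unfolding G_def using IH by (subst sum.reindex[OF inj]) simp
  from tiling_dilate_prime[OF G(1,2) M(2) _ a01 this]
  have "(\<Sum>f\<in>G. a (x - int p *s f)) = 1"
    using G(3) factor.prems M by auto
  then show ?case
    unfolding G_def by (subst (asm) sum.reindex[OF inj]) (simp add: vector_smult_assoc)
next
  case (unit M)
  then show ?case using tile by simp
qed simp

section \<open>Weakly periodic tilings\<close>

definition lattice_hom :: "('d::finite lattice \<Rightarrow> int) \<Rightarrow> bool" where
  "lattice_hom k \<longleftrightarrow> (\<forall>x y. k (x + y) = k x + k y)"

definition invariant_along :: "int \<Rightarrow> ('d::finite lattice \<Rightarrow> int) \<Rightarrow> ('d lattice \<Rightarrow> 'b) \<Rightarrow> bool" where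
  "invariant_along N k f \<longleftrightarrow> (\<forall>x y. k y = 0 \<longrightarrow> f (x + N *s y) = f x)"

definition periodic_mod :: "int \<Rightarrow> ('d::finite lattice \<Rightarrow> 'b) \<Rightarrow> bool" where
  "periodic_mod N f \<longleftrightarrow> (\<forall>x y. f (x + N *s y) = f x)"

text \<open>For nonzero homomorphisms into the integers, one kernel is contained in another only if
  the two are proportional. So the last clause asks for pairwise nonproportional members, that is,
  for distinct kernels.\<close>

definition directions :: "('d::finite lattice \<Rightarrow> int) set \<Rightarrow> bool" where
  "directions K \<longleftrightarrow> finite K \<and> (\<forall>k\<in>K. lattice_hom k \<and> (\<exists>x. k x \<noteq> 0)) \<and>
     (\<forall>k\<in>K. \<forall>l\<in>K. k \<noteq> l \<longrightarrow> (\<exists>u. l u = 0 \<and> k u \<noteq> 0))"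

definition vmod :: "int \<Rightarrow> 'd::finite lattice \<Rightarrow> 'd lattice" where
  "vmod N x = (\<chi> i. x $ i mod N)"

lemma lattice_hom_add: "lattice_hom k \<Longrightarrow> k (x + y) = k x + k y"
  by (simp add: lattice_hom_def)

lemma lattice_hom_0: "lattice_hom k \<Longrightarrow> k 0 = 0"
  using lattice_hom_add[of k 0 0] by simp

lemma lattice_hom_diff: "lattice_hom k \<Longrightarrow> k (x - y) = k x - k y"
  using lattice_hom_add[of k "x - y" y] by simp

lemma lattice_hom_scale:
  assumes "lattice_hom k"
  shows "k (c *s x) = c * k x"
proof (induction c rule: int_induct[where k = 0])
  case base
  then show ?case using lattice_hom_0[OF assms] by simp
next
  case (step1 i)
  then show ?case using lattice_hom_add[OF assms, of "i *s x" x]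
    by (simp add: vector_sadd_rdistrib distrib_right)
next
  case (step2 i)
  then show ?case using lattice_hom_diff[OF assms, of "i *s x" x]
    by (simp add: vector_sub_rdistrib left_diff_distrib)
qed

lemmas lattice_hom_simps = lattice_hom_add lattice_hom_0 lattice_hom_diff lattice_hom_scale

lemma vmod_decomp: "x = vmod N x + N *s (\<chi> i. x $ i div N)"
  by (simp add: vec_eq_iff vmod_def)

lemma vmod_eqD:
  assumes "vmod N x = vmod N y"
  obtains z where "x = y + N *s z"
proof
  let ?q = "\<lambda>v :: (int, 'a) vec. \<chi> i. v $ i div N"
  show "x = y + N *s (?q x - ?q y)"
    unfolding vec_eq_iff
  proof
    fix i
    have "x $ i mod N = y $ i mod N" using assms by (auto simp: vmod_def vec_eq_iff)
    then show "x $ i = (y + N *s (?q x - ?q y)) $ i"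
      using mult_div_mod_eq[of N "x $ i"] mult_div_mod_eq[of N "y $ i"]
      by (simp only: vector_add_component vector_smult_component vector_minus_component vec_lambda_beta
          right_diff_distrib)
  qed
qed

lemma vmod_add_scale [simp]: "vmod N (x + N *s y) = vmod N x"
  by (simp add: vec_eq_iff vmod_def)

lemma finite_range_vmod: "N > 0 \<Longrightarrow> finite (range (vmod N :: 'd::finite lattice \<Rightarrow> _))"
proof -
  assume "N > 0"
  then have "range (vmod N :: 'd lattice \<Rightarrow> _) \<subseteq> vec_lambda ` (\<Pi>\<^sub>E i\<in>UNIV. {0..<N})"
    by (auto simp: vmod_def PiE_def extensional_def)
  then show ?thesis by (rule finite_subset) (intro finite_imageI finite_PiE, auto)
qed

lemma invariant_along_mono:
  assumes "invariant_along N k f" "lattice_hom k" "N dvd N'"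
  shows "invariant_along N' k f"
proof -
  obtain c where "N' = N * c" using assms(3) by (elim dvdE)
  then show ?thesis
    using assms(1,2) unfolding invariant_along_def
    by (metis lattice_hom_scale mult_zero_right vector_smult_assoc)
qed

lemma periodic_mod_mono:
  assumes "periodic_mod N f" "N dvd N'"
  shows "periodic_mod N' f"
proof -
  obtain c where "N' = N * c" using assms(2) by (elim dvdE)
  then show ?thesis
    using assms(1) unfolding periodic_mod_def by (metis vector_smult_assoc)
qed

text \<open>Points of one coset differ by some \<open>N *s z\<close>, and equal levels give
  \<open>k z = 0\<close>. Such a function therefore lives on finitely many copies of the integers,
  one for each coset.\<close>

lemma invariant_along_cong:
  assumes "invariant_along N k f" "lattice_hom k" "N \<noteq> 0" "vmod N x = vmod N y" "k x = k y"
  shows "f x = f y"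
proof -
  obtain z where z: "x = y + N *s z" using vmod_eqD[OF assms(4)] by blast
  then have "k z = 0" using assms by (simp add: lattice_hom_simps)
  then show ?thesis using assms(1) z by (simp add: invariant_along_def)
qed

section \<open>Mixed differences along lattice vectors\<close>

abbreviation fdiffs :: "'a::ab_group_add list \<Rightarrow> ('a \<Rightarrow> 'b::ab_group_add) \<Rightarrow> 'a \<Rightarrow> 'b" where
  "fdiffs hs \<equiv> foldr fdiff hs"

lemma fdiffs_sum: "fdiffs hs (\<lambda>x. \<Sum>l\<in>K. g l x) = (\<lambda>x. \<Sum>l\<in>K. fdiffs hs (g l) x)"
  by (induction hs) (simp_all add: fun_eq_iff fdiff_def sum_subtractf)

lemma fdiffs_diff: "fdiffs hs (\<lambda>x. f x - g x) = (\<lambda>x. fdiffs hs f x - fdiffs hs g x)"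
  by (induction hs) (simp_all add: fun_eq_iff fdiff_def)

lemma fdiffs_invariant:
  assumes "\<And>x. f (x + h) = f x"
  shows "fdiffs hs f (x + h) = fdiffs hs f x"
  by (induction hs arbitrary: x) (simp_all add: fdiff_def assms, metis add.assoc add.commute)

lemma fdiffs_zero:
  assumes "\<And>x. f (x + h) = f x" "h \<in> set hs"
  shows "fdiffs hs f x = 0"
  using assms(2)
proof (induction hs arbitrary: x)
  case (Cons h' hs)
  then show ?case
    using fdiffs_invariant[of f h hs x, OF assms(1)] fdiff_def[of h' "fdiffs hs f" x] by auto
qed simp

lemma fdiffs_Ints:
  assumes "\<And>x. f x \<in> \<int>"
  shows "fdiffs hs f x \<in> \<int>"
  by (induction hs arbitrary: x) (auto simp: fdiff_def assms)

lemma fdiff_pow_sequence: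
  fixes f :: "'d::finite lattice \<Rightarrow> 'b::ab_group_add"
  shows "(fdiff 1 ^^ m) (\<lambda>t::int. f (x + t *s v)) t = (fdiff v ^^ m) f (x + t *s v)"
  by (induction m arbitrary: t) (simp_all add: fdiff_def vector_sadd_rdistrib add.assoc)

text \<open>A difference in a direction \<open>u \<in> ker l\<close> kills the \<open>l\<close>-invariant summand. All the steps \<open>u\<close> used
  for the other directions \<open>l\<close> have the same level \<open>k u = k h\<close>, so on the \<open>k\<close>-invariant summand they
  act as the difference by \<open>h\<close>.\<close>

lemma isolate_direction:
  fixes K :: "('d::finite lattice \<Rightarrow> int) set"
  assumes K: "directions K" and k: "k \<in> K"
  obtains h hs where "k h > 0" "hs \<noteq> []" "\<And>v. v \<in> set hs \<Longrightarrow> \<exists>y. v = N *s y"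
    "\<And>(g :: _ \<Rightarrow> _ \<Rightarrow> real) x. (\<And>l. l \<in> K \<Longrightarrow> invariant_along N l (g l)) \<Longrightarrow>
        (fdiff (N *s h) ^^ card K) (g k) x = fdiffs hs (\<lambda>x. \<Sum>l\<in>K. g l x) x"
proof -
  have fin: "finite K" and hom: "\<And>l. l \<in> K \<Longrightarrow> lattice_hom l" using K by (auto simp: directions_def)
  obtain h0 where h0: "k h0 \<noteq> 0" using K k by (auto simp: directions_def)
  have "\<forall>l\<in>K - {k}. \<exists>u. l u = 0 \<and> k u \<noteq> 0" using K k by (auto simp: directions_def)
  then obtain u where u: "\<And>l. l \<in> K - {k} \<Longrightarrow> l (u l) = 0 \<and> k (u l) \<noteq> 0" by metis
  \<comment> \<open>A common multiple of \<open>k h0\<close> and all the \<open>k (u l)\<close>, so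
    that every step can be rescaled to the same level \<open>D\<close>.\<close>
  define D where "D = \<bar>k h0\<bar> * (\<Prod>l\<in>K - {k}. \<bar>k (u l)\<bar>)"
  have "D > 0" unfolding D_def using h0 u by (intro mult_pos_pos prod_pos) auto
  define h where "h = (D div k h0) *s h0"
  have kh: "k h = D" using h0 by (simp add: h_def lattice_hom_scale[OF hom[OF k]] D_def)
  define v where "v l = (D div k (u l)) *s u l" for l
  have v: "l (v l) = 0" "k (v l) = D" if "l \<in> K - {k}" for l
  proof -
    have "k (u l) dvd (\<Prod>l\<in>K - {k}. \<bar>k (u l)\<bar>)"
      using that fin dvd_prodI[of "K - {k}" l "\<lambda>l. \<bar>k (u l)\<bar>"] by simp
    then have "k (u l) dvd D" by (simp add: D_def)
    then show "l (v l) = 0" "k (v l) = D"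
      using u[OF that] that lattice_hom_scale[OF hom[OF k], of _ "u l"] lattice_hom_scale[OF hom, of l _ "u l"]
      by (simp_all add: v_def)
  qed
  obtain ls where ls: "set ls = K - {k}" "distinct ls"
    using finite_distinct_list[of "K - {k}"] fin by auto
  \<comment> \<open>The additional step along \<open>N *s h\<close> is present even if
    \<open>k\<close> is the only direction; it annihilates constant and \<open>N\<close>-periodic
    terms.\<close>
  define hs where "hs = N *s h # map (\<lambda>l. N *s v l) ls"
  have len: "length hs = card K"
    using ls(1) distinct_card[OF ls(2)] card_Suc_Diff1[OF fin k] by (simp add: hs_def)
  show thesis
  proof (rule that)
    show "k h > 0" using kh \<open>D > 0\<close> by simp
    show "hs \<noteq> []" by (simp add: hs_def)
    show "\<exists>y. w = N *s y" if "w \<in> set hs" for w using that by (auto simp: hs_def)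
    fix g :: "_ \<Rightarrow> _ \<Rightarrow> real" and x
    assume g: "\<And>l. l \<in> K \<Longrightarrow> invariant_along N l (g l)"
    have "fdiffs hs (g l) x = 0" if "l \<in> K - {k}" for l
    proof (rule fdiffs_zero)
      show "g l (x + N *s v l) = g l x" for x
        using g[of l] that v(1)[OF that] by (auto simp: invariant_along_def)
      show "N *s v l \<in> set hs" using that ls(1) by (auto simp: hs_def)
    qed
    then have sum: "fdiffs hs (\<lambda>x. \<Sum>l\<in>K. g l x) x = fdiffs hs (g k) x"
      unfolding fdiffs_sum using k fin by (simp add: sum.remove[of K k])
    have pow: "fdiffs ws (g k) = (fdiff (N *s h) ^^ length ws) (g k)"
      if "set ws \<subseteq> {N *s w |w. k w = D}" for ws
      using that
    proof (induction ws)
      case (Cons w ws)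
      then obtain w' where w': "w = N *s w'" "k w' = D" by auto
      have inv: "fdiffs ws (g k) (x + N *s y) = fdiffs ws (g k) x" if "k y = 0" for x y
        using that g[OF k] by (intro fdiffs_invariant) (auto simp: invariant_along_def)
      have eq: "fdiff w (fdiffs ws (g k)) = fdiff (N *s h) (fdiffs ws (g k))"
      proof
        fix x
        have "x + w = (x + N *s h) + N *s (w' - h)"
          by (simp add: w' vector_ssub_ldistrib)
        then show "fdiff w (fdiffs ws (g k)) x = fdiff (N *s h) (fdiffs ws (g k)) x"
          using inv[of "w' - h" "x + N *s h"] w' kh hom[OF k] by (simp add: fdiff_def lattice_hom_diff)
      qed
      then show ?case using Cons by simp
    qed simp
    have "fdiffs hs (g k) = (fdiff (N *s h) ^^ card K) (g k)"
    proof -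
      have "set hs \<subseteq> {N *s w |w. k w = D}" using v ls kh by (auto simp: hs_def)
      from pow[OF this] show ?thesis by (simp only: len)
    qed
    then show "(fdiff (N *s h) ^^ card K) (g k) x = fdiffs hs (\<lambda>x. \<Sum>l\<in>K. g l x) x"
      using sum by simp
  qed
qed

text \<open>By invariance a window of levels shows only finitely many patterns, so two windows far
  apart agree. The strip between them is cut out and repeated. As the windows are wide enough for
  \<open>F\<close>, every sum over \<open>F\<close> is taken inside a translate of \<open>a\<close>
  along \<open>h\<close>, and by \<open>bh\<close> such translations do not change the sums.\<close>

lemma replace_by_periodic:
  fixes a :: "'d::finite lattice \<Rightarrow> int"
  assumes k: "lattice_hom k" and N: "N > 0" and F: "finite F"
    and a01: "\<And>x. a x \<in> {0, 1}" and inv: "invariant_along N k a"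
    and h: "k h > 0" and bh: "\<And>x. (\<Sum>f\<in>F. a (x + h - f)) = (\<Sum>f\<in>F. a (x - f))"
  obtains a' E where "E > 0" "\<And>x. a' x \<in> {0, 1}" "periodic_mod E a'"
    "\<And>x. (\<Sum>f\<in>F. a' (x - f)) = (\<Sum>f\<in>F. a (x - f))"
proof -
  define R where "R = (\<Sum>f\<in>F. \<bar>k f\<bar>) + 1"
  have R: "\<bar>k f\<bar> \<le> R" if "f \<in> F" for f
    using member_le_sum[OF that, of "\<lambda>f. \<bar>k f\<bar>"] F by (simp add: R_def)
  have R0: "R > 0" unfolding R_def by (intro add_nonneg_pos sum_nonneg) auto
  define T where "T = R *s h"
  have kT: "k T \<ge> R" using h R0 by (simp add: T_def lattice_hom_scale[OF k])
  define W where "W = {x. \<bar>k x\<bar> \<le> R}"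
  define \<phi> where "\<phi> x = (vmod N x, k x)" for x
  have "\<phi> ` W \<subseteq> range (vmod N) \<times> {-R..R}" by (auto simp: \<phi>_def W_def)
  then have "finite (\<phi> ` W)"
    by (rule finite_subset) (use finite_range_vmod[OF N] in auto)
  then obtain V where V: "V \<subseteq> W" "finite V" "\<phi> ` W = \<phi> ` V"
    using finite_subset_image[of "\<phi> ` W" \<phi> W] by blast
  \<comment> \<open>By invariance the finite set \<open>V\<close> represents the whole window
    \<open>W\<close>, so \<open>st n\<close> records all of \<open>a\<close> on the translate of
    \<open>W\<close> by \<open>n\<close> times \<open>T\<close>.\<close>
  define st where "st n = {y \<in> V. a (y + int n *s T) = 1}" for n
  have "finite (range st)"
    by (rule finite_subset[of _ "Pow V"]) (use V(2) in \<open>auto simp: st_def\<close>)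
  then obtain n1 n2 where n12: "n1 < n2" "st n1 = st n2"
    by (metis finite_imageD infinite_UNIV_nat injI linorder_neqE_nat)
  define w where "w = int (n2 - n1) *s T"
  define c where "c = int n1 *s T"
  have cw: "c + w = int n2 *s T"
    using n12(1) by (simp add: w_def c_def vector_sadd_rdistrib[symmetric] of_nat_diff)
  have kw: "k w \<ge> R"
  proof -
    have "R * 1 \<le> k T * int (n2 - n1)" using kT n12(1) R0 by (intro mult_mono) auto
    then show ?thesis by (simp add: w_def lattice_hom_scale[OF k] mult.commute)
  qed
  then have kw0: "k w > 0" using R0 by simp
  have win: "a (x + c + w) = a (x + c)" if x: "\<bar>k x\<bar> \<le> R" for x
  proof -
    have "\<phi> x \<in> \<phi> ` V" using x V(3) by (auto simp: W_def)
    then obtain y where y: "y \<in> V" "\<phi> y = \<phi> x" by (metis imageE)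
    have "a (x + z) = a (y + z)" for z
      using y(2) N
      by (intro invariant_along_cong[OF inv k])
        (auto simp: \<phi>_def vmod_def vec_eq_iff lattice_hom_add[OF k] intro: mod_add_cong)
    moreover have "a (y + int n1 *s T) = a (y + int n2 *s T)"
    proof -
      have "y \<in> st n1 \<longleftrightarrow> y \<in> st n2" using n12(2) by simp
      then show ?thesis
        using y(1) a01[of "y + int n1 *s T"] a01[of "y + int n2 *s T"] by (auto simp: st_def)
    qed
    ultimately show ?thesis by (simp add: add.assoc cw) (simp add: c_def)
  qed
  \<comment> \<open>A point is moved by a multiple of \<open>w\<close> to a level between 0 and
    \<open>k w\<close>, where the translate of \<open>a\<close> by \<open>c\<close> is read off.
    Since the windows at \<open>c\<close> and \<open>c + w\<close> agree, the formula
    \<open>a (x + c)\<close> remains valid up to \<open>R\<close> levels beyond this strip.\<close>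
  define a' where "a' x = a (x - (k x div k w) *s w + c)" for x
  have a'_w: "a' (x + t *s w) = a' x" for x t
  proof -
    have "k (x + t *s w) div k w = k x div k w + t"
      using kw0 by (simp add: lattice_hom_simps[OF k])
    then show ?thesis by (simp add: a'_def vector_sadd_rdistrib)
  qed
  have a'_eq: "a' z = a (z + c)" if z: "- R \<le> k z" "k z < k w + R" for z
  proof -
    consider "0 \<le> k z" "k z < k w" | "k w \<le> k z" | "k z < 0" by linarith
    then show ?thesis
    proof cases
      case 1
      then show ?thesis by (simp add: a'_def)
    next
      case 2
      then have "k z div k w = 1" using z kw kw0 by (intro int_div_pos_eq[of _ _ _ "k z - k w"]) auto
      then show ?thesis
        using win[of "z - w"] 2 z by (simp add: a'_def lattice_hom_diff[OF k] algebra_simps)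
    next
      case 3
      then have "k z div k w = - 1" using z kw kw0 by (intro int_div_pos_eq[of _ _ _ "k z + k w"]) auto
      moreover have "(- 1) *s w = - w" by (simp add: vec_eq_iff)
      ultimately show ?thesis
        using win[of z] 3 z by (simp add: a'_def algebra_simps)
    qed
  qed
  have b_h: "(\<Sum>f\<in>F. a (x + int n *s h - f)) = (\<Sum>f\<in>F. a (x - f))" for x n
  proof (induction n)
    case (Suc n)
    then show ?case using bh[of "x + int n *s h"] by (simp add: vector_sadd_rdistrib add_ac)
  qed simp
  have b_h': "(\<Sum>f\<in>F. a (x + t *s h - f)) = (\<Sum>f\<in>F. a (x - f))" for x t
  proof (cases "t \<ge> 0")
    case True
    then show ?thesis using b_h[of x "nat t"] by simp
  next
    case False
    then show ?thesis using b_h[of "x + t *s h" "nat (- t)"] by (simp add: add.assoc flip: vector_sadd_rdistrib)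
  qed
  show thesis
  proof (rule that)
    show "N * k w > 0" using N kw0 by simp
    show "a' x \<in> {0, 1}" for x by (simp only: a'_def a01)
    show "periodic_mod (N * k w) a'"
      unfolding periodic_mod_def
    proof (intro allI)
      fix x y
      \<comment> \<open>\<open>k w *s y\<close> is \<open>y'\<close> plus a multiple of
        \<open>w\<close>, with \<open>y'\<close> in the kernel of \<open>k\<close>; and
        \<open>a'\<close> is invariant under both \<open>N *s y'\<close> and
        \<open>w\<close>.\<close>
      define y' where "y' = k w *s y - k y *s w"
      have ky': "k y' = 0" by (simp add: y'_def lattice_hom_simps[OF k])
      have "x + (N * k w) *s y = (x + N *s y') + (N * k y) *s w"
        by (simp add: y'_def vector_ssub_ldistrib vector_smult_assoc)
      then have "a' (x + (N * k w) *s y) = a' (x + N *s y')" by (simp only: a'_w)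
      also have "\<dots> = a ((x - (k x div k w) *s w + c) + N *s y')"
      proof -
        have "k (x + N *s y') = k x" by (simp add: lattice_hom_simps[OF k] ky')
        then show ?thesis
          unfolding a'_def by (intro arg_cong[of _ _ a]) (simp add: vec_eq_iff)
      qed
      also have "\<dots> = a' x"
        using inv ky' unfolding invariant_along_def a'_def by blast
      finally show "a' (x + (N * k w) *s y) = a' x" .
    qed
    fix x
    define y where "y = x - (k x div k w) *s w"
    have ky: "0 \<le> k y" "k y < k w"
      using kw0 by (simp_all add: y_def lattice_hom_simps[OF k] minus_div_mult_eq_mod)
    have "(\<Sum>f\<in>F. a' (x - f)) = (\<Sum>f\<in>F. a (y - f + c))"
    proof (rule sum.cong[OF refl])
      fix f assume f: "f \<in> F"
      have "a' (x - f) = a' (y - f)"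
        using a'_w[of "y - f" "k x div k w"] by (simp add: y_def algebra_simps)
      also have "\<dots> = a (y - f + c)"
        using ky R[OF f] by (intro a'_eq) (auto simp: lattice_hom_diff[OF k])
      finally show "a' (x - f) = a (y - f + c)" .
    qed
    also have "\<dots> = (\<Sum>f\<in>F. a (x + (int n1 * R - (k x div k w) * int (n2 - n1) * R) *s h - f))"
      by (simp add: y_def c_def w_def T_def vector_smult_assoc vector_sub_rdistrib algebra_simps)
    also have "\<dots> = (\<Sum>f\<in>F. a (x - f))" by (rule b_h')
    finally show "(\<Sum>f\<in>F. a' (x - f)) = (\<Sum>f\<in>F. a (x - f))" .
  qed
qed

lemma finite_index_multiples:
  assumes "N > 0"
  shows "finite_index_subgroup (range (\<lambda>y :: 'd::finite lattice. N *s y))"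
  unfolding finite_index_subgroup_def
proof (intro conjI ballI)
  let ?G = "range (\<lambda>y :: 'd lattice. N *s y)"
  show "0 \<in> ?G" by (auto intro: image_eqI[of _ _ 0])
  show "x + y \<in> ?G" if "x \<in> ?G" "y \<in> ?G" for x y
    using that by (auto simp flip: vector_add_ldistrib)
  show "- x \<in> ?G" if "x \<in> ?G" for x
    using that by (auto simp flip: vector_smult_rneg)
  have "(+) x ` ?G = (+) (vmod N x) ` ?G" for x :: "'d lattice"
  proof -
    obtain z where z: "x = vmod N x + N *s z" using vmod_decomp[of x N] by blast
    have "(+) x ` ?G = (\<lambda>y. vmod N x + N *s y) ` (range ((+) z))"
    proof -
      have "(+) x ` ?G = (+) (vmod N x + N *s z) ` ?G" by (simp only: z[symmetric])
      then show ?thesis by (simp only: image_image vector_add_ldistrib add.assoc)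
    qed
    also have "range ((+) z) = UNIV" by simp
    finally show ?thesis by (simp only: image_image)
  qed
  note coset = this
  define C where "C = (\<lambda>x :: 'd lattice. (+) x ` ?G)"
  have "C x = C (vmod N x)" for x unfolding C_def by (rule coset)
  then have "range C \<subseteq> C ` range (vmod N)" by blast
  then have "finite (range C)" using finite_range_vmod[OF assms] finite_surj by blast
  then show "finite (range (\<lambda>x. (+) x ` ?G))" unfolding C_def .
qed

text \<open>The sums of \<open>g k\<close> over \<open>F\<close> are invariant along
  \<open>k\<close> and add up to 1. Isolating one direction annihilates this constant, so along
  \<open>N *s h\<close> the sum for \<open>k\<close> is a bounded sequence with vanishing iterated
  differences, hence constant. That is the condition under which a piece can be replaced.\<close>

lemma weakly_periodic_imp_periodic_tiling:
  fixes K :: "('d::finite lattice \<Rightarrow> int) set" and g :: "_ \<Rightarrow> 'd lattice \<Rightarrow> int"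
  assumes K: "directions K" and N: "N > 0" and F: "finite F" "F \<noteq> {}"
    and g01: "\<And>k x. k \<in> K \<Longrightarrow> g k x \<in> {0, 1}" and inv: "\<And>k. k \<in> K \<Longrightarrow> invariant_along N k (g k)"
    and tile: "\<And>x. (\<Sum>f\<in>F. \<Sum>k\<in>K. g k (x - f)) = 1"
  shows "\<exists>A. tiling_complement F A \<and> fully_periodic A"
proof -
  have fin: "finite K" and hom: "\<And>k. k \<in> K \<Longrightarrow> lattice_hom k" using K by (auto simp: directions_def)
  have "\<exists>a' E. E > 0 \<and> (\<forall>x. a' x \<in> {0, 1}) \<and> periodic_mod E a' \<and>
      (\<forall>x. (\<Sum>f\<in>F. a' (x - f)) = (\<Sum>f\<in>F. g k (x - f)))" if k: "k \<in> K" for k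
  proof -
    define b where "b l x = real_of_int (\<Sum>f\<in>F. g l (x - f))" for l x
    obtain h hs where h: "k h > 0" "hs \<noteq> []"
      and iso: "\<And>g x. (\<And>l. l \<in> K \<Longrightarrow> invariant_along N l (g l :: _ \<Rightarrow> real)) \<Longrightarrow>
        (fdiff (N *s h) ^^ card K) (g k) x = fdiffs hs (\<lambda>x. \<Sum>l\<in>K. g l x) x"
      using isolate_direction[OF K k, of N thesis] by blast
    have b_inv: "invariant_along N l (b l)" if "l \<in> K" for l
      using inv[OF that] unfolding invariant_along_def b_def by (metis (no_types, lifting) add_diff_eq add_diff_eq diff_add_eq sum.cong)
    have sum1: "(\<Sum>l\<in>K. b l x) = 1" for x
    proof -
      have "(\<Sum>l\<in>K. b l x) = real_of_int (\<Sum>f\<in>F. \<Sum>k\<in>K. g k (x - f))"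
        by (simp add: b_def) (rule sum.swap)
      then show ?thesis by (simp add: tile)
    qed
    have zero: "(fdiff (N *s h) ^^ card K) (b k) x = 0" for x
    proof -
      have "fdiffs hs (\<lambda>x. \<Sum>l\<in>K. b l x) x = 0"
        using h(2) by (intro fdiffs_zero[of _ "hd hs"]) (simp_all add: sum1)
      then show ?thesis using iso[of b, OF b_inv] by simp
    qed
    have card: "card K > 0" using fin k by (auto simp: card_gt_0_iff)
    have "b k (x + t *s (N *s h)) = b k (x + 0 *s (N *s h))" for x t
    proof (rule bounded_fdiff_zero_const[where m = "card K" and B = "real (card F)"])
      show "(fdiff 1 ^^ card K) (\<lambda>t. b k (x + t *s (N *s h))) t = 0" for t
        by (simp only: fdiff_pow_sequence zero)
      have "\<bar>b k y\<bar> \<le> (\<Sum>f\<in>F. 1)" for y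
        unfolding b_def of_int_sum using g01[OF k]
        by (intro order_trans[OF sum_abs] sum_mono) (metis abs_0 abs_1 empty_iff insert_iff of_int_0 of_int_1 order_refl zero_le_one)
      then show "\<bar>b k (x + t *s (N *s h))\<bar> \<le> real (card F)" for t by simp
    qed (rule card)
    from this[of _ 1] have bh: "b k (x + N *s h) = b k x" for x by simp
    have "k (N *s h) > 0" using h N by (simp add: lattice_hom_scale[OF hom[OF k]])
    from replace_by_periodic[OF hom[OF k] N F(1) g01[OF k] inv[OF k] this] bh
    show ?thesis unfolding b_def by (metis of_int_eq_iff)
  qed
  then obtain a' E where E: "\<And>k. k \<in> K \<Longrightarrow> E k > 0" and a'01: "\<And>k x. k \<in> K \<Longrightarrow> a' k x \<in> {0, 1::int}"
    and per: "\<And>k. k \<in> K \<Longrightarrow> periodic_mod (E k) (a' k)"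
    and conv: "\<And>k x. k \<in> K \<Longrightarrow> (\<Sum>f\<in>F. a' k (x - f)) = (\<Sum>f\<in>F. g k (x - f))"
    by metis
  define E' where "E' = (\<Prod>k\<in>K. E k)"
  have E': "E' > 0" unfolding E'_def using E by (intro prod_pos) auto
  define s where "s x = (\<Sum>k\<in>K. a' k x)" for x
  have per': "periodic_mod E' (a' k)" if "k \<in> K" for k
    unfolding E'_def using that fin by (intro periodic_mod_mono[OF per] dvd_prodI)
  have s_per: "s (x + E' *s y) = s x" for x y
    unfolding s_def using per' by (intro sum.cong) (auto simp: periodic_mod_def)
  have s1: "(\<Sum>f\<in>F. s (x - f)) = 1" for x
  proof -
    have "(\<Sum>f\<in>F. s (x - f)) = (\<Sum>k\<in>K. \<Sum>f\<in>F. a' k (x - f))" unfolding s_def by (rule sum.swap)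
    also have "\<dots> = (\<Sum>k\<in>K. \<Sum>f\<in>F. g k (x - f))" by (simp add: conv)
    also have "\<dots> = 1" by (subst sum.swap) (rule tile)
    finally show ?thesis .
  qed
  have s0: "s x \<ge> 0" for x
    unfolding s_def using a'01 by (intro sum_nonneg) (metis insert_iff order_refl singletonD zero_le_one)
  \<comment> \<open>The new pieces are not known to be disjoint. But \<open>s\<close> is integer
    valued and nonnegative with sums 1 over \<open>F\<close>, so among the points
    \<open>x - f\<close> exactly one has value 1 and all others have value 0.\<close>
  define A where "A = {x. s x = 1}"
  have "tiling_complement F A"
    unfolding tiling_complement_def
  proof
    fix x
    have "\<exists>f\<in>F. s (x - f) \<noteq> 0" using s1[of x] by (metis sum.neutral zero_neq_one)
    then obtain f where f: "f \<in> F" "s (x - f) \<noteq> 0" by blast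
    have rest: "s (x - f) + (\<Sum>f'\<in>F - {f}. s (x - f')) = 1"
      using s1[of x] f(1) F(1) by (simp add: sum.remove)
    have "(\<Sum>f'\<in>F - {f}. s (x - f')) \<ge> 0" by (intro sum_nonneg s0)
    then have 1: "s (x - f) = 1" "(\<Sum>f'\<in>F - {f}. s (x - f')) = 0" using rest f(2) s0[of "x - f"] by linarith+
    then have 0: "s (x - f') = 0" if "f' \<in> F - {f}" for f'
      using that F(1) by (subst (asm) sum_nonneg_eq_0_iff) (auto simp: s0)
    show "\<exists>!(f, a). f \<in> F \<and> a \<in> A \<and> x = f + a"
    proof (rule ex1I[of _ "(f, x - f)"])
      show "case (f, x - f) of (f, a) \<Rightarrow> f \<in> F \<and> a \<in> A \<and> x = f + a" using f 1 by (simp add: A_def)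
      fix p assume p: "case p of (f, a) \<Rightarrow> f \<in> F \<and> a \<in> A \<and> x = f + a"
      obtain f' a where "p = (f', a)" by (cases p)
      then have "f' \<in> F" "s (x - f') = 1" "a = x - f'" using p by (auto simp: A_def)
      then show "p = (f, x - f)" using 0[of f'] \<open>p = _\<close> by force
    qed
  qed
  moreover have "fully_periodic A"
    unfolding fully_periodic_def
  proof (intro exI conjI)
    show "finite_index_subgroup (range (\<lambda>y :: 'd lattice. E' *s y))" by (rule finite_index_multiples[OF E'])
    show "{a + g |a g. a \<in> A \<and> g \<in> range (\<lambda>y. E' *s y)} = A"
    proof (intro set_eqI iffI)
      fix x assume "x \<in> A"
      then show "x \<in> {a + g |a g. a \<in> A \<and> g \<in> range (\<lambda>y. E' *s y)}"
        by (intro CollectI exI[of _ x] exI[of _ 0]) (auto intro: image_eqI[of _ _ 0])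
    qed (auto simp: A_def s_per)
  qed
  ultimately show ?thesis by blast
qed

section \<open>Polynomial phases and their dilation limits\<close>

lemma ex_pointwise_convergent_subseq:
  fixes a :: "nat \<Rightarrow> 'd::finite lattice \<Rightarrow> int"
  assumes "\<And>j x. a j x \<in> {0, 1}"
  obtains r b where "strict_mono r" "\<And>x. \<forall>\<^sub>F j in sequentially. a (r j) x = b x"
proof -
  define A where "A j x = real_of_int (a j x)" for j x
  have "compactin (product_topology (\<lambda>_::'d lattice. euclidean :: real topology) UNIV) (PiE UNIV (\<lambda>_. {0, 1}))"
    by (subst compactin_PiE) (simp add: compactin_euclidean_iff finite_imp_compact)
  then have "compact (PiE UNIV (\<lambda>_. {0, 1}) :: ('d lattice \<Rightarrow> real) set)"
    by (simp add: euclidean_product_topology flip: compactin_euclidean_iff)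
  then have "seq_compact (PiE UNIV (\<lambda>_. {0, 1}) :: ('d lattice \<Rightarrow> real) set)"
    by (rule compact_imp_seq_compact)
  moreover have "\<forall>j. A j \<in> PiE UNIV (\<lambda>_. {0, 1})"
    using assms by (auto simp: PiE_UNIV_domain A_def)
  ultimately obtain b r where r: "b \<in> PiE UNIV (\<lambda>_. {0, 1})" "strict_mono r" "(A \<circ> r) \<longlonglongrightarrow> b"
    by (elim seq_compactE) auto
  have "\<forall>\<^sub>F j in sequentially. a (r j) x = \<lfloor>b x\<rfloor>" for x
  proof -
    have "isCont (\<lambda>f :: 'd lattice \<Rightarrow> real. f x) b"
      using continuous_on_eq_continuous_at[of UNIV "\<lambda>f :: 'd lattice \<Rightarrow> real. f x"] by simp
    from isCont_tendsto_compose[OF this r(3)] have "(\<lambda>j. A (r j) x) \<longlonglongrightarrow> b x" by (simp add: o_def)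
    from tendstoD[OF this zero_less_one] show ?thesis
    proof eventually_elim
      case (elim j)
      have "b x \<in> {0, 1}" using r(1) by (auto simp: PiE_UNIV_domain)
      then show ?case using elim assms[of "r j" x] by (auto simp: A_def dist_real_def)
    qed
  qed
  then show thesis using r(2) that[of r "\<lambda>x. \<lfloor>b x\<rfloor>"] by blast
qed

text \<open>On the line \<open>w + s *s e\<close> every member vanishes for at most one
  \<open>s\<close>: those with \<open>l e \<noteq> 0\<close> because they are injective along it,
  and \<open>k\<close> in the case \<open>k e = 0\<close> because it has the constant value
  \<open>k w \<noteq> 0\<close>.\<close>

lemma ex_common_nonzero:
  fixes K :: "('d::finite lattice \<Rightarrow> int) set"
  assumes "finite K" "\<And>k. k \<in> K \<Longrightarrow> lattice_hom k \<and> (\<exists>x. k x \<noteq> 0)"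
  obtains e where "\<And>k. k \<in> K \<Longrightarrow> k e \<noteq> 0"
  using assms
proof (induction K arbitrary: thesis rule: finite_induct)
  case (insert k K)
  obtain e where e: "\<And>l. l \<in> K \<Longrightarrow> l e \<noteq> 0" using insert.IH insert.prems(2) by blast
  obtain w where w: "k w \<noteq> 0" using insert.prems(2) by blast
  have hom: "lattice_hom l" if "l \<in> insert k K" for l using insert.prems(2) that by blast
  have "finite {s. l (w + s *s e) = 0}" if l: "l \<in> insert k K" for l
  proof (cases "l e = 0")
    case True
    then have "l = k" using l e by blast
    then have "{s. l (w + s *s e) = 0} = {}" using True w lattice_hom_simps(1,4)[OF hom[OF l]] by auto
    then show ?thesis by simp
  next
    case False
    have "{s. l (w + s *s e) = 0} \<subseteq> {- (l w div l e)}"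
    proof
      fix s assume "s \<in> {s. l (w + s *s e) = 0}"
      then have "l w = (- s) * l e" by (simp add: lattice_hom_simps[OF hom[OF l]])
      then have "l w div l e = - s" using False nonzero_mult_div_cancel_right[of "l e" "- s"] by simp
      then show "s \<in> {- (l w div l e)}" by simp
    qed
    then show ?thesis by (rule finite_subset) simp
  qed
  then have "finite (\<Union>l\<in>insert k K. {s. l (w + s *s e) = 0})" using insert.hyps by (intro finite_UN_I) auto
  from ex_new_if_finite[OF infinite_UNIV_int this] obtain s
    where "s \<notin> (\<Union>l\<in>insert k K. {s. l (w + s *s e) = 0})" by blast
  then show ?case using insert.prems(1)[of "w + s *s e"] by auto
qed simp

text \<open>\<open>n - n'\<close> divides \<open>n ^ i - n' ^ i\<close>, so a common denominator of
  the nonconstant coefficients is a period; the constant coefficient cancels.\<close>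

lemma rational_poly_mod_1_periodic:
  fixes P :: "real poly"
  assumes "\<And>i. i > 0 \<Longrightarrow> coeff P i \<in> \<rat>"
  obtains q :: int where "q > 0" "\<And>n n'. q dvd n - n' \<Longrightarrow> poly P (of_int n) - poly P (of_int n') \<in> \<int>"
proof -
  have "\<exists>q::int. q > 0 \<and> of_int q * coeff P i \<in> \<int>" if i: "i > 0" for i
  proof -
    obtain a b :: int where "b > 0" "coeff P i = of_int a / of_int b"
      using Rats_cases'[OF assms[OF i]] by metis
    then show ?thesis by (intro exI[of _ b]) auto
  qed
  then obtain c :: "nat \<Rightarrow> int" where c: "\<And>i. i > 0 \<Longrightarrow> c i > 0 \<and> of_int (c i) * coeff P i \<in> \<int>" by metis
  define q where "q = (\<Prod>i\<in>{1..degree P}. c i)"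
  show thesis
  proof (rule that)
    show "q > 0" unfolding q_def using c by (intro prod_pos) auto
    fix n n' :: int assume q: "q dvd n - n'"
    have "poly P (of_int n) - poly P (of_int n') = (\<Sum>i\<le>degree P. coeff P i * of_int (n ^ i - n' ^ i))"
      by (simp add: poly_altdef sum_subtractf algebra_simps)
    also have "\<dots> \<in> \<int>"
    proof (rule Ints_sum)
      fix i assume i: "i \<in> {..degree P}"
      show "coeff P i * of_int (n ^ i - n' ^ i) \<in> \<int>"
      proof (cases "i = 0")
        case False
        have "c i dvd q" unfolding q_def using i False by (intro dvd_prodI) auto
        moreover have "n - n' dvd n ^ i - n' ^ i"
          by (simp add: power_diff_sumr2)
        ultimately obtain z where z: "n ^ i - n' ^ i = c i * z" using q dvd_trans by (metis dvdE)
        have "coeff P i * of_int (n ^ i - n' ^ i) = (of_int (c i) * coeff P i) * of_int z"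
          by (simp add: z)
        moreover have "of_int (c i) * coeff P i \<in> \<int>" using c[of i] False by simp
        then have "(of_int (c i) * coeff P i) * of_int z \<in> \<int>" by (rule Ints_mult[OF _ Ints_of_int])
        ultimately show ?thesis by (simp only:)
      qed simp
    qed
    finally show "poly P (of_int n) - poly P (of_int n') \<in> \<int>" .
  qed
qed

text \<open>\<open>frac\<close> is continuous off the integers. The value \<open>y j = 1\<close>,
  the only one in the interval that \<open>frac\<close> changes, has fractional part 0 and is
  excluded once the fractional parts are close to \<open>frac q > 0\<close>.\<close>

lemma frac_limit_mod_1:
  fixes y :: "nat \<Rightarrow> real"
  assumes y: "\<And>j. 0 \<le> y j" "\<And>j. y j \<le> 1" and q: "q \<notin> \<int>"
    and lim: "(\<lambda>j. y j - of_int (z j)) \<longlonglongrightarrow> q"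
  shows "y \<longlonglongrightarrow> frac q"
proof -
  have "isCont frac q" using q by (rule continuous_frac)
  from isCont_tendsto_compose[OF this lim]
  have l: "(\<lambda>j. frac (y j - of_int (z j))) \<longlonglongrightarrow> frac q" .
  have "frac q > 0" using q by simp
  from order_tendstoD(1)[OF l this] have "\<forall>\<^sub>F j in sequentially. frac (y j - of_int (z j)) = y j"
  proof eventually_elim
    case (elim j)
    have eq: "frac (y j - of_int (z j)) = frac (y j)"
      by (simp add: frac_def)
    then have "y j \<noteq> 1" using elim by auto
    then have "y j < 1" using y(2)[of j] by simp
    then show ?case using y(1)[of j] unfolding eq by (simp add: frac_eq)
  qed
  with l show ?thesis by (rule Lim_transform_eventually)
qed

text \<open>Differencing away the other directions leaves an integer because \<open>a\<close> is integer valued.\<close>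

lemma poly_phase:
  fixes a :: "'d::finite lattice \<Rightarrow> int"
  assumes K: "directions K" and k: "k \<in> K" and N: "N > 0"
    and \<Psi>: "periodic_mod N \<Psi>" and inv: "\<And>k. k \<in> K \<Longrightarrow> invariant_along N k (g k)"
    and dec: "\<And>x. real_of_int (a x) = \<Psi> x + (\<Sum>k\<in>K. g k x)"
  obtains N' where "N' > 0" "N dvd N'"
    "\<And>r. \<exists>P. \<forall>x. vmod N' x = vmod N' r \<longrightarrow> g k x - poly P (of_int (k x)) \<in> \<int>"
proof -
  have hom: "lattice_hom k" using K k by (auto simp: directions_def)
  obtain h hs where h: "k h > 0" "hs \<noteq> []" "\<And>v. v \<in> set hs \<Longrightarrow> \<exists>y. v = N *s y"
    and iso: "\<And>g x. (\<And>l. l \<in> K \<Longrightarrow> invariant_along N l (g l :: _ \<Rightarrow> real)) \<Longrightarrow>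
      (fdiff (N *s h) ^^ card K) (g k) x = fdiffs hs (\<lambda>x. \<Sum>l\<in>K. g l x) x"
    using isolate_direction[OF K k, of N thesis] by blast
  have "(fdiff (N *s h) ^^ card K) (g k) x \<in> \<int>" for x
  proof -
    obtain y where y: "hd hs = N *s y" using h(2,3) by (metis hd_in_set)
    have "(\<lambda>x. \<Sum>l\<in>K. g l x) = (\<lambda>x. of_int (a x) - \<Psi> x)" by (simp add: dec)
    then have "(fdiff (N *s h) ^^ card K) (g k) x = fdiffs hs (\<lambda>x. of_int (a x)) x - fdiffs hs \<Psi> x"
      using iso[of g, OF inv] by (simp only: fdiffs_diff)
    also have "fdiffs hs \<Psi> x = 0"
      by (rule fdiffs_zero[OF _ hd_in_set[OF h(2)]]) (use \<Psi> y in \<open>simp add: periodic_mod_def\<close>)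
    finally show ?thesis using fdiffs_Ints[of "\<lambda>x. of_int (a x)" hs x] by simp
  qed
  then have phase: "\<exists>Q. \<forall>t. g k (x + t *s (N *s h)) - poly Q (of_int t) \<in> \<int>" for x
    using poly_mod_1_of_fdiff[of "card K" "\<lambda>t. g k (x + t *s (N *s h))"]
    by (simp only: fdiff_pow_sequence) blast
  define D where "D = N * k h"
  have D: "D > 0" using N h by (simp add: D_def)
  show thesis
  proof (rule that)
    show "N * D > 0" "N dvd N * D" using N D by simp_all
    fix r
    obtain Q where Q: "\<And>t. g k (r + t *s (N *s h)) - poly Q (of_int t) \<in> \<int>" using phase[of r] by blast
    define P where "P = pcompose Q [:- of_int (k r) / of_int D, 1 / of_int D:]"
    show "\<exists>P. \<forall>x. vmod (N * D) x = vmod (N * D) r \<longrightarrow> g k x - poly P (of_int (k x)) \<in> \<int>"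
    proof (intro exI[of _ P] allI impI)
      fix x assume "vmod (N * D) x = vmod (N * D) r"
      then obtain y where y: "x = r + (N * D) *s y" using vmod_eqD by blast
      define t where "t = N * k y"
      have kx: "k x = k r + t * D" by (simp add: y t_def lattice_hom_simps[OF hom])
      have "g k x = g k (r + t *s (N *s h))"
      proof (rule invariant_along_cong[OF inv[OF k] hom])
        have "x = r + N *s (D *s y)" "r + t *s (N *s h) = r + N *s (t *s h)"
          by (simp_all add: y mult.commute)
        then show "vmod N x = vmod N (r + t *s (N *s h))" by (simp only: vmod_add_scale)
        show "k x = k (r + t *s (N *s h))" by (simp only: kx lattice_hom_simps[OF hom] D_def)
      qed (use N in simp)
      moreover have "poly P (of_int (k x)) = poly Q (of_int t)"
        using D by (simp add: P_def poly_pcompose kx) (simp add: field_simps)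
      ultimately show "g k x - poly P (of_int (k x)) \<in> \<int>" using Q by simp
    qed
  qed
qed

definition phase_on :: "int \<Rightarrow> ('d::finite lattice \<Rightarrow> int) \<Rightarrow> ('d lattice \<Rightarrow> real) \<Rightarrow> 'd lattice \<Rightarrow> real poly \<Rightarrow> bool" where
  "phase_on N k g r P \<longleftrightarrow> (\<forall>x. vmod N x = vmod N r \<longrightarrow> g x - poly P (of_int (k x)) \<in> \<int>)"

lemma phase_on_mono:
  assumes "phase_on N k g r P" "N dvd N'"
  shows "phase_on N' k g r P"
proof -
  obtain c where c: "N' = N * c" using assms(2) by (elim dvdE)
  show ?thesis
    unfolding phase_on_def
  proof (intro allI impI)
    fix x assume "vmod N' x = vmod N' r"
    then obtain y where "x = r + N' *s y" using vmod_eqD by blast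
    then have "x = r + N *s (c *s y)" by (simp add: c)
    then have "vmod N x = vmod N r" by (simp only: vmod_add_scale)
    then show "g x - poly P (of_int (k x)) \<in> \<int>" using assms(1) by (simp add: phase_on_def)
  qed
qed

lemma phase_on_const:
  fixes g :: "'d::finite lattice \<Rightarrow> real"
  assumes P: "phase_on N k g r P" and hom: "lattice_hom k" and N: "N dvd N'" "q dvd N'"
    and q: "\<And>n n'. q dvd n - n' \<Longrightarrow> poly P (of_int n) - poly P (of_int n') \<in> \<int>"
  shows "phase_on N' k g r [:g r:]"
  unfolding phase_on_def
proof (intro allI impI)
  fix x assume x: "vmod N' x = vmod N' r"
  then obtain y where y: "x = r + N' *s y" using vmod_eqD by blast
  have "q dvd k x - k r" using N(2) by (simp add: y lattice_hom_simps[OF hom])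
  then have 1: "poly P (of_int (k x)) - poly P (of_int (k r)) \<in> \<int>" by (rule q)
  have "phase_on N' k g r P" using phase_on_mono[OF P N(1)] .
  then have 2: "g x - poly P (of_int (k x)) \<in> \<int>" "g r - poly P (of_int (k r)) \<in> \<int>"
    using x by (auto simp: phase_on_def)
  from Ints_diff[OF Ints_add[OF 2(1) 1] 2(2)] show "g x - poly [:g r:] (of_int (k x)) \<in> \<int>"
    by simp
qed

lemma phase_on_cong: "vmod N r = vmod N r' \<Longrightarrow> phase_on N k g r P \<Longrightarrow> phase_on N k g r' P"
  by (simp add: phase_on_def)

text \<open>A phase whose nonconstant coefficients are all rational is periodic modulo 1, so on the
  cosets of a sparser lattice it can be replaced by a constant. The others keep an irrational
  nonconstant coefficient.\<close>

lemma common_phases: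
  fixes g :: "_ \<Rightarrow> 'd::finite lattice \<Rightarrow> real"
  assumes K: "directions K" and N: "N > 0"
    and phases: "\<And>k. k \<in> K \<Longrightarrow> \<exists>N'>0. N dvd N' \<and> (\<forall>r. \<exists>P. phase_on N' k (g k) r P)"
  obtains N' P where "N' > 0" "N dvd N'"
    "\<And>k r. k \<in> K \<Longrightarrow> phase_on N' k (g k) r (P k r)"
    "\<And>k r. k \<in> K \<Longrightarrow> degree (P k r) = 0 \<or> (\<exists>i>0. coeff (P k r) i \<notin> \<rat>)"
proof -
  have fin: "finite K" and hom: "\<And>k. k \<in> K \<Longrightarrow> lattice_hom k" using K by (auto simp: directions_def)
  obtain n where n: "\<And>k. k \<in> K \<Longrightarrow> n k > 0" "\<And>k. k \<in> K \<Longrightarrow> N dvd n k"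
    "\<And>k r. k \<in> K \<Longrightarrow> \<exists>P. phase_on (n k) k (g k) r P"
    using phases by metis
  define N1 where "N1 = N * (\<Prod>k\<in>K. n k)"
  have N1: "N1 > 0" "N dvd N1" using N n(1) by (auto simp: N1_def prod_pos)
  have "n k dvd N1" if "k \<in> K" for k
    unfolding N1_def using that fin by (intro dvd_mult dvd_prodI)
  then have "\<exists>P. phase_on N1 k (g k) r P" if "k \<in> K" for k r
    using n(3)[OF that, of r] phase_on_mono that by blast
  then obtain P0 where P0: "\<And>k r. k \<in> K \<Longrightarrow> phase_on N1 k (g k) r (P0 k r)" by metis
  \<comment> \<open>Choosing the polynomial through the representative of the coset leaves only
    finitely many, so that one \<open>N2\<close> can serve all of them.\<close>
  define P1 where "P1 k r = P0 k (vmod N1 r)" for k r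
  have P1: "phase_on N1 k (g k) r (P1 k r)" if "k \<in> K" for k r
    unfolding P1_def by (rule phase_on_cong[OF _ P0[OF that]]) (simp add: vmod_def)
  define rat where "rat P \<longleftrightarrow> (\<forall>i>0. coeff P i \<in> \<rat>)" for P :: "real poly"
  have "\<exists>q::int. q > 0 \<and> (rat P \<longrightarrow> (\<forall>n n'. q dvd n - n' \<longrightarrow> poly P (of_int n) - poly P (of_int n') \<in> \<int>))" for P
  proof (cases "rat P")
    case True
    then show ?thesis using rational_poly_mod_1_periodic[of P] unfolding rat_def by metis
  next
    case False
    then show ?thesis by (intro exI[of _ 1]) simp
  qed
  then obtain q :: "real poly \<Rightarrow> int" where q: "\<And>P. q P > 0"
    "\<And>P n n'. rat P \<Longrightarrow> q P dvd n - n' \<Longrightarrow> poly P (of_int n) - poly P (of_int n') \<in> \<int>"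
    by metis
  define S where "S = (\<lambda>(k, r). P0 k r) ` (K \<times> range (vmod N1))"
  have S: "finite S" unfolding S_def 
    by (intro finite_imageI finite_cartesian_product fin finite_range_vmod[OF N1(1)])
  define N2 where "N2 = N1 * (\<Prod>P\<in>S. q P)"
  have N2: "N2 > 0" "N1 dvd N2" using N1 q(1) by (auto simp: N2_def prod_pos)
  have q_dvd: "q (P1 k r) dvd N2" if "k \<in> K" for k r
    unfolding N2_def P1_def using that S by (intro dvd_mult dvd_prodI) (auto simp: S_def)
  define P where "P k r = (if rat (P1 k r) then [:g k r:] else P1 k r)" for k r
  show thesis
  proof (rule that)
    show "N2 > 0" "N dvd N2" using N2 N1 dvd_trans by blast+
    fix k r assume k: "k \<in> K"
    show "phase_on N2 k (g k) r (P k r)"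
    proof (cases "rat (P1 k r)")
      case True
      have "phase_on N2 k (g k) r [:g k r:]"
        using phase_on_const[OF P1[OF k] hom[OF k] N2(2) q_dvd[OF k] q(2)[OF True]] .
      then show ?thesis using True by (simp add: P_def)
    next
      case False
      then show ?thesis using phase_on_mono[OF P1[OF k] N2(2)] by (simp add: P_def)
    qed
    show "degree (P k r) = 0 \<or> (\<exists>i>0. coeff (P k r) i \<notin> \<rat>)"
      by (auto simp: P_def rat_def)
  qed
qed

text \<open>A polynomial with an irrational coefficient is rational at finitely many integers only,
  and \<open>k (N *s (s *s e))\<close> takes different values for different \<open>s\<close>. So all
  but finitely many \<open>s\<close> serve for all \<open>k\<close> and \<open>r\<close> at
  once.\<close>

lemma translate_to_irrational:
  fixes P :: "('d::finite lattice \<Rightarrow> int) \<Rightarrow> 'd lattice \<Rightarrow> real poly"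
  assumes K: "directions K" and N: "N > 0"
    and irr: "\<And>k r. k \<in> K \<Longrightarrow> degree (P k r) = 0 \<or> (\<exists>i>0. coeff (P k r) i \<notin> \<rat>)"
    and fin: "finite R"
  obtains v where "\<And>k r. k \<in> K \<Longrightarrow> r \<in> R \<Longrightarrow> degree (P k r) = 0 \<or> poly (P k r) (of_int (k (N *s v))) \<notin> \<rat>"
proof -
  have finK: "finite K" and hom: "\<And>k. k \<in> K \<Longrightarrow> lattice_hom k" using K by (auto simp: directions_def)
  obtain e where e: "\<And>k. k \<in> K \<Longrightarrow> k e \<noteq> 0"
    using ex_common_nonzero[OF finK] K unfolding directions_def by metis
  define bad where "bad k r = {s::int. degree (P k r) \<noteq> 0 \<and> poly (P k r) (of_int (k (N *s (s *s e)))) \<in> \<rat>}" for k r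
  have "finite (bad k r)" if k: "k \<in> K" for k r
  proof (cases "degree (P k r) = 0")
    case True
    then show ?thesis by (simp add: bad_def)
  next
    case False
    then obtain i where "coeff (P k r) i \<notin> \<rat>" using irr[OF k, of r] by auto
    then have f: "finite {n::int. poly (P k r) (of_int n) \<in> \<rat>}" using poly_rational_values by blast
    have "inj (\<lambda>s. N * s * k e)" using N e[OF k] by (auto simp: inj_def)
    from finite_vimageI[OF f this] have "finite {s. poly (P k r) (of_int (N * s * k e)) \<in> \<rat>}"
      by (simp add: vimage_def)
    then show ?thesis
      unfolding bad_def by (rule finite_subset[rotated]) (auto simp: lattice_hom_scale[OF hom[OF k]] mult.assoc)
  qed
  then have "finite (\<Union>k\<in>K. \<Union>r\<in>R. bad k r)" using finK fin by blast
  from ex_new_if_finite[OF infinite_UNIV_int this] obtain s where s: "s \<notin> (\<Union>k\<in>K. \<Union>r\<in>R. bad k r)" by blast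
  show thesis
    by (rule that[of "s *s e"]) (use s in \<open>auto simp: bad_def\<close>)
qed

lemma prime_dvd_dilation_factor:
  fixes p M :: nat
  assumes "prime p" "p dvd 1 + fact c * t"
  shows "c < p"
proof (rule ccontr)
  assume "\<not> c < p"
  then have "p dvd fact c" using assms(1) prime_gt_0_nat by (intro dvd_fact) (auto simp: Suc_le_eq)
  then have "p dvd 1" using assms(2) by (metis dvd_add_left_iff dvd_mult2)
  then show False using assms(1) by (simp add: prime_nat_iff)
qed

text \<open>A constant coefficient is not changed by dilations. By \<open>irr\<close> the limits of the nonconstant phases
  thus avoid the integers, where a value in \<open>[0, 1]\<close> is not determined modulo 1.\<close>

lemma periodic_tiling_of_phases:
  fixes a :: "'d::finite lattice \<Rightarrow> int" and g :: "_ \<Rightarrow> 'd lattice \<Rightarrow> real"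
  assumes K: "directions K" "K \<noteq> {}" and N: "N > 0" and F: "finite F" "F \<noteq> {}"
    and a01: "\<And>x. a x \<in> {0, 1}" and tile: "\<And>x. (\<Sum>f\<in>F. a (x - f)) = 1"
    and \<Psi>: "periodic_mod N \<Psi>"
    and inv: "\<And>k. k \<in> K \<Longrightarrow> invariant_along N k (g k)"
    and g01: "\<And>k x. k \<in> K \<Longrightarrow> 0 \<le> g k x \<and> g k x \<le> 1"
    and dec: "\<And>x. real_of_int (a x) = \<Psi> x + (\<Sum>k\<in>K. g k x)"
    and int: "\<And>k x. k \<in> K \<Longrightarrow> g k x \<in> \<int> \<Longrightarrow> real_of_int (a x) = g k x"
    and phase: "\<And>k r. k \<in> K \<Longrightarrow> phase_on N k (g k) r (P k r)"
    and irr: "\<And>k r. k \<in> K \<Longrightarrow> r \<in> range (vmod N) \<Longrightarrow> degree (P k r) = 0 \<or> coeff (P k r) 0 \<notin> \<rat>"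
  shows "\<exists>A. tiling_complement F A \<and> fully_periodic A"
proof -
  have finK: "finite K" and hom: "\<And>k. k \<in> K \<Longrightarrow> lattice_hom k" using K by (auto simp: directions_def)
  define R where "R = range (vmod N :: 'd lattice \<Rightarrow> _)"
  have finR: "finite R" unfolding R_def by (rule finite_range_vmod[OF N])
  define I where "I = (SIGMA k:K. SIGMA r:R. {1..degree (P k r)})"
  define N' where "N' = nat N * fact (card F)"
  obtain \<rho> where \<rho>: "power_reaches N' I (\<lambda>(k, r, i). i) (\<lambda>(k, r, i). coeff (P k r) i) \<rho>"
    "\<And>j. j \<in> I \<Longrightarrow> \<rho> j \<in> \<rat>"
  proof (rule power_reaches_rational[of I N' "\<lambda>(k, r, i). i" "\<lambda>(k, r, i). coeff (P k r) i"])
    show "finite I" unfolding I_def using finK finR by (intro finite_SigmaI) auto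
    show "N' > 0" using N by (simp add: N'_def)
    show "(case j of (k, r, i) \<Rightarrow> i) > 0" if "j \<in> I" for j using that by (auto simp: I_def)
  qed blast
  have "\<exists>t::nat. \<forall>j\<in>I. \<exists>z::int. \<bar>(\<lambda>(k, r, i). coeff (P k r) i) j * real (1 + N' * t) ^ (\<lambda>(k, r, i). i) j - \<rho> j - of_int z\<bar> < inverse (real (Suc n))" for n
    using \<rho>(1)[unfolded power_reaches_def] by (metis inverse_positive_iff_positive of_nat_0_less_iff zero_less_Suc)
  then obtain t :: "nat \<Rightarrow> nat" where t: "\<And>n j. j \<in> I \<Longrightarrow> \<exists>z::int.
      \<bar>(\<lambda>(k, r, i). coeff (P k r) i) j * real (1 + N' * t n) ^ (\<lambda>(k, r, i). i) j - \<rho> j - of_int z\<bar> < inverse (real (Suc n))"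
    by metis
  define M where "M n = int (1 + N' * t n)" for n
  have M_eq: "M n *s x = x + N *s ((int (fact (card F) * t n)) *s x)" for n and x :: "'d lattice"
  proof -
    have "M n = 1 + N * int (fact (card F) * t n)" using N by (simp add: M_def N'_def)
    then show ?thesis by (simp add: vector_sadd_rdistrib)
  qed
  have vmod_M: "vmod N (M n *s x) = vmod N x" for n and x :: "'d lattice" unfolding M_eq by (rule vmod_add_scale)
  have \<Psi>_M: "\<Psi> (M n *s x) = \<Psi> x" for n x using \<Psi> unfolding M_eq periodic_mod_def by blast
  have tile_M: "(\<Sum>f\<in>F. a (M n *s (x - f))) = 1" for n x
  proof -
    have "card F < p" if "prime p" "p dvd 1 + N' * t n" for p
      using prime_dvd_dilation_factor[of p "card F" "nat N * t n"] that by (simp add: N'_def mult_ac)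
    from tiling_dilate[where a = a and M = "1 + N' * t n" and x = "M n *s x", OF F _ this a01 tile]
    show ?thesis by (simp add: M_def vector_ssub_ldistrib)
  qed
  obtain s b where s: "strict_mono s" and b: "\<And>x. \<forall>\<^sub>F n in sequentially. a (M (s n) *s x) = b x"
    using ex_pointwise_convergent_subseq[of "\<lambda>n x. a (M n *s x)", OF a01] by metis
  have b01: "b x \<in> {0, 1}" for x
  proof -
    obtain n where "a (M (s n) *s x) = b x" using b[of x] by (auto simp: eventually_sequentially)
    then show ?thesis using a01 by metis
  qed
  have b_tile: "(\<Sum>f\<in>F. b (x - f)) = 1" for x
  proof -
    have "\<forall>\<^sub>F n in sequentially. \<forall>f\<in>F. a (M (s n) *s (x - f)) = b (x - f)"
      by (intro eventually_ball_finite ballI b F(1))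
    then obtain n where "\<forall>f\<in>F. a (M (s n) *s (x - f)) = b (x - f)" by (auto simp: eventually_sequentially)
    then show ?thesis using tile_M[of "s n" x] by simp
  qed

  \<comment> \<open>\<open>Q k r\<close> is the limit phase: rational limits in the positive degrees
    and the old constant coefficient.\<close>
  define Q where "Q k r = (\<Sum>i\<le>degree (P k r). monom (if i = 0 then coeff (P k r) 0 else \<rho> (k, r, i)) i)" for k r
  have poly_Q: "poly (Q k r) y = (\<Sum>i\<le>degree (P k r). (if i = 0 then coeff (P k r) 0 else \<rho> (k, r, i)) * y ^ i)" for k r y
    by (simp add: Q_def poly_sum poly_monom)
  have coeff_Q: "coeff (Q k r) i \<in> \<rat>" if "k \<in> K" "r \<in> R" "i > 0" for k r i
  proof -
    have "coeff (Q k r) i = (if i \<le> degree (P k r) then \<rho> (k, r, i) else 0)"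
      using that by (simp add: Q_def coeff_sum coeff_monom)
    then show ?thesis using \<rho>(2)[of "(k, r, i)"] that by (auto simp: I_def)
  qed
  have "\<exists>q::int. q > 0 \<and> (k \<in> K \<longrightarrow> r \<in> R \<longrightarrow>
      (\<forall>n n'. q dvd n - n' \<longrightarrow> poly (Q k r) (of_int n) - poly (Q k r) (of_int n') \<in> \<int>))" for k r
  proof (cases "k \<in> K \<and> r \<in> R")
    case True
    then show ?thesis using rational_poly_mod_1_periodic[of "Q k r"] coeff_Q by metis
  next
    case False
    then show ?thesis by (intro exI[of _ 1]) auto
  qed
  then obtain q :: "_ \<Rightarrow> _ \<Rightarrow> int" where q: "\<And>k r. q k r > 0"
    "\<And>k r n n'. k \<in> K \<Longrightarrow> r \<in> R \<Longrightarrow> q k r dvd n - n' \<Longrightarrow> poly (Q k r) (of_int n) - poly (Q k r) (of_int n') \<in> \<int>"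
    by metis
  have Q_near: "\<exists>z::int. \<bar>g k (M n *s x) - of_int z - poly (Q k (vmod N x)) (of_int (k x))\<bar>
      \<le> inverse (real (Suc n)) * (\<Sum>i\<le>degree (P k (vmod N x)). \<bar>of_int (k x)\<bar> ^ i)" if k: "k \<in> K" for k x n
  proof -
    define r where "r = vmod N x"
    have r: "r \<in> R" by (simp add: r_def R_def)
    define y where "y = real_of_int (k x)"
    define c where "c i = (if i = 0 then coeff (P k r) 0 else \<rho> (k, r, i))" for i
    have "\<exists>z::int. \<bar>coeff (P k r) i * of_int (M n) ^ i - c i - of_int z\<bar> \<le> inverse (real (Suc n))"
      if "i \<le> degree (P k r)" for i
    proof (cases "i = 0")
      case True
      then show ?thesis by (intro exI[of _ 0]) (simp add: c_def)
    next
      case False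
      then have "(k, r, i) \<in> I" using that k r by (auto simp: I_def)
      from t[OF this, of n] show ?thesis using False by (auto simp: c_def M_def intro: less_imp_le)
    qed
    then obtain w :: "nat \<Rightarrow> int" where w: "\<And>i. i \<le> degree (P k r) \<Longrightarrow>
        \<bar>coeff (P k r) i * of_int (M n) ^ i - c i - of_int (w i)\<bar> \<le> inverse (real (Suc n))"
      by metis
    \<comment> \<open>The level \<open>k x\<close> is an integer, so the integers \<open>w i\<close>
      split off from the coefficients change the value of the polynomial by an integer.\<close>
    define W where "W = (\<Sum>i\<le>degree (P k r). w i * k x ^ i)"
    have "poly (P k r) (of_int (M n) * y) - poly (Q k r) y - of_int W
        = (\<Sum>i\<le>degree (P k r). (coeff (P k r) i * of_int (M n) ^ i - c i - of_int (w i)) * y ^ i)"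
      by (simp add: poly_Q poly_altdef[of "P k r"] W_def c_def y_def sum_subtractf algebra_simps power_mult_distrib
          flip: sum.distrib)
    also have "\<bar>\<dots>\<bar> \<le> (\<Sum>i\<le>degree (P k r). inverse (real (Suc n)) * \<bar>y\<bar> ^ i)"
      by (intro order_trans[OF sum_abs] sum_mono) (use w in \<open>auto simp: abs_mult power_abs intro!: mult_right_mono\<close>)
    finally have 1: "\<bar>poly (P k r) (of_int (M n) * y) - poly (Q k r) y - of_int W\<bar>
        \<le> inverse (real (Suc n)) * (\<Sum>i\<le>degree (P k r). \<bar>y\<bar> ^ i)" by (simp add: sum_distrib_left)
    have "g k (M n *s x) - poly (P k r) (of_int (k (M n *s x))) \<in> \<int>"
      using phase[OF k, of r] vmod_M[of n x] by (auto simp: phase_on_def r_def vmod_def)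
    then obtain z :: int where "g k (M n *s x) - poly (P k r) (of_int (M n) * y) = of_int z"
      by (auto simp: lattice_hom_scale[OF hom[OF k]] y_def elim: Ints_cases)
    then have "g k (M n *s x) - of_int (z + W) - poly (Q k r) y
        = poly (P k r) (of_int (M n) * y) - poly (Q k r) y - of_int W" by simp
    then show ?thesis using 1 unfolding r_def y_def by metis
  qed

  \<comment> \<open>\<open>B k r\<close> marks the cosets with an integral constant phase, where
    \<open>g k\<close> is integer valued. Its limit could not be read off modulo 1, but by
    \<open>int\<close> the tiling agrees with \<open>g k\<close> there and inherits its
    invariance.\<close>
  define B where "B k r \<longleftrightarrow> degree (P k r) = 0 \<and> coeff (P k r) 0 \<in> \<int>" for k r
  have b_B: "b (x + N *s y) = b x" if k: "k \<in> K" "B k (vmod N x)" and y: "k y = 0" for k x y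
  proof -
    have aB: "real_of_int (a x') = g k x'" if x': "vmod N x' = vmod N x" for x'
    proof (rule int[OF k(1)])
      obtain c where "P k (vmod N x) = [:c:]" using k(2) unfolding B_def by (metis degree_eq_zeroE)
      then have "poly (P k (vmod N x)) u \<in> \<int>" for u using k(2) by (simp add: B_def)
      moreover have "g k x' - poly (P k (vmod N x)) (of_int (k x')) \<in> \<int>"
        using phase[OF k(1), of "vmod N x"] x' by (auto simp: phase_on_def vmod_def)
      ultimately show "g k x' \<in> \<int>" using Ints_add by (metis diff_add_cancel)
    qed
    have "a (M n *s (x + N *s y)) = a (M n *s x)" for n
    proof -
      have eq: "M n *s (x + N *s y) = M n *s x + N *s (M n *s y)"
        by (simp add: vector_add_ldistrib vector_smult_assoc mult.commute)
      have "g k (M n *s x + N *s (M n *s y)) = g k (M n *s x)"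
        using inv[OF k(1)] y unfolding invariant_along_def
        by (metis lattice_hom_scale[OF hom[OF k(1)]] mult_zero_right)
      then have "real_of_int (a (M n *s x + N *s (M n *s y))) = real_of_int (a (M n *s x))"
        by (simp only: aB vmod_add_scale vmod_M)
      then show ?thesis unfolding eq by simp
    qed
    moreover obtain n where "a (M (s n) *s x) = b x" "a (M (s n) *s (x + N *s y)) = b (x + N *s y)"
      using eventually_happens'[OF sequentially_bot eventually_conj[OF b[of x] b[of "x + N *s y"]]] by blast
    ultimately show ?thesis by metis
  qed
  \<comment> \<open>On the remaining cosets no limit phase is integral, so every summand converges
    to a fractional part, and \<open>b\<close> is given by an expression that is periodic in all
    directions.\<close>
  have b_T: "real_of_int (b x) = \<Psi> x + (\<Sum>k\<in>K. frac (poly (Q k (vmod N x)) (of_int (k x))))"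
    if T: "\<forall>k\<in>K. \<not> B k (vmod N x)" for x
  proof -
    have "(\<lambda>n. g k (M n *s x)) \<longlonglongrightarrow> frac (poly (Q k (vmod N x)) (of_int (k x)))" if k: "k \<in> K" for k
    proof -
      define r where "r = vmod N x"
      define y where "y = poly (Q k r) (of_int (k x))"
      have r: "r \<in> R" by (simp add: r_def R_def)
      have "y \<notin> \<int>"
      proof (cases "degree (P k r) = 0")
        case True
        then show ?thesis using T k by (auto simp: y_def poly_Q B_def r_def)
      next
        case False
        then have nr: "coeff (P k r) 0 \<notin> \<rat>" using irr[OF k, of r] r by (auto simp: R_def)
        have "y = coeff (P k r) 0 + (\<Sum>i\<in>{1..degree (P k r)}. \<rho> (k, r, i) * of_int (k x) ^ i)"
        proof -
          have "{..degree (P k r)} = insert 0 {1..degree (P k r)}" by auto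
          then show ?thesis by (simp add: y_def poly_Q)
        qed
        moreover have "(\<Sum>i\<in>{1..degree (P k r)}. \<rho> (k, r, i) * of_int (k x) ^ i) \<in> \<rat>"
          using \<rho>(2) k r by (intro Rats_sum Rats_mult Rats_power) (auto simp: I_def)
        ultimately have "y \<notin> \<rat>" using nr by (metis Rats_diff add_diff_cancel_right')
        then show ?thesis using Ints_subset_Rats by blast
      qed
      define C where "C = (\<Sum>i\<le>degree (P k r). \<bar>of_int (k x)\<bar> ^ i :: real)"
      obtain z :: "nat \<Rightarrow> int" where z: "\<And>n. \<bar>g k (M n *s x) - of_int (z n) - y\<bar> \<le> inverse (real (Suc n)) * C"
        using Q_near[OF k, of _ x] unfolding r_def[symmetric] y_def[symmetric] C_def[symmetric] by metis
      have "(\<lambda>n. inverse (real (Suc n)) * C) \<longlonglongrightarrow> 0"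
        using tendsto_mult[OF LIMSEQ_inverse_real_of_nat tendsto_const[of C]] by simp
      then have "(\<lambda>n. (g k (M n *s x) - of_int (z n)) - y) \<longlonglongrightarrow> 0"
        by (rule Lim_null_comparison[rotated]) (use z in simp)
      then have "(\<lambda>n. g k (M n *s x) - of_int (z n)) \<longlonglongrightarrow> y" by (rule LIM_zero_cancel)
      from frac_limit_mod_1[OF _ _ \<open>y \<notin> \<int>\<close> this] g01[OF k] show ?thesis unfolding y_def r_def by blast
    qed
    then have "(\<lambda>n. \<Psi> x + (\<Sum>k\<in>K. g k (M n *s x))) \<longlonglongrightarrow> \<Psi> x + (\<Sum>k\<in>K. frac (poly (Q k (vmod N x)) (of_int (k x))))"
      by (intro tendsto_add tendsto_const tendsto_sum)
    then have "(\<lambda>n. real_of_int (a (M n *s x))) \<longlonglongrightarrow> \<Psi> x + (\<Sum>k\<in>K. frac (poly (Q k (vmod N x)) (of_int (k x))))"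
      by (simp add: dec \<Psi>_M)
    from LIMSEQ_subseq_LIMSEQ[OF this s]
    have l1: "(\<lambda>n. real_of_int (a (M (s n) *s x))) \<longlonglongrightarrow> \<Psi> x + (\<Sum>k\<in>K. frac (poly (Q k (vmod N x)) (of_int (k x))))"
      by (simp add: o_def)
    have l2: "(\<lambda>n. real_of_int (a (M (s n) *s x))) \<longlonglongrightarrow> real_of_int (b x)"
      by (rule tendsto_eventually) (use b[of x] in \<open>auto elim: eventually_mono\<close>)
    show ?thesis by (rule LIMSEQ_unique[OF l2 l1])
  qed

  define L where "L = N * (\<Prod>k\<in>K. \<Prod>r\<in>R. q k r)"
  have L: "L > 0" "N dvd L" using N q(1) by (auto simp: L_def intro!: mult_pos_pos prod_pos)
  have q_dvd: "q k r dvd L" if "k \<in> K" "r \<in> R" for k r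
    unfolding L_def using that finK finR
    by (intro dvd_mult) (meson dvd_prodI dvd_trans)
  have vmod_L: "vmod N (x + L *s y) = vmod N x" for x y :: "'d lattice"
  proof -
    obtain c where "L = N * c" using L(2) by (elim dvdE)
    then have "x + L *s y = x + N *s (c *s y)" by simp
    then show ?thesis by (simp only: vmod_add_scale)
  qed
  have b_T': "b (x + L *s y) = b x" if T: "\<forall>k\<in>K. \<not> B k (vmod N x)" for x y
  proof -
    have "frac (poly (Q k (vmod N x)) (of_int (k (x + L *s y)))) = frac (poly (Q k (vmod N x)) (of_int (k x)))"
      if k: "k \<in> K" for k
    proof -
      have r: "vmod N x \<in> R" by (simp add: R_def)
      have "q k (vmod N x) dvd k (x + L *s y) - k x"
        using q_dvd[OF k r] by (simp add: lattice_hom_simps[OF hom[OF k]])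
      from q(2)[OF k r this] obtain z :: int
        where "poly (Q k (vmod N x)) (of_int (k (x + L *s y))) = poly (Q k (vmod N x)) (of_int (k x)) + of_int z"
        by (metis Ints_cases add.commute diff_add_cancel)
      then show ?thesis by (simp add: frac_def)
    qed
    moreover have "\<Psi> (x + L *s y) = \<Psi> x"
      using periodic_mod_mono[OF \<Psi> L(2)] by (simp add: periodic_mod_def)
    ultimately have "real_of_int (b (x + L *s y)) = real_of_int (b x)"
      using b_T[OF T] b_T[of "x + L *s y"] T by (simp add: vmod_L)
    then show ?thesis by simp
  qed

  obtain k0 where k0: "k0 \<in> K" using K(2) by blast
  \<comment> \<open>Each coset is given as a whole to one direction: to one satisfying
    \<open>B\<close> if there is any, and otherwise to \<open>k0\<close>, since \<open>b\<close> is
    then fully periodic on the coset.\<close>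
  define \<kappa> where "\<kappa> r = (if \<exists>k\<in>K. B k r then SOME k. k \<in> K \<and> B k r else k0)" for r
  have \<kappa>: "\<kappa> r \<in> K" "\<And>k. k \<in> K \<Longrightarrow> B k r \<Longrightarrow> B (\<kappa> r) r" for r
    unfolding \<kappa>_def using k0 someI_ex[of "\<lambda>k. k \<in> K \<and> B k r"] by (auto split: if_splits)
  define G where "G k x = (if \<kappa> (vmod N x) = k then b x else 0)" for k x
  show ?thesis
  proof (rule weakly_periodic_imp_periodic_tiling[OF K(1) L(1) F])
    show "G k x \<in> {0, 1}" for k x using b01 by (auto simp: G_def)
    show "invariant_along L k (G k)" if k: "k \<in> K" for k
      unfolding invariant_along_def
    proof (intro allI impI)
      fix x y assume y: "k y = 0"
      have "b (x + L *s y) = b x" if "\<kappa> (vmod N x) = k"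
      proof (cases "\<exists>k\<in>K. B k (vmod N x)")
        case True
        then have B: "B k (vmod N x)" using \<kappa>(2) that by blast
        obtain c where "L = N * c" using L(2) by (elim dvdE)
        then show ?thesis using b_B[OF k B, of "c *s y"] y by (simp add: lattice_hom_scale[OF hom[OF k]])
      next
        case False
        then show ?thesis using b_T' by blast
      qed
      then show "G k (x + L *s y) = G k x" by (simp add: G_def vmod_L)
    qed
    have "(\<Sum>k\<in>K. G k x) = b x" for x
      unfolding G_def using \<kappa>(1) finK by simp
    then show "(\<Sum>f\<in>F. \<Sum>k\<in>K. G k (x - f)) = 1" for x by (simp add: b_tile)
  qed
qed

lemma periodic_tiling_of_decomposition:
  fixes a :: "'d::finite lattice \<Rightarrow> int" and g :: "_ \<Rightarrow> 'd lattice \<Rightarrow> real"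
  assumes K: "directions K" "K \<noteq> {}" and N: "N > 0" and F: "finite F" "F \<noteq> {}"
    and a01: "\<And>x. a x \<in> {0, 1}" and tile: "\<And>x. (\<Sum>f\<in>F. a (x - f)) = 1"
    and \<Psi>: "periodic_mod N \<Psi>"
    and inv: "\<And>k. k \<in> K \<Longrightarrow> invariant_along N k (g k)"
    and g01: "\<And>k x. k \<in> K \<Longrightarrow> 0 \<le> g k x \<and> g k x \<le> 1"
    and dec: "\<And>x. real_of_int (a x) = \<Psi> x + (\<Sum>k\<in>K. g k x)"
    and int: "\<And>k x. k \<in> K \<Longrightarrow> g k x \<in> \<int> \<Longrightarrow> real_of_int (a x) = g k x"
  shows "\<exists>A. tiling_complement F A \<and> fully_periodic A"
proof -
  have hom: "\<And>k. k \<in> K \<Longrightarrow> lattice_hom k" using K by (auto simp: directions_def)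
  have "\<exists>N'>0. N dvd N' \<and> (\<forall>r. \<exists>P. phase_on N' k (g k) r P)" if "k \<in> K" for k
    using poly_phase[OF K(1) that N \<Psi> inv dec] unfolding phase_on_def by metis
  then obtain N' P where N': "N' > 0" "N dvd N'"
    and P: "\<And>k r. k \<in> K \<Longrightarrow> phase_on N' k (g k) r (P k r)"
    and irr: "\<And>k r. k \<in> K \<Longrightarrow> degree (P k r) = 0 \<or> (\<exists>i>0. coeff (P k r) i \<notin> \<rat>)"
    using common_phases[OF K(1) N] by metis
  obtain v where v: "\<And>k r. k \<in> K \<Longrightarrow> r \<in> range (vmod N') \<Longrightarrow>
      degree (P k r) = 0 \<or> poly (P k r) (of_int (k (N' *s v))) \<notin> \<rat>"
    using translate_to_irrational[where P = P, OF K(1) N'(1) irr finite_range_vmod[OF N'(1)]] by metis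
  \<comment> \<open>Translation by an element of \<open>N'\<close> times the lattice preserves every
    coset, and the value of a phase at \<open>k w\<close> becomes the constant coefficient of the
    translated phase.\<close>
  define w where "w = N' *s v"
  show ?thesis
  proof (rule periodic_tiling_of_phases[OF K N'(1) F])
    show "a (x + w) \<in> {0, 1}" for x by (rule a01)
    show "(\<Sum>f\<in>F. a (x - f + w)) = 1" for x using tile[of "x + w"] by (simp add: algebra_simps)
    show "periodic_mod N' (\<lambda>x. \<Psi> (x + w))"
      using periodic_mod_mono[OF \<Psi> N'(2)] unfolding periodic_mod_def by (metis add.assoc add.commute)
    show "invariant_along N' k (\<lambda>x. g k (x + w))" if "k \<in> K" for k
      using invariant_along_mono[OF inv[OF that] hom[OF that] N'(2)] unfolding invariant_along_def
      by (metis add.assoc add.commute)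
    show "0 \<le> g k (x + w) \<and> g k (x + w) \<le> 1" if "k \<in> K" for k x using g01[OF that] .
    show "real_of_int (a (x + w)) = \<Psi> (x + w) + (\<Sum>k\<in>K. g k (x + w))" for x by (rule dec)
    show "real_of_int (a (x + w)) = g k (x + w)" if "k \<in> K" "g k (x + w) \<in> \<int>" for k x using int that .
    show "phase_on N' k (\<lambda>x. g k (x + w)) r (pcompose (P k r) [:of_int (k w), 1:])" if k: "k \<in> K" for k r
      unfolding phase_on_def
    proof (intro allI impI)
      fix x assume "vmod N' x = vmod N' r"
      then have "vmod N' (x + w) = vmod N' r" by (simp add: w_def)
      then have "g k (x + w) - poly (P k r) (of_int (k (x + w))) \<in> \<int>"
        using P[OF k] by (simp add: phase_on_def)
      then show "g k (x + w) - poly (pcompose (P k r) [:of_int (k w), 1:]) (of_int (k x)) \<in> \<int>"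
        by (simp add: poly_pcompose lattice_hom_add[OF hom[OF k]] add.commute)
    qed
    show "degree (pcompose (P k r) [:of_int (k w), 1:]) = 0 \<or> coeff (pcompose (P k r) [:of_int (k w), 1:]) 0 \<notin> \<rat>"
      if "k \<in> K" "r \<in> range (vmod N')" for k r
      using v[OF that] by (simp add: w_def degree_pcompose flip: poly_0_coeff_0) (simp add: poly_pcompose)
  qed
qed

section \<open>Conditional expectations on invariant sets\<close>

definition add_subgroup :: "'g::ab_group_add set \<Rightarrow> bool" where
  "add_subgroup L \<longleftrightarrow> 0 \<in> L \<and> (\<forall>x\<in>L. \<forall>y\<in>L. x + y \<in> L) \<and> (\<forall>x\<in>L. - x \<in> L)"

locale preserving_action = prob_space M
  for M :: "'a measure" +
  fixes T :: "'g::{ab_group_add, countable} \<Rightarrow> 'a \<Rightarrow> 'a"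
  assumes T_measurable [measurable]: "T g \<in> measurable M M"
    and T_add: "\<omega> \<in> space M \<Longrightarrow> T (g + h) \<omega> = T g (T h \<omega>)"
    and T_0: "\<omega> \<in> space M \<Longrightarrow> T 0 \<omega> = \<omega>"
    and T_preserves: "distr M M (T g) = M"
begin

lemma T_space: "\<omega> \<in> space M \<Longrightarrow> T g \<omega> \<in> space M"
  using T_measurable by (rule measurable_space)

lemma T_commute: "\<omega> \<in> space M \<Longrightarrow> T g (T h \<omega>) = T h (T g \<omega>)"
  by (metis T_add add.commute)

lemma AE_T:
  assumes "AE \<omega> in M. P \<omega>"
  shows "AE \<omega> in M. P (T g \<omega>)"
proof (rule AE_distrD[OF T_measurable])
  show "AE \<omega> in distr M M (T g). P \<omega>" unfolding T_preserves by (rule assms)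
qed

lemma integrable_T: "integrable M f \<Longrightarrow> integrable M (\<lambda>\<omega>. f (T g \<omega>))" for f :: "'a \<Rightarrow> real"
  using integrable_distr[OF T_measurable[of g], of f] T_preserves by simp

lemma integral_T: "f \<in> borel_measurable M \<Longrightarrow> (\<integral>\<omega>. f (T g \<omega>) \<partial>M) = (\<integral>\<omega>. f \<omega> \<partial>M)" for f :: "'a \<Rightarrow> real"
  using integral_distr[OF T_measurable[of g], of f] T_preserves by simp

text \<open>Invariance is required at every point and not just almost everywhere, so that a
  conditional expectation is invariant along the orbit of every point; \<open>E_fixed\<close>
  provides the link to functions that are invariant almost everywhere.\<close>

definition inv_sets :: "'g set \<Rightarrow> 'a set set" where
  "inv_sets L = {S \<in> sets M. \<forall>h\<in>L. T h -` S \<inter> space M = S}"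

definition Inv :: "'g set \<Rightarrow> 'a measure" where
  "Inv L = sigma (space M) (inv_sets L)"

lemma inv_setsI:
  assumes "S \<in> sets M" "\<And>h \<omega>. h \<in> L \<Longrightarrow> \<omega> \<in> space M \<Longrightarrow> T h \<omega> \<in> S \<longleftrightarrow> \<omega> \<in> S"
  shows "S \<in> inv_sets L"
  using assms sets.sets_into_space[OF assms(1)] by (auto simp: inv_sets_def)

lemma inv_setsD:
  assumes "S \<in> inv_sets L"
  shows "S \<in> sets M" "h \<in> L \<Longrightarrow> \<omega> \<in> space M \<Longrightarrow> T h \<omega> \<in> S \<longleftrightarrow> \<omega> \<in> S"
  using assms by (auto simp: inv_sets_def)

lemma sigma_algebra_inv_sets: "sigma_algebra (space M) (inv_sets L)"
  unfolding sigma_algebra_iff2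
proof (intro conjI ballI allI impI)
  show "inv_sets L \<subseteq> Pow (space M)" using sets.sets_into_space by (auto simp: inv_sets_def)
  show "{} \<in> inv_sets L" by (simp add: inv_sets_def)
  show "space M - S \<in> inv_sets L" if "S \<in> inv_sets L" for S
    using inv_setsD[OF that] by (intro inv_setsI) (auto intro: T_space)
  show "(\<Union>i. A i) \<in> inv_sets L" if "range A \<subseteq> inv_sets L" for A :: "nat \<Rightarrow> _"
  proof (rule inv_setsI)
    show "(\<Union>i. A i) \<in> sets M" using that inv_setsD(1) by (intro sets.countable_UN) auto
    show "T h \<omega> \<in> (\<Union>i. A i) \<longleftrightarrow> \<omega> \<in> (\<Union>i. A i)" if "h \<in> L" "\<omega> \<in> space M" for h \<omega>
      using inv_setsD(2)[OF _ that] \<open>range A \<subseteq> inv_sets L\<close> by blast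
  qed
qed

lemma sets_Inv: "sets (Inv L) = inv_sets L"
  unfolding Inv_def by (rule sigma_algebra.sets_measure_of_eq[OF sigma_algebra_inv_sets])

lemma space_Inv: "space (Inv L) = space M"
  unfolding Inv_def by (rule sigma_algebra.space_measure_of_eq[OF sigma_algebra_inv_sets])

lemma subalgebra_Inv: "subalgebra M (Inv L)"
  by (auto simp: subalgebra_def space_Inv sets_Inv inv_sets_def)

lemma sigma_finite_subalgebra_Inv: "sigma_finite_subalgebra M (Inv L)"
  by (intro finite_measure_subalgebra_is_sigma_finite)
    (simp add: finite_measure_subalgebra_def finite_measure_subalgebra_axioms_def subalgebra_Inv finite_measure_axioms)

lemma measurable_InvI:
  fixes f :: "'a \<Rightarrow> real"
  assumes f: "f \<in> borel_measurable M" and inv: "\<And>h \<omega>. h \<in> L \<Longrightarrow> \<omega> \<in> space M \<Longrightarrow> f (T h \<omega>) = f \<omega>"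
  shows "f \<in> borel_measurable (Inv L)"
proof (rule measurableI)
  fix A :: "real set" assume "A \<in> sets borel"
  then have "f -` A \<inter> space M \<in> inv_sets L"
    using f by (intro inv_setsI measurable_sets) (auto simp: inv T_space)
  then show "f -` A \<inter> space (Inv L) \<in> sets (Inv L)" by (simp add: space_Inv sets_Inv)
qed simp

lemma measurable_InvD:
  fixes f :: "'a \<Rightarrow> real"
  assumes f: "f \<in> borel_measurable (Inv L)" and "h \<in> L" "\<omega> \<in> space M"
  shows "f (T h \<omega>) = f \<omega>"
proof -
  have "f -` {f \<omega>} \<inter> space (Inv L) \<in> sets (Inv L)" using f by (rule measurable_sets) simp
  then have "f -` {f \<omega>} \<inter> space M \<in> inv_sets L" by (simp add: space_Inv sets_Inv)
  from inv_setsD(2)[OF this assms(2,3)] show ?thesis using assms(3) by simp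
qed

abbreviation E :: "'g set \<Rightarrow> ('a \<Rightarrow> real) \<Rightarrow> 'a \<Rightarrow> real" where
  "E L f \<equiv> real_cond_exp M (Inv L) f"

lemma E_measurable_Inv: "E L f \<in> borel_measurable (Inv L)"
  by (rule borel_measurable_cond_exp)

lemma E_measurable [measurable]: "E L f \<in> borel_measurable M"
  by (rule borel_measurable_cond_exp2)

lemma E_integrable: "integrable M f \<Longrightarrow> integrable M (E L f)"
  by (rule sigma_finite_subalgebra.real_cond_exp_int(1)[OF sigma_finite_subalgebra_Inv])

lemma E_invariant: "h \<in> L \<Longrightarrow> \<omega> \<in> space M \<Longrightarrow> E L f (T h \<omega>) = E L f \<omega>"
  by (rule measurable_InvD[OF E_measurable_Inv])

lemma E_diff:
  assumes "integrable M f" "integrable M g"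
  shows "AE \<omega> in M. E L (\<lambda>\<omega>. f \<omega> - g \<omega>) \<omega> = E L f \<omega> - E L g \<omega>"
  by (rule sigma_finite_subalgebra.real_cond_exp_diff[OF sigma_finite_subalgebra_Inv assms])

lemma E_cong:
  assumes "AE \<omega> in M. f \<omega> = g \<omega>" "f \<in> borel_measurable M" "g \<in> borel_measurable M"
  shows "AE \<omega> in M. E L f \<omega> = E L g \<omega>"
  by (rule sigma_finite_subalgebra.real_cond_exp_cong[OF sigma_finite_subalgebra_Inv assms])

text \<open>An almost everywhere invariant function agrees almost everywhere with a strictly invariant one:
  cut it down to the invariant set where the invariance holds along the whole orbit.\<close>

lemma E_fixed:
  assumes L: "add_subgroup L" and f: "integrable M f"
    and inv: "\<And>h. h \<in> L \<Longrightarrow> AE \<omega> in M. f (T h \<omega>) = f \<omega>"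
  shows "AE \<omega> in M. E L f \<omega> = f \<omega>"
proof -
  have [measurable]: "f \<in> borel_measurable M" using f by simp
  define P where "P \<omega> \<longleftrightarrow> (\<forall>h\<in>L. f (T h \<omega>) = f \<omega>)" for \<omega>
  define G where "G = {\<omega> \<in> space M. \<forall>k\<in>L. P (T k \<omega>)}"
  have "AE \<omega> in M. P \<omega>" unfolding P_def using inv by (intro AE_ball_countable') auto
  then have AE_G: "AE \<omega> in M. \<omega> \<in> G"
    unfolding G_def using AE_space AE_ball_countable'[of L "\<lambda>k \<omega>. P (T k \<omega>)", OF AE_T] by auto
  have G_sets [measurable]: "G \<in> sets M" unfolding G_def P_def by measurable
  have G_inv: "T h \<omega> \<in> G \<longleftrightarrow> \<omega> \<in> G" if h: "h \<in> L" and \<omega>: "\<omega> \<in> space M" for h \<omega>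
  proof -
    have "(\<forall>k\<in>L. P (T k (T h \<omega>))) \<longleftrightarrow> (\<forall>k\<in>L. P (T (k + h) \<omega>))" by (simp add: T_add \<omega>)
    also have "\<dots> \<longleftrightarrow> (\<forall>k\<in>L. P (T k \<omega>))"
    proof safe
      fix k assume *: "\<forall>k\<in>L. P (T (k + h) \<omega>)" and "k \<in> L"
      then have "k - h \<in> L" using L h unfolding add_subgroup_def by (metis diff_conv_add_uminus)
      then show "P (T k \<omega>)" using * by force
    next
      fix k assume *: "\<forall>k\<in>L. P (T k \<omega>)" and "k \<in> L"
      then have "k + h \<in> L" using L h unfolding add_subgroup_def by blast
      then show "P (T (k + h) \<omega>)" using * by blast
    qed
    finally show ?thesis using \<omega> by (simp add: G_def T_space)
  qed
  define f' where "f' \<omega> = f \<omega> * indicator G \<omega>" for \<omega>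
  have f': "f' \<in> borel_measurable M" unfolding f'_def by measurable
  have "f' \<in> borel_measurable (Inv L)"
  proof (rule measurable_InvI[OF f'])
    fix h \<omega> assume h: "h \<in> L" and \<omega>: "\<omega> \<in> space M"
    have "f (T h \<omega>) = f \<omega>" if "\<omega> \<in> G"
    proof -
      have "P (T 0 \<omega>)" using that L unfolding G_def add_subgroup_def by blast
      then show ?thesis using h \<omega> by (simp add: P_def T_0)
    qed
    then show "f' (T h \<omega>) = f' \<omega>" using G_inv[OF h \<omega>] by (simp add: f'_def indicator_def)
  qed
  moreover have "integrable M f'" unfolding f'_def 
    using integrable_mult_indicator[OF G_sets f] by (simp add: mult.commute)
  ultimately have "AE \<omega> in M. E L f' \<omega> = f' \<omega>"
    by (intro sigma_finite_subalgebra.real_cond_exp_F_meas[OF sigma_finite_subalgebra_Inv])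
  moreover have eq: "AE \<omega> in M. f \<omega> = f' \<omega>" using AE_G by eventually_elim (simp add: f'_def)
  moreover have "AE \<omega> in M. E L f \<omega> = E L f' \<omega>" using eq f' by (intro E_cong) auto
  ultimately show ?thesis by eventually_elim simp
qed

text \<open>Since the group is commutative, \<open>T (- g)\<close> pulls invariant sets back to
  invariant sets; it also preserves the measure. So the shifted conditional expectation has the
  integrals that characterise the left-hand side.\<close>

lemma E_shift:
  assumes f: "integrable M f"
  shows "AE \<omega> in M. E L (\<lambda>\<omega>. f (T g \<omega>)) \<omega> = E L f (T g \<omega>)"
proof (rule sigma_finite_subalgebra.real_cond_exp_charact[OF sigma_finite_subalgebra_Inv])
  have [measurable]: "f \<in> borel_measurable M" using f by simp
  show "integrable M (\<lambda>\<omega>. f (T g \<omega>))" using f by (rule integrable_T)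
  show "integrable M (\<lambda>\<omega>. E L f (T g \<omega>))" using f by (intro integrable_T E_integrable)
  show "(\<lambda>\<omega>. E L f (T g \<omega>)) \<in> borel_measurable (Inv L)"
    by (rule measurable_InvI) (simp_all add: T_commute[of _ g] E_invariant T_space)
  fix A assume "A \<in> sets (Inv L)"
  then have A: "A \<in> inv_sets L" by (simp add: sets_Inv)
  note [measurable] = inv_setsD(1)[OF A]
  define A' where "A' = T (- g) -` A \<inter> space M"
  have A'_M [measurable]: "A' \<in> sets M" unfolding A'_def by measurable
  have A': "A' \<in> sets (Inv L)"
    unfolding sets_Inv
  proof (rule inv_setsI[OF A'_M])
    fix h \<omega> assume "h \<in> L" "\<omega> \<in> space M"
    then show "T h \<omega> \<in> A' \<longleftrightarrow> \<omega> \<in> A'"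
      using inv_setsD(2)[OF A, of h "T (- g) \<omega>"] by (simp add: A'_def T_space T_commute[of _ "- g"])
  qed
  have A'_T: "indicator A' (T g \<omega>) = (indicator A \<omega> :: real)" if "\<omega> \<in> space M" for \<omega>
    using that T_add[OF that, of "- g" g] by (simp add: A'_def indicator_def T_space T_0)
  have shift: "(\<integral>\<omega>\<in>A. u (T g \<omega>) \<partial>M) = (\<integral>\<omega>\<in>A'. u \<omega> \<partial>M)" if [measurable]: "u \<in> borel_measurable M" for u :: "'a \<Rightarrow> real"
  proof -
    have "(\<integral>\<omega>\<in>A. u (T g \<omega>) \<partial>M) = (\<integral>\<omega>. (\<lambda>\<omega>. indicator A' \<omega> * u \<omega>) (T g \<omega>) \<partial>M)"
      unfolding set_lebesgue_integral_def by (intro Bochner_Integration.integral_cong) (simp_all add: A'_T)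
    also have "\<dots> = (\<integral>\<omega>\<in>A'. u \<omega> \<partial>M)"
      unfolding set_lebesgue_integral_def by (subst integral_T) simp_all
    finally show ?thesis .
  qed
  show "(\<integral>\<omega>\<in>A. f (T g \<omega>) \<partial>M) = (\<integral>\<omega>\<in>A. E L f (T g \<omega>) \<partial>M)"
    unfolding shift[OF \<open>f \<in> borel_measurable M\<close>] shift[OF E_measurable]
    by (rule sigma_finite_subalgebra.real_cond_exp_intA[OF sigma_finite_subalgebra_Inv f A'])
qed

lemma fdiffs_integrable:
  fixes f :: "'a \<Rightarrow> real"
  assumes "integrable M f"
  shows "integrable M (\<lambda>\<omega>. fdiffs hs (\<lambda>x. f (T x \<omega>)) y)"
  by (induction hs arbitrary: y) (auto simp: fdiff_def[of _ "fdiffs _ _"] intro: integrable_T[OF assms])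

lemma E_fdiffs:
  assumes f: "integrable M f"
  shows "AE \<omega> in M. E L (\<lambda>\<omega>. fdiffs hs (\<lambda>x. f (T x \<omega>)) y) \<omega> = fdiffs hs (\<lambda>x. E L f (T x \<omega>)) y"
proof (induction hs arbitrary: y)
  case Nil
  show ?case using E_shift[OF f, of L y] by simp
next
  case (Cons h hs)
  show ?case
    using E_diff[OF fdiffs_integrable[OF f, of hs "y + h"] fdiffs_integrable[OF f, of hs y], of L] Cons[of "y + h"] Cons[of y]
    by eventually_elim (simp add: fdiff_def[of _ "fdiffs _ _"])
qed

lemma fdiffs_T:
  "\<omega> \<in> space M \<Longrightarrow> fdiffs hs (\<lambda>x. f (T x (T h \<omega>))) y = fdiffs hs (\<lambda>x. f (T x \<omega>)) (y + h)"
  by (induction hs arbitrary: y) (simp_all add: T_add fdiff_def[of _ "fdiffs _ _"] add_ac)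

text \<open>The inner expectation is invariant under \<open>a\<close>, which passes through the
  outer one by \<open>E_shift\<close>; the outer one is invariant under \<open>b\<close>. Averaging
  over two different kernels thus gives invariance under their sum, the source of the periodic
  part.\<close>

lemma E_E_invariant:
  assumes f: "integrable M f" and "a \<in> L" "b \<in> L'"
  shows "AE \<omega> in M. E L' (E L f) (T (a + b) \<omega>) = E L' (E L f) \<omega>"
proof -
  have "AE \<omega> in M. E L f (T a \<omega>) = E L f \<omega>" using assms(2) by (intro AE_I2 E_invariant)
  then have 1: "AE \<omega> in M. E L' (\<lambda>\<omega>. E L f (T a \<omega>)) \<omega> = E L' (E L f) \<omega>" by (intro E_cong) simp_all
  from 1 E_shift[OF E_integrable[OF f], of L' L a] AE_space show ?thesis
  proof eventually_elim
    case (elim \<omega>)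
    have "E L' (E L f) (T (a + b) \<omega>) = E L' (E L f) (T b (T a \<omega>))"
      using elim(3) by (simp add: T_add add.commute[of a b])
    also have "\<dots> = E L' (E L f) (T a \<omega>)" using assms(3) elim(3) by (intro E_invariant T_space)
    finally show ?case using elim by simp
  qed
qed

text \<open>If \<open>f\<close> is killed by all mixed differences along \<open>L\<^sub>1, \<dots>, L\<^sub>m\<close>, then \<open>f - E L\<^sub>1 f\<close> is killed by those
  along \<open>L\<^sub>2, \<dots>, L\<^sub>m\<close>, since the latter turn \<open>f\<close> into an \<open>L\<^sub>1\<close>-invariant function.\<close>

lemma invariant_decomposition:
  assumes "\<And>L. L \<in> set Ls \<Longrightarrow> add_subgroup L"
    and "sorted_wrt (\<lambda>L L'. \<forall>\<gamma>\<in>\<Gamma>. \<exists>a\<in>L. \<exists>b\<in>L'. \<gamma> = a + b) Ls"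
    and "integrable M f"
    and "\<And>hs. list_all2 (\<in>) hs Ls \<Longrightarrow> AE \<omega> in M. fdiffs hs (\<lambda>x. f (T x \<omega>)) 0 = 0"
  shows "\<exists>\<Psi>. integrable M \<Psi> \<and> (AE \<omega> in M. f \<omega> = (\<Sum>L\<leftarrow>Ls. E L f \<omega>) + \<Psi> \<omega>) \<and>
    (\<forall>\<gamma>\<in>\<Gamma>. AE \<omega> in M. \<Psi> (T \<gamma> \<omega>) = \<Psi> \<omega>)"
  using assms
proof (induction Ls arbitrary: f)
  case Nil
  have "AE \<omega> in M. f (T 0 \<omega>) = 0" using Nil(4)[of "[]"] by simp
  then have "AE \<omega> in M. f \<omega> = 0" using AE_space by eventually_elim (simp add: T_0)
  then show ?case by (intro exI[of _ "\<lambda>_. 0"]) simp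
next
  case (Cons L Ls)
  note f = Cons.prems(3)
  define f1 where "f1 \<omega> = f \<omega> - E L f \<omega>" for \<omega>
  have f1: "integrable M f1" unfolding f1_def using f by (intro Bochner_Integration.integrable_diff E_integrable)
  have "AE \<omega> in M. fdiffs hs (\<lambda>x. f1 (T x \<omega>)) 0 = 0" if hs: "list_all2 (\<in>) hs Ls" for hs
  proof -
    define u where "u \<omega> = fdiffs hs (\<lambda>x. f (T x \<omega>)) 0" for \<omega>
    have u: "integrable M u" unfolding u_def by (rule fdiffs_integrable[OF f])
    have "AE \<omega> in M. u (T h \<omega>) = u \<omega>" if h: "h \<in> L" for h
    proof -
      have "AE \<omega> in M. fdiffs (h # hs) (\<lambda>x. f (T x \<omega>)) 0 = 0" using hs h by (intro Cons.prems(4)) simp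
      then show ?thesis
        using AE_space
        by eventually_elim (simp add: u_def fdiffs_T fdiff_def[of _ "fdiffs _ _"])
    qed
    then have "AE \<omega> in M. E L u \<omega> = u \<omega>" using Cons.prems(1) u by (intro E_fixed) auto
    moreover have "AE \<omega> in M. E L u \<omega> = fdiffs hs (\<lambda>x. E L f (T x \<omega>)) 0"
      unfolding u_def by (rule E_fdiffs[OF f])
    ultimately show ?thesis
      by eventually_elim (simp add: f1_def fdiffs_diff u_def)
  qed
  then have "\<exists>\<Psi>. integrable M \<Psi> \<and> (AE \<omega> in M. f1 \<omega> = (\<Sum>L\<leftarrow>Ls. E L f1 \<omega>) + \<Psi> \<omega>) \<and>
    (\<forall>\<gamma>\<in>\<Gamma>. AE \<omega> in M. \<Psi> (T \<gamma> \<omega>) = \<Psi> \<omega>)"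
    using Cons.prems f1 by (intro Cons.IH) auto
  then obtain \<Psi> where \<Psi>: "integrable M \<Psi>" "AE \<omega> in M. f1 \<omega> = (\<Sum>L\<leftarrow>Ls. E L f1 \<omega>) + \<Psi> \<omega>"
    "\<And>\<gamma>. \<gamma> \<in> \<Gamma> \<Longrightarrow> AE \<omega> in M. \<Psi> (T \<gamma> \<omega>) = \<Psi> \<omega>" by blast
  \<comment> \<open>\<open>E L' f1\<close> differs from \<open>E L' f\<close> by a double
    expectation. By the sortedness hypothesis these are almost everywhere invariant under
    \<open>\<Gamma>\<close>, so they are moved into the periodic part.\<close>
  define \<Psi>' where "\<Psi>' \<omega> = \<Psi> \<omega> - (\<Sum>L'\<leftarrow>Ls. E L' (E L f) \<omega>)" for \<omega>
  have int': "integrable M (\<lambda>\<omega>. \<Sum>L'\<leftarrow>Ls'. E L' (E L f) \<omega>)" for Ls'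
    by (induction Ls') (auto intro: E_integrable[OF E_integrable[OF f]])
  have E_f1: "AE \<omega> in M. \<forall>L'\<in>set Ls. E L' f1 \<omega> = E L' f \<omega> - E L' (E L f) \<omega>"
    unfolding f1_def using f by (intro AE_ball_countable' E_diff E_integrable) (auto simp: countable_finite)
  show ?case
  proof (intro exI[of _ \<Psi>'] conjI ballI)
    show "integrable M \<Psi>'" unfolding \<Psi>'_def using \<Psi>(1) int' by (intro Bochner_Integration.integrable_diff)
    show "AE \<omega> in M. f \<omega> = (\<Sum>L\<leftarrow>L # Ls. E L f \<omega>) + \<Psi>' \<omega>"
      using \<Psi>(2) E_f1
    proof eventually_elim
      case (elim \<omega>)
      have "(\<Sum>L'\<leftarrow>Ls. E L' f1 \<omega>) = (\<Sum>L'\<leftarrow>Ls. E L' f \<omega> - E L' (E L f) \<omega>)"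
        using elim(2) by (intro arg_cong[of _ _ sum_list] map_cong) auto
      then show ?case using elim(1) by (simp add: f1_def \<Psi>'_def sum_list_subtractf)
    qed
    fix \<gamma> assume \<gamma>: "\<gamma> \<in> \<Gamma>"
    have "AE \<omega> in M. E L' (E L f) (T \<gamma> \<omega>) = E L' (E L f) \<omega>" if "L' \<in> set Ls" for L'
    proof -
      have "\<exists>a\<in>L. \<exists>b\<in>L'. \<gamma> = a + b" using Cons.prems(2) that \<gamma> by simp
      then show ?thesis using E_E_invariant[OF f] by blast
    qed
    then have "AE \<omega> in M. \<forall>L'\<in>set Ls. E L' (E L f) (T \<gamma> \<omega>) = E L' (E L f) \<omega>"
      by (intro AE_ball_countable') (auto simp: countable_finite)
    then show "AE \<omega> in M. \<Psi>' (T \<gamma> \<omega>) = \<Psi>' \<omega>"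
      using \<Psi>(3)[OF \<gamma>]
    proof eventually_elim
      case (elim \<omega>)
      have "(\<Sum>L'\<leftarrow>Ls. E L' (E L f) (T \<gamma> \<omega>)) = (\<Sum>L'\<leftarrow>Ls. E L' (E L f) \<omega>)"
        using elim(1) by (intro arg_cong[of _ _ sum_list] map_cong) auto
      then show ?case using elim(2) by (simp add: \<Psi>'_def)
    qed
  qed
qed

text \<open>The set where the conditional expectation vanishes is itself invariant, so
  \<open>f\<close> has integral 0 over it.\<close>

lemma E_eq_0:
  assumes f: "integrable M f" and nonneg: "\<And>\<omega>. \<omega> \<in> space M \<Longrightarrow> 0 \<le> f \<omega>"
  shows "AE \<omega> in M. E L f \<omega> = 0 \<longrightarrow> f \<omega> = 0"
proof -
  define A where "A = {\<omega> \<in> space M. E L f \<omega> = 0}"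
  have A: "A \<in> sets (Inv L)"
    using measurable_sets[OF E_measurable_Inv[of L f], of "{0}"] by (simp add: A_def space_Inv vimage_def Int_def conj_commute)
  then have [measurable]: "A \<in> sets M" using inv_setsD(1) by (simp add: sets_Inv)
  have "(\<integral>\<omega>\<in>A. f \<omega> \<partial>M) = (\<integral>\<omega>\<in>A. E L f \<omega> \<partial>M)"
    by (rule sigma_finite_subalgebra.real_cond_exp_intA[OF sigma_finite_subalgebra_Inv f A])
  also have "\<dots> = (\<integral>\<omega>. 0 \<partial>M)"
    unfolding set_lebesgue_integral_def by (intro Bochner_Integration.integral_cong) (auto simp: A_def indicator_def)
  finally have "(\<integral>\<omega>. indicator A \<omega> * f \<omega> \<partial>M) = 0" by (simp add: set_lebesgue_integral_def)
  moreover have "integrable M (\<lambda>\<omega>. indicator A \<omega> * f \<omega>)"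
    using integrable_mult_indicator[OF \<open>A \<in> sets M\<close> f] by simp
  moreover have "AE \<omega> in M. 0 \<le> indicator A \<omega> * f \<omega>" using nonneg by (intro AE_I2) (simp add: indicator_def)
  ultimately have "AE \<omega> in M. indicator A \<omega> * f \<omega> = 0" using integral_nonneg_eq_0_iff_AE by blast
  then show ?thesis using AE_space by eventually_elim (auto simp: A_def indicator_def)
qed

lemma E_eq_1:
  assumes f: "integrable M f" and le1: "\<And>\<omega>. \<omega> \<in> space M \<Longrightarrow> f \<omega> \<le> 1"
  shows "AE \<omega> in M. E L f \<omega> = 1 \<longrightarrow> f \<omega> = 1"
proof -
  have int1: "integrable M (\<lambda>_. 1 :: real)" by simp
  have "AE \<omega> in M. E L (\<lambda>\<omega>. 1) \<omega> = 1" by (rule sigma_finite_subalgebra.real_cond_exp_F_meas[OF sigma_finite_subalgebra_Inv]) auto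
  moreover have "AE \<omega> in M. E L (\<lambda>\<omega>. 1 - f \<omega>) \<omega> = E L (\<lambda>\<omega>. 1) \<omega> - E L f \<omega>" by (rule E_diff[OF int1 f])
  moreover have "AE \<omega> in M. E L (\<lambda>\<omega>. 1 - f \<omega>) \<omega> = 0 \<longrightarrow> 1 - f \<omega> = 0"
    using f le1 by (intro E_eq_0) auto
  ultimately show ?thesis by eventually_elim auto
qed

lemma E_bounds:
  assumes "integrable M f" "\<And>\<omega>. \<omega> \<in> space M \<Longrightarrow> 0 \<le> f \<omega> \<and> f \<omega> \<le> 1"
  shows "AE \<omega> in M. 0 \<le> E L f \<omega> \<and> E L f \<omega> \<le> 1"
proof -
  have "AE \<omega> in M. 0 \<le> E L f \<omega>"
    using assms by (intro sigma_finite_subalgebra.real_cond_exp_ge_c[OF sigma_finite_subalgebra_Inv] AE_I2) auto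
  moreover have "AE \<omega> in M. E L f \<omega> \<le> 1"
    using assms by (intro sigma_finite_subalgebra.real_cond_exp_le_c[OF sigma_finite_subalgebra_Inv] AE_I2) auto
  ultimately show ?thesis by eventually_elim simp
qed

end

section \<open>Rational affine circles\<close>

lemma additive_bounded_imp_0:
  fixes A :: "real \<Rightarrow> real"
  assumes add: "\<And>s t. A (s + t) = A s + A t" and bound: "\<And>t. \<bar>A t\<bar> \<le> B"
  shows "A t = 0"
proof (rule ccontr)
  assume "A t \<noteq> 0"
  have "A 0 = 0" using add[of 0 0] by simp
  then have mult: "A (real n * t) = real n * A t" for n
    by (induction n) (simp_all add: add distrib_right)
  obtain n :: nat where "B / \<bar>A t\<bar> < real n" using reals_Archimedean2 by blast
  then have "B < \<bar>real n * A t\<bar>" using \<open>A t \<noteq> 0\<close> by (simp add: pos_divide_less_eq abs_mult)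
  then show False using bound[of "real n * t"] mult by simp
qed

lemma continuous_Ints_const:
  fixes f :: "real \<Rightarrow> real"
  assumes cont: "continuous_on UNIV f" and int: "\<And>t. f t \<in> \<int>"
  shows "f t = f 0"
proof -
  have "f constant_on UNIV"
  proof (rule continuous_discrete_range_constant[OF connected_UNIV cont])
    fix x :: real
    show "\<exists>e>0. \<forall>y. y \<in> UNIV \<and> f y \<noteq> f x \<longrightarrow> e \<le> norm (f y - f x)"
    proof (intro exI[of _ 1] conjI allI impI)
      fix y assume "y \<in> UNIV \<and> f y \<noteq> f x"
      then have "f y - f x \<in> \<int>" "f y - f x \<noteq> 0" using int by auto
      then show "1 \<le> norm (f y - f x)" using Ints_nonzero_abs_ge1[of "f y - f x"] by simp
    qed simp
  qed
  then show ?thesis unfolding constant_on_def by (metis UNIV_I)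
qed

lemma cis_eq_iff_Ints: "cis s = cis t \<longleftrightarrow> (s - t) / (2 * pi) \<in> \<int>"
proof -
  have "cis s = cis t \<longleftrightarrow> cis (s - t) = 1" by (simp add: cis_divide[symmetric])
  also have "\<dots> \<longleftrightarrow> (s - t) / (2 * pi) \<in> \<int>"
    using unit_exp_eq_1_iff[of "(s - t) / (2 * pi)"] by (simp add: unit_exp_def)
  finally show ?thesis .
qed

text \<open>Lift \<open>t \<mapsto> \<eta> (cis t)\<close> through the exponential. The failure of
  additivity is continuous with values in the multiples of \<open>2 * pi\<close>, hence constant in
  \<open>t\<close>; subtracting the value at 0 removes it.\<close>

lemma circle_character_lift:
  fixes \<eta> :: "complex \<Rightarrow> complex"
  assumes cont: "continuous_on (sphere 0 1) \<eta>" and norm: "\<And>z. z \<in> sphere 0 1 \<Longrightarrow> cmod (\<eta> z) = 1"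
    and mult: "\<And>z w. z \<in> sphere 0 1 \<Longrightarrow> w \<in> sphere 0 1 \<Longrightarrow> \<eta> (z * w) = \<eta> z * \<eta> w"
  obtains A :: "real \<Rightarrow> real" where "continuous_on UNIV A" "\<And>s t. A (s + t) = A s + A t"
    "\<And>t. \<eta> (cis t) = cis (A t)"
proof -
  have cis: "cis t \<in> sphere 0 1" for t by simp
  have c: "continuous_on UNIV (\<lambda>t. \<eta> (cis t))"
  proof (rule continuous_on_compose2[OF cont])
    show "continuous_on UNIV cis" by (intro continuous_intros)
    show "range cis \<subseteq> sphere 0 1" by auto
  qed
  have nz: "\<eta> (cis t) \<noteq> 0" for t using norm[OF cis, of t] by auto
  obtain g where g: "continuous_on UNIV g" "\<And>t::real. \<eta> (cis t) = exp (g t)"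
    using continuous_logarithm_on_contractible[OF c convex_imp_contractible[OF convex_UNIV] nz] by auto
  define l where "l t = Im (g t)" for t
  have l_cont: "continuous_on UNIV l" unfolding l_def using g(1) by (intro continuous_intros)
  have l: "\<eta> (cis t) = cis (l t)" for t
  proof -
    have "exp (Re (g t)) = 1" using norm[OF cis, of t] g(2)[of t] by simp
    then show ?thesis using g(2)[of t] by (simp add: exp_eq_polar l_def)
  qed
  have "cis (l (s + t)) = cis (l s + l t)" for s t
    using mult[OF cis cis, of s t] unfolding cis_mult l .
  then have int: "(l (s + t) - (l s + l t)) / (2 * pi) \<in> \<int>" for s t
    by (simp only: cis_eq_iff_Ints)
  have add: "l (s + t) = l s + l t - l 0" for s t
  proof -
    have "continuous_on UNIV (\<lambda>t. (l (s + t) - (l s + l t)) / (2 * pi))"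
      by (intro continuous_intros continuous_on_compose2[OF l_cont]) auto
    from continuous_Ints_const[OF this int, of t] have "l (s + t) - (l s + l t) = l (s + 0) - (l s + l 0)"
      by (metis divide_cancel_right mult_eq_0_iff pi_neq_zero zero_neq_numeral)
    then show ?thesis by simp
  qed
  have "\<eta> 1 * \<eta> 1 = \<eta> 1" "\<eta> 1 \<noteq> 0" using mult[of 1 1] norm[of 1] by auto
  then have "cis (l 0) = 1" using l[of 0] by simp
  show thesis
  proof (rule that[of "\<lambda>t. l t - l 0"])
    show "continuous_on UNIV (\<lambda>t. l t - l 0)" using l_cont by (intro continuous_intros)
    show "\<eta> (cis t) = cis (l t - l 0)" for t
      using \<open>cis (l 0) = 1\<close> by (simp add: l cis_divide[symmetric])
  qed (simp add: add)
qed

text \<open>The level function of a circle \<open>\<phi>\<close> sends \<open>g\<close> to the winding number of \<open>z \<mapsto> \<phi> z g\<close>.\<close>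

lemma one_dim_subtorus_level:
  fixes H :: "('d::finite lattice \<Rightarrow> complex) set"
  assumes "one_dim_subtorus H"
  obtains k where "lattice_hom k" "\<exists>x. k x \<noteq> 0" "\<And>\<theta> x. \<theta> \<in> H \<Longrightarrow> k x = 0 \<Longrightarrow> \<theta> x = 1"
proof -
  obtain \<phi> \<psi> where H: "H \<subseteq> dual_group" and homeo: "homeomorphism (sphere (0::complex) 1) H \<phi> \<psi>"
    and mult: "\<And>z w g. z \<in> sphere 0 1 \<Longrightarrow> w \<in> sphere 0 1 \<Longrightarrow> \<phi> (z * w) g = \<phi> z g * \<phi> w g"
    using assms unfolding one_dim_subtorus_def by blast
  have \<phi>_H: "\<phi> z \<in> H" if "z \<in> sphere 0 1" for z using homeo that unfolding homeomorphism_def by blast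
  have cont: "continuous_on (sphere 0 1) (\<lambda>z. \<phi> z g)" for g
    using homeomorphism_cont1[OF homeo] by (rule continuous_on_product_then_coordinatewise)
  have norm: "cmod (\<phi> z g) = 1" if "z \<in> sphere 0 1" for z g
    using \<phi>_H[OF that] H by (auto simp: dual_group_def)
  have "\<exists>A. continuous_on UNIV A \<and> (\<forall>s t. A (s + t) = A s + A t) \<and> (\<forall>t. \<phi> (cis t) g = cis (A t))" for g
    using circle_character_lift[OF cont norm mult, of g] by metis
  then obtain A where A: "\<And>g. continuous_on UNIV (A g)" "\<And>g s t. A g (s + t) = A g s + A g t"
    "\<And>g t. \<phi> (cis t) g = cis (A g t)" by metis
  have A0: "A g 0 = 0" for g using A(2)[of g 0 0] by simp
  have unique: "f t = 0" if f: "continuous_on UNIV f" "\<And>t. cis (f t) = 1" "f 0 = 0" for f :: "real \<Rightarrow> real" and t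
  proof -
    have "(f t - 0) / (2 * pi) \<in> \<int>" for t using f(2)[of t] cis_eq_iff_Ints[of "f t" 0] by simp
    moreover have "continuous_on UNIV (\<lambda>t. (f t - 0) / (2 * pi))" using f(1) by (intro continuous_intros) auto
    ultimately have "(f t - 0) / (2 * pi) = (f 0 - 0) / (2 * pi)" by (intro continuous_Ints_const)
    then show ?thesis using f(3) by simp
  qed
  have A_hom: "A (g + h) t = A g t + A h t" for g h t
  proof -
    have "A (g + h) t - (A g t + A h t) = 0"
    proof (rule unique[of "\<lambda>t. A (g + h) t - (A g t + A h t)"])
      show "continuous_on UNIV (\<lambda>t. A (g + h) t - (A g t + A h t))" by (intro continuous_intros A(1))
      have "\<phi> (cis t) (g + h) = \<phi> (cis t) g * \<phi> (cis t) h" for t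
        using \<phi>_H[of "cis t"] H by (auto simp: dual_group_def)
      then show "cis (A (g + h) t - (A g t + A h t)) = 1" for t
        by (simp add: A(3) cis_mult cis_divide[symmetric])
    qed (simp add: A0)
    then show ?thesis by simp
  qed
  define k where "k g = \<lfloor>A g (2 * pi) / (2 * pi)\<rfloor>" for g
  have k: "of_int (k g) = A g (2 * pi) / (2 * pi)" for g
  proof -
    have "cis (A g (2 * pi)) = cis 0" using A(3)[of "2 * pi" g] A(3)[of 0 g] A0 by simp
    then have "A g (2 * pi) / (2 * pi) \<in> \<int>" by (simp only: cis_eq_iff_Ints) simp
    then show ?thesis by (simp add: k_def)
  qed
  \<comment> \<open>Winding number 0 makes the additive function \<open>A g\<close> periodic and
    thus bounded, and a bounded additive function vanishes.\<close>
  have trivial: "A g t = 0" if "k g = 0" for g t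
  proof -
    have per: "A g (2 * pi) = 0" using k[of g] that by simp
    have "bounded (A g ` {0..2 * pi})"
      using A(1) by (intro compact_imp_bounded compact_continuous_image continuous_on_subset[OF A(1)]) auto
    then obtain B where "\<forall>y\<in>A g ` {0..2 * pi}. norm y \<le> B" unfolding bounded_iff by blast
    then have B: "\<bar>A g t\<bar> \<le> B" if "t \<in> {0..2 * pi}" for t using that by simp
    have "A g (real_of_int n * (2 * pi)) = 0" for n
    proof (induction n rule: int_induct[where k = 0])
      case (step1 i)
      then show ?case using A(2)[of g "real_of_int i * (2 * pi)" "2 * pi"] per by (simp add: distrib_right)
    next
      case (step2 i)
      then show ?case using A(2)[of g "real_of_int (i - 1) * (2 * pi)" "2 * pi"] per by (simp add: left_diff_distrib)
    qed (simp add: A0)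
    note per_n = this
    have "\<bar>A g t\<bar> \<le> B" for t
    proof -
      define n where "n = \<lfloor>t / (2 * pi)\<rfloor>"
      define s where "s = t - real_of_int n * (2 * pi)"
      have "real_of_int n \<le> t / (2 * pi)" "t / (2 * pi) < real_of_int n + 1" unfolding n_def by linarith+
      then have "s \<in> {0..2 * pi}"
        by (auto simp: s_def pos_le_divide_eq pos_divide_less_eq algebra_simps)
      moreover have "A g t = A g s" using A(2)[of g s "real_of_int n * (2 * pi)"] per_n[of n] by (simp add: s_def)
      ultimately show ?thesis using B by simp
    qed
    then show ?thesis using additive_bounded_imp_0[of "A g"] A(2) by blast
  qed
  show thesis
  proof (rule that[of k])
    show "lattice_hom k"
      unfolding lattice_hom_def
    proof (intro allI)
      fix x y
      have "real_of_int (k (x + y)) = real_of_int (k x + k y)"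
        by (simp add: k A_hom add_divide_distrib)
      then show "k (x + y) = k x + k y" by simp
    qed
    \<comment> \<open>If all winding numbers vanished, \<open>\<phi>\<close> would take the same
      value at 1 and at -1, against injectivity.\<close>
    show "\<exists>x. k x \<noteq> 0"
    proof (rule ccontr)
      assume "\<not> (\<exists>x. k x \<noteq> 0)"
      then have "A x t = 0" for x t by (intro trivial) simp
      then have "\<phi> (cis pi) = \<phi> (cis 0)" by (intro ext) (simp only: A(3))
      moreover have "inj_on \<phi> (sphere 0 1)"
        using homeo unfolding homeomorphism_def by (metis inj_onI)
      ultimately have "cis pi = cis 0" using inj_onD[of \<phi> "sphere 0 1" "cis pi" "cis 0"] by auto
      then show False by simp
    qed
    fix \<theta> x assume \<theta>: "\<theta> \<in> H" and "k x = 0"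
    obtain z where z: "z \<in> sphere 0 1" "\<theta> = \<phi> z" using homeo \<theta> unfolding homeomorphism_def by blast
    have "z = cis (Arg z)" using z(1) cis_Arg[of z] by (cases "z = 0") (auto simp: sgn_eq)
    then obtain t where "z = cis t" by blast
    then show "\<theta> x = 1" using z trivial[OF \<open>k x = 0\<close>] by (simp add: A(3))
  qed
qed

lemma dual_group_power:
  assumes "\<theta> \<in> dual_group"
  shows "\<theta> (int n *s x) = \<theta> x ^ n"
proof (induction n)
  case 0
  have 1: "\<theta> (0 + 0) = \<theta> 0 * \<theta> 0" "cmod (\<theta> 0) = 1" using assms unfolding dual_group_def by blast+
  then have "\<theta> 0 \<noteq> 0" by auto
  then have "\<theta> 0 = 1" using 1(1) by simp
  then show ?case by simp
next
  case (Suc n)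
  have "\<theta> (int (Suc n) *s x) = \<theta> (x + int n *s x)" by (simp add: vector_sadd_rdistrib)
  also have "\<dots> = \<theta> x * \<theta> (int n *s x)" using assms by (simp add: dual_group_def)
  finally show ?case using Suc by simp
qed

text \<open>On the kernel of the level function only the torsion character is left, and an exponent
  \<open>n\<close> of it makes it trivial on \<open>n\<close>-fold multiples.\<close>

lemma rational_affine_circle_level:
  fixes C :: "('d::finite lattice \<Rightarrow> complex) set"
  assumes "rational_affine_circle C"
  obtains k n where "lattice_hom k" "\<exists>x. k x \<noteq> 0" "n > (0::nat)" "C \<subseteq> dual_group"
    "\<And>\<theta> x. \<theta> \<in> C \<Longrightarrow> k x = 0 \<Longrightarrow> \<theta> (int n *s x) = 1"
proof -
  obtain \<tau> H where \<tau>: "torsion_character \<tau>" and H: "one_dim_subtorus H" and C: "C = (\<lambda>\<theta> g. \<tau> g * \<theta> g) ` H"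
    using assms unfolding rational_affine_circle_def by blast
  obtain k where k: "lattice_hom k" "\<exists>x. k x \<noteq> 0" "\<And>\<theta> x. \<theta> \<in> H \<Longrightarrow> k x = 0 \<Longrightarrow> \<theta> x = 1"
    using one_dim_subtorus_level[OF H] by metis
  obtain n :: nat where n: "n > 0" "\<And>g. \<tau> g ^ n = 1" using \<tau> unfolding torsion_character_def by metis
  have dual: "\<tau> \<in> dual_group" "H \<subseteq> dual_group" using \<tau> H by (auto simp: torsion_character_def one_dim_subtorus_def)
  have C_dual: "C \<subseteq> dual_group" using dual by (auto simp: C dual_group_def norm_mult)
  show thesis
  proof (rule that[OF k(1,2) n(1) C_dual])
    fix \<theta> x assume \<theta>: "\<theta> \<in> C" and "k x = 0"
    then obtain \<theta>' where \<theta>': "\<theta>' \<in> H" "\<theta> = (\<lambda>g. \<tau> g * \<theta>' g)" by (auto simp: C)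
    have "\<theta> (int n *s x) = \<theta> x ^ n" using \<theta> C_dual by (intro dual_group_power) auto
    also have "\<dots> = 1" using n(2) k(3)[OF \<theta>'(1) \<open>k x = 0\<close>] by (simp add: \<theta>'(2) power_mult_distrib)
    finally show "\<theta> (int n *s x) = 1" .
  qed
qed

section \<open>The spectral measure\<close>

text \<open>Every point of the space off the support has a basic open neighbourhood of measure 0,
  and there are only countably many basic sets.\<close>

lemma AE_measure_support:
  fixes \<sigma> :: "'b::second_countable_topology measure"
  assumes sets: "sets \<sigma> = sets (restrict_space borel S)"
  shows "AE \<theta> in \<sigma>. \<theta> \<in> measure_support \<sigma>"
proof -
  obtain B :: "'b set set" where B: "countable B" "topological_basis B" using ex_countable_basis by blast
  have space: "space \<sigma> = S" using sets_eq_imp_space_eq[OF sets] by (simp add: space_restrict_space)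
  define N where "N = {U \<in> B. emeasure \<sigma> (U \<inter> space \<sigma>) = 0}"
  have "AE \<theta> in \<sigma>. \<forall>U\<in>N. \<theta> \<notin> U"
  proof (rule AE_ball_countable')
    show "countable N" using B(1) unfolding N_def by (rule countable_subset[rotated]) auto
    fix U assume U: "U \<in> N"
    then have "open U" using B(2) topological_basis_open unfolding N_def by blast
    then have "U \<inter> space \<sigma> \<in> sets \<sigma>" unfolding sets space by (auto simp: sets_restrict_space)
    then have "U \<inter> space \<sigma> \<in> null_sets \<sigma>" using U by (auto simp: N_def)
    then show "AE \<theta> in \<sigma>. \<theta> \<notin> U" by (rule AE_I') auto
  qed
  then show ?thesis
    using AE_space
  proof eventually_elim
    case (elim \<theta>)
    have "emeasure \<sigma> (U \<inter> space \<sigma>) > 0" if U: "open U" "\<theta> \<in> U" for U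
    proof (rule ccontr)
      assume "\<not> emeasure \<sigma> (U \<inter> space \<sigma>) > 0"
      then have 0: "emeasure \<sigma> (U \<inter> space \<sigma>) = 0" by simp
      obtain V where V: "V \<in> B" "\<theta> \<in> V" "V \<subseteq> U" using topological_basisE[OF B(2) U] by metis
      have "U \<inter> space \<sigma> \<in> sets \<sigma>" unfolding sets space using U(1) by (auto simp: sets_restrict_space)
      then have "emeasure \<sigma> (V \<inter> space \<sigma>) = 0"
        using emeasure_mono[of "V \<inter> space \<sigma>" "U \<inter> space \<sigma>" \<sigma>] V(3) 0 by auto
      then show False using elim(1) V by (auto simp: N_def)
    qed
    then show ?case using elim(2) by (simp add: measure_support_def)
  qed
qed

definition bounded_measurable :: "'a measure \<Rightarrow> ('a \<Rightarrow> 'b::{real_normed_algebra, second_countable_topology}) \<Rightarrow> bool" where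
  "bounded_measurable M f \<longleftrightarrow> f \<in> borel_measurable M \<and> (\<exists>B. \<forall>x\<in>space M. norm (f x) \<le> B)"

lemma bounded_measurable_diff:
  assumes "bounded_measurable M f" "bounded_measurable M g"
  shows "bounded_measurable M (\<lambda>x. f x - g x)"
proof -
  obtain B C where "\<forall>x\<in>space M. norm (f x) \<le> B" "\<forall>x\<in>space M. norm (g x) \<le> C"
    using assms unfolding bounded_measurable_def by blast
  then have "\<forall>x\<in>space M. norm (f x - g x) \<le> B + C" by (meson add_mono norm_triangle_le_diff)
  then show ?thesis using assms unfolding bounded_measurable_def by (auto intro: borel_measurable_diff)
qed

lemma integrable_bounded_measurable_mult:
  fixes f g :: "'a \<Rightarrow> 'b::{real_normed_field, second_countable_topology, banach}"
  assumes "finite_measure M" "bounded_measurable M f" "bounded_measurable M g"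
  shows "integrable M (\<lambda>x. f x * g x)"
proof -
  obtain B C where B: "\<forall>x\<in>space M. norm (f x) \<le> B" and C: "\<forall>x\<in>space M. norm (g x) \<le> C"
    using assms unfolding bounded_measurable_def by blast
  have [measurable]: "f \<in> borel_measurable M" "g \<in> borel_measurable M"
    using assms by (auto simp: bounded_measurable_def)
  have "norm (f x * g x) \<le> \<bar>B\<bar> * \<bar>C\<bar>" if "x \<in> space M" for x
    unfolding norm_mult using B C that by (intro mult_mono) (auto intro: order_trans[OF _ abs_ge_self])
  then show ?thesis
    by (intro finite_measure.integrable_const_bound[OF assms(1), of _ "\<bar>B\<bar> * \<bar>C\<bar>"] AE_I2) auto
qed

text \<open>Pairs of a random variable \<open>u\<close> in the span of the translates of \<open>1\<^sub>D\<close> and the trigonometric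
  polynomial \<open>p\<close> that represents it in \<open>L\<^sup>2(\<sigma>)\<close>.\<close>

inductive spectral_pair ::
  "(('d::finite lattice \<Rightarrow> nat) \<Rightarrow> real) \<Rightarrow> (('d lattice \<Rightarrow> complex) \<Rightarrow> complex) \<Rightarrow> bool" where
  base: "spectral_pair (\<lambda>\<omega>. real (\<omega> g)) (\<lambda>\<theta>. \<theta> g)"
| diff: "spectral_pair u p \<Longrightarrow> spectral_pair v q \<Longrightarrow> spectral_pair (\<lambda>\<omega>. u \<omega> - v \<omega>) (\<lambda>\<theta>. p \<theta> - q \<theta>)"

lemma spectral_pair_fdiffs:
  fixes hs :: "'d::finite lattice list"
  shows "\<exists>p. spectral_pair (\<lambda>\<omega>. fdiffs hs (\<lambda>x. real (\<omega> x)) x) p \<and>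
    (\<forall>\<theta>\<in>dual_group. p \<theta> = \<theta> x * (\<Prod>h\<leftarrow>hs. \<theta> h - 1))"
proof (induction hs arbitrary: x)
  case Nil
  show ?case using base[of x] by (intro exI[of _ "\<lambda>\<theta>. \<theta> x"]) simp
next
  case (Cons h hs)
  obtain p where p: "spectral_pair (\<lambda>\<omega>. fdiffs hs (\<lambda>x. real (\<omega> x)) (x + h)) p"
    "\<And>\<theta>. \<theta> \<in> dual_group \<Longrightarrow> p \<theta> = \<theta> (x + h) * (\<Prod>h\<leftarrow>hs. \<theta> h - 1)" using Cons[of "x + h"] by blast
  obtain q where q: "spectral_pair (\<lambda>\<omega>. fdiffs hs (\<lambda>x. real (\<omega> x)) x) q"
    "\<And>\<theta>. \<theta> \<in> dual_group \<Longrightarrow> q \<theta> = \<theta> x * (\<Prod>h\<leftarrow>hs. \<theta> h - 1)" using Cons[of x] by blast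
  show ?case
  proof (intro exI[of _ "\<lambda>\<theta>. p \<theta> - q \<theta>"] conjI ballI)
    show "spectral_pair (\<lambda>\<omega>. fdiffs (h # hs) (\<lambda>x. real (\<omega> x)) x) (\<lambda>\<theta>. p \<theta> - q \<theta>)"
      using diff[OF p(1) q(1)] by (simp add: fdiff_def[of _ "fdiffs _ _"])
    fix \<theta> :: "'d lattice \<Rightarrow> complex" assume \<theta>: "\<theta> \<in> dual_group"
    then have "\<theta> (x + h) = \<theta> x * \<theta> h" by (simp add: dual_group_def)
    then show "p \<theta> - q \<theta> = \<theta> x * (\<Prod>h\<leftarrow>h # hs. \<theta> h - 1)"
      using p(2)[OF \<theta>] q(2)[OF \<theta>] by (simp add: algebra_simps)
  qed
qed

locale tiling_system =
  fixes F :: "'d::finite lattice set" and \<mu> :: "('d lattice \<Rightarrow> nat) measure"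
    and \<sigma> :: "('d lattice \<Rightarrow> complex) measure"
  assumes borel_prob: "borel_prob_on_tilings F \<mu>" and invariant: "shift_invariant \<mu>"
    and spectral: "is_spectral_measure \<mu> (indicator {a \<in> tiling_space F. a 0 = 1}) \<sigma>"
begin

lemma sets_\<mu>: "sets \<mu> = sets (restrict_space borel (tiling_space F))"
  using borel_prob by (simp add: borel_prob_on_tilings_def)

lemma space_\<mu>: "space \<mu> = tiling_space F"
  using sets_eq_imp_space_eq[OF sets_\<mu>] by (simp add: space_restrict_space)

lemma sets_\<sigma>: "sets \<sigma> = sets (restrict_space borel dual_group)"
  using spectral by (simp add: is_spectral_measure_def)

lemma space_\<sigma>: "space \<sigma> = dual_group"
  using sets_eq_imp_space_eq[OF sets_\<sigma>] by (simp add: space_restrict_space)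

lemma finite_\<sigma>: "finite_measure \<sigma>"
  using spectral by (simp add: is_spectral_measure_def)

lemma finite_\<mu>: "finite_measure \<mu>"
  using borel_prob prob_space.finite_measure by (auto simp: borel_prob_on_tilings_def)

lemma tiling_01: "\<omega> \<in> tiling_space F \<Longrightarrow> \<omega> x = 0 \<or> \<omega> x = 1"
  unfolding tiling_space_def by blast

lemma shift_tiling: "\<omega> \<in> tiling_space F \<Longrightarrow> shift g \<omega> \<in> tiling_space F"
proof -
  assume \<omega>: "\<omega> \<in> tiling_space F"
  have "(\<Sum>f\<in>F. \<omega> (x - f + g)) = 1" for x
  proof -
    have "(\<Sum>f\<in>F. \<omega> ((x + g) - f)) = 1" using \<omega> by (simp add: tiling_space_def)
    then show ?thesis by (simp add: algebra_simps)
  qed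
  then show ?thesis using \<omega> by (simp add: tiling_space_def shift_def image_subset_iff)
qed

lemma coordinate_measurable: "(\<lambda>\<omega>. real (\<omega> g)) \<in> borel_measurable \<mu>"
proof -
  have "continuous_on UNIV (\<lambda>\<omega> :: 'd lattice \<Rightarrow> nat. \<omega> g)" by simp
  then have "continuous_on UNIV (\<lambda>\<omega> :: 'd lattice \<Rightarrow> nat. real (\<omega> g))"
    by (rule continuous_on_compose2[rotated]) (auto intro: continuous_on_discrete)
  then show ?thesis
    unfolding measurable_cong_sets[OF sets_\<mu> refl]
    by (intro measurable_restrict_space1 borel_measurable_continuous_onI)
qed

lemma shift_measurable: "shift g \<in> measurable \<mu> \<mu>"
  unfolding measurable_cong_sets[OF sets_\<mu> sets_\<mu>]
proof (rule measurable_restrict_space3)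
  have "continuous_on UNIV (shift g :: ('d lattice \<Rightarrow> nat) \<Rightarrow> _)"
    unfolding shift_def by (intro continuous_on_coordinatewise_then_product) simp
  then show "shift g \<in> borel_measurable (borel :: ('d lattice \<Rightarrow> nat) measure)" by (rule borel_measurable_continuous_onI)
qed (use shift_tiling in blast)

sublocale preserving_action \<mu> shift
proof -
  interpret prob_space \<mu> using borel_prob by (simp add: borel_prob_on_tilings_def)
  show "preserving_action \<mu> shift"
  proof
    show "shift g \<in> measurable \<mu> \<mu>" for g by (rule shift_measurable)
    show "shift (g + h) \<omega> = shift g (shift h \<omega>)" for g h \<omega> by (simp add: shift_def fun_eq_iff add.assoc)
    show "shift 0 \<omega> = \<omega>" for \<omega> by (simp add: shift_def)
    show "distr \<mu> \<mu> (shift g) = \<mu>" for g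
      using invariant by (intro measure_eqI) (auto simp: emeasure_distr shift_measurable shift_invariant_def)
  qed
qed

lemma coordinate_bounded_measurable: "bounded_measurable \<mu> (\<lambda>\<omega>. real (\<omega> g))"
  unfolding bounded_measurable_def space_\<mu>
  using coordinate_measurable tiling_01 by (metis (mono_tags, lifting) norm_of_nat of_nat_0 of_nat_1 order_refl zero_le_one)

lemma character_bounded_measurable: "bounded_measurable \<sigma> (\<lambda>\<theta>. \<theta> g)"
proof -
  have "(\<lambda>\<theta>. \<theta> g) \<in> borel_measurable \<sigma>"
    unfolding measurable_cong_sets[OF sets_\<sigma> refl]
    by (intro measurable_restrict_space1 borel_measurable_continuous_onI) simp
  then show ?thesis unfolding bounded_measurable_def space_\<sigma> by (auto simp: dual_group_def)
qed

text \<open>Invariance moves the pair \<open>g\<close>, \<open>h\<close> to 0 and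
  \<open>h - g\<close>. As \<open>koopman\<close> composes with the inverse shift, this is the inner
  product for the group element \<open>g - h\<close>; and \<open>\<theta> (g - h)\<close> is
  \<open>\<theta> g * cnj (\<theta> h)\<close> for characters.\<close>

lemma correlation: "complex_of_real (\<integral>\<omega>. real (\<omega> g) * real (\<omega> h) \<partial>\<mu>) = (\<integral>\<theta>. \<theta> g * cnj (\<theta> h) \<partial>\<sigma>)"
proof -
  let ?v = "indicator {a \<in> tiling_space F. a 0 = 1} :: _ \<Rightarrow> complex"
  have "(\<integral>\<omega>. real (\<omega> g) * real (\<omega> h) \<partial>\<mu>) = (\<integral>\<omega>. (\<lambda>\<omega>. real (\<omega> 0) * real (\<omega> (h - g))) (shift g \<omega>) \<partial>\<mu>)"
    by (simp add: shift_def)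
  also have "\<dots> = (\<integral>\<omega>. real (\<omega> 0) * real (\<omega> (h - g)) \<partial>\<mu>)"
    by (rule integral_T) (intro borel_measurable_times coordinate_measurable)
  finally have "complex_of_real (\<integral>\<omega>. real (\<omega> g) * real (\<omega> h) \<partial>\<mu>)
      = (\<integral>\<omega>. complex_of_real (real (\<omega> 0) * real (\<omega> (h - g))) \<partial>\<mu>)"
    by (simp only: integral_complex_of_real)
  also have "\<dots> = l2_inner \<mu> ?v (koopman (g - h) ?v)"
    unfolding l2_inner_def
  proof (rule Bochner_Integration.integral_cong[OF refl])
    fix \<omega> assume "\<omega> \<in> space \<mu>"
    then have \<omega>: "\<omega> \<in> tiling_space F" by (simp add: space_\<mu>)
    have "koopman (g - h) ?v \<omega> = indicator {a \<in> tiling_space F. a 0 = 1} (shift (h - g) \<omega>)"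
      by (simp add: koopman_def)
    also have "\<dots> = of_nat (\<omega> (h - g))"
      using shift_tiling[OF \<omega>, of "h - g"] tiling_01[OF \<omega>, of "h - g"] by (auto simp: indicator_def shift_def)
    finally show "complex_of_real (real (\<omega> 0) * real (\<omega> (h - g))) = cnj (?v \<omega>) * koopman (g - h) ?v \<omega>"
      using \<omega> tiling_01[OF \<omega>, of 0] by (auto simp: indicator_def)
  qed
  also have "\<dots> = (\<integral>\<theta>. \<theta> (g - h) \<partial>\<sigma>)" using spectral by (simp add: is_spectral_measure_def)
  also have "\<dots> = (\<integral>\<theta>. \<theta> g * cnj (\<theta> h) \<partial>\<sigma>)"
  proof (rule Bochner_Integration.integral_cong[OF refl])
    fix \<theta> assume "\<theta> \<in> space \<sigma>"
    then have \<theta>: "\<theta> \<in> dual_group" by (simp add: space_\<sigma>)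
    have "\<theta> ((g - h) + h) = \<theta> (g - h) * \<theta> h" "cmod (\<theta> h) = 1"
      using \<theta> unfolding dual_group_def by blast+
    then show "\<theta> (g - h) = \<theta> g * cnj (\<theta> h)" by (simp add: mult.assoc complex_norm_square[symmetric])
  qed
  finally show ?thesis .
qed

lemma spectral_pair_bounded:
  assumes "spectral_pair u p"
  shows "bounded_measurable \<mu> u" "bounded_measurable \<sigma> p"
  using assms
  by (induction rule: spectral_pair.induct)
    (auto intro: coordinate_bounded_measurable character_bounded_measurable bounded_measurable_diff)

lemma bounded_measurable_cnj: "bounded_measurable M p \<Longrightarrow> bounded_measurable M (\<lambda>x. cnj (p x))"
  unfolding bounded_measurable_def by (auto intro!: borel_measurable_continuous_on[where f = cnj] continuous_intros)

text \<open>Sesquilinear extension of \<open>correlation\<close>: the pairs describe an isometry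
  into the L2 space of \<open>\<sigma>\<close>.\<close>

lemma spectral_pair_inner:
  assumes "spectral_pair u p" "spectral_pair v q"
  shows "complex_of_real (\<integral>\<omega>. u \<omega> * v \<omega> \<partial>\<mu>) = (\<integral>\<theta>. p \<theta> * cnj (q \<theta>) \<partial>\<sigma>)"
  using assms
proof (induction rule: spectral_pair.induct)
  case (base g)
  from base.prems show ?case
  proof (induction rule: spectral_pair.induct)
    case (base h)
    show ?case by (rule correlation)
  next
    case (diff u p v q)
    note int = integrable_bounded_measurable_mult[OF finite_\<mu> coordinate_bounded_measurable[of g]]
      integrable_bounded_measurable_mult[OF finite_\<sigma> character_bounded_measurable[of g] bounded_measurable_cnj]
    show ?case
      using diff.IH int(1)[OF spectral_pair_bounded(1)[OF diff.hyps(1)]] int(1)[OF spectral_pair_bounded(1)[OF diff.hyps(2)]]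
        int(2)[OF spectral_pair_bounded(2)[OF diff.hyps(1)]] int(2)[OF spectral_pair_bounded(2)[OF diff.hyps(2)]]
      by (simp add: right_diff_distrib)
  qed
next
  case (diff u1 p1 u2 p2)
  note int = integrable_bounded_measurable_mult[OF finite_\<mu> _ spectral_pair_bounded(1)[OF diff.prems]]
    integrable_bounded_measurable_mult[OF finite_\<sigma> _ bounded_measurable_cnj[OF spectral_pair_bounded(2)[OF diff.prems]]]
  show ?case
    using diff.IH[OF diff.prems]
      int(1)[OF spectral_pair_bounded(1)[OF diff.hyps(1)]] int(1)[OF spectral_pair_bounded(1)[OF diff.hyps(2)]]
      int(2)[OF spectral_pair_bounded(2)[OF diff.hyps(1)]] int(2)[OF spectral_pair_bounded(2)[OF diff.hyps(2)]]
    by (simp add: left_diff_distrib)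
qed

text \<open>The mixed difference is represented by a character times the product of the
  \<open>\<theta> h - 1\<close>, which vanishes on the support. By the isometry its square has
  integral 0.\<close>

lemma fdiffs_zero_of_support:
  assumes kill: "\<And>\<theta>. \<theta> \<in> measure_support \<sigma> \<Longrightarrow> \<exists>h\<in>set hs. \<theta> h = 1"
  shows "AE \<omega> in \<mu>. fdiffs hs (\<lambda>x. real (\<omega> x)) x = 0"
proof -
  define u where "u \<omega> = fdiffs hs (\<lambda>x. real (\<omega> x)) x" for \<omega> :: "'d lattice \<Rightarrow> nat"
  obtain p where p: "spectral_pair u p" "\<And>\<theta>. \<theta> \<in> dual_group \<Longrightarrow> p \<theta> = \<theta> x * (\<Prod>h\<leftarrow>hs. \<theta> h - 1)"
    using spectral_pair_fdiffs[of hs x] unfolding u_def by blast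
  have "AE \<theta> in \<sigma>. p \<theta> * cnj (p \<theta>) = 0"
    using AE_measure_support[OF sets_\<sigma>] AE_space
  proof eventually_elim
    case (elim \<theta>)
    then obtain h where "h \<in> set hs" "\<theta> h = 1" using kill by blast
    then have "(\<Prod>h\<leftarrow>hs. \<theta> h - 1) = 0" by (auto simp: prod_list_zero_iff)
    then show ?case using p(2)[of \<theta>] elim(2) by (simp add: space_\<sigma>)
  qed
  then have "(\<integral>\<theta>. p \<theta> * cnj (p \<theta>) \<partial>\<sigma>) = 0" by (rule integral_eq_zero_AE)
  then have "(\<integral>\<omega>. u \<omega> * u \<omega> \<partial>\<mu>) = 0" using spectral_pair_inner[OF p(1) p(1)] by simp
  moreover have "integrable \<mu> (\<lambda>\<omega>. u \<omega> * u \<omega>)"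
    by (intro integrable_bounded_measurable_mult finite_\<mu> spectral_pair_bounded(1)[OF p(1)])
  ultimately have "AE \<omega> in \<mu>. u \<omega> * u \<omega> = 0" by (subst (asm) integral_nonneg_eq_0_iff_AE) auto
  then show ?thesis by (simp add: u_def)
qed

end

section \<open>The periodic tiling\<close>

text \<open>One homomorphism is kept for each kernel. If \<open>ker l\<close> lies in
  \<open>ker k\<close>, then \<open>l e *s x - l x *s e\<close> lies in both, so \<open>k\<close>
  and \<open>l\<close> are proportional and have the same kernel.\<close>

lemma ex_directions:
  fixes \<K> :: "('d::finite lattice \<Rightarrow> int) set"
  assumes fin: "finite \<K>" and hom: "\<And>k. k \<in> \<K> \<Longrightarrow> lattice_hom k \<and> (\<exists>x. k x \<noteq> 0)"
  obtains K where "directions K" "\<And>k. k \<in> \<K> \<Longrightarrow> \<exists>k'\<in>K. \<forall>x. k' x = 0 \<longleftrightarrow> k x = 0"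
proof -
  define ker where "ker k = {x. k x = 0}" for k :: "'d lattice \<Rightarrow> int"
  define pick where "pick S = (SOME k. k \<in> \<K> \<and> ker k = S)" for S
  have pick: "pick (ker k) \<in> \<K>" "ker (pick (ker k)) = ker k" if "k \<in> \<K>" for k
    unfolding pick_def using someI[of "\<lambda>k'. k' \<in> \<K> \<and> ker k' = ker k" k] that by auto
  define K where "K = (\<lambda>k. pick (ker k)) ` \<K>"
  have K: "K \<subseteq> \<K>" using pick by (auto simp: K_def)
  have inj: "k = l" if "k \<in> K" "l \<in> K" "ker k = ker l" for k l
    using that pick by (auto simp: K_def)
  have "\<exists>u. l u = 0 \<and> k u \<noteq> 0" if k: "k \<in> K" and l: "l \<in> K" and "k \<noteq> l" for k l
  proof (rule ccontr)
    assume "\<not> ?thesis"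
    then have sub: "k u = 0" if "l u = 0" for u using that by blast
    have hk: "lattice_hom k" and hl: "lattice_hom l" using hom K k l by auto
    obtain e where e: "l e \<noteq> 0" using hom K l by blast
    have ratio: "l e * k x = l x * k e" for x
    proof -
      have "l (l e *s x - l x *s e) = 0" by (simp add: lattice_hom_simps[OF hl])
      from sub[OF this] show ?thesis by (simp add: lattice_hom_simps[OF hk])
    qed
    obtain e' where "k e' \<noteq> 0" using hom K k by blast
    then have "k e \<noteq> 0" using ratio[of e'] e by auto
    have "k x = 0 \<longleftrightarrow> l x = 0" for x
      using ratio[of x] e \<open>k e \<noteq> 0\<close> by (metis mult_eq_0_iff)
    then have "ker k = ker l" by (simp add: ker_def)
    then show False using inj[OF k l] \<open>k \<noteq> l\<close> by blast
  qed
  then have "directions K"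
    unfolding directions_def using K hom fin by (auto simp: K_def)
  moreover have "\<exists>k'\<in>K. \<forall>x. k' x = 0 \<longleftrightarrow> k x = 0" if "k \<in> \<K>" for k
    using pick(2)[OF that] that by (intro bexI[of _ "pick (ker k)"]) (auto simp: K_def ker_def)
  ultimately show thesis using that by blast
qed

definition kernel_multiples :: "int \<Rightarrow> ('d::finite lattice \<Rightarrow> int) \<Rightarrow> 'd lattice set" where
  "kernel_multiples N k = {N *s x | x. k x = 0}"

lemma add_subgroup_kernel_multiples:
  assumes "lattice_hom k"
  shows "add_subgroup (kernel_multiples N k)"
  unfolding add_subgroup_def
proof (intro conjI ballI)
  show "0 \<in> kernel_multiples N k"
    unfolding kernel_multiples_def by (intro CollectI exI[of _ 0]) (simp add: lattice_hom_0[OF assms])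
  fix a assume "a \<in> kernel_multiples N k"
  then obtain x where x: "a = N *s x" "k x = 0" by (auto simp: kernel_multiples_def)
  have "- a = N *s (0 - x)" by (simp add: x vec_eq_iff)
  then show "- a \<in> kernel_multiples N k"
    unfolding kernel_multiples_def using x(2) lattice_hom_diff[OF assms, of 0 x] lattice_hom_0[OF assms] by force
  fix b assume "b \<in> kernel_multiples N k"
  then obtain y where y: "b = N *s y" "k y = 0" by (auto simp: kernel_multiples_def)
  have "a + b = N *s (x + y)" by (simp add: x y)
  then show "a + b \<in> kernel_multiples N k"
    unfolding kernel_multiples_def using x(2) y(2) lattice_hom_add[OF assms, of x y] by force
qed

text \<open>Two different kernels span a subgroup of finite index: if \<open>l v = 0\<close> and
  \<open>k v \<noteq> 0\<close>, then \<open>k v *s x - k x *s v\<close> lies in the kernel of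
  \<open>k\<close>, so \<open>k v *s x\<close> splits. \<open>c\<close> is a common multiple of
  these factors for all pairs.\<close>

lemma kernel_multiples_sum:
  assumes K: "directions K"
  obtains c where "c > 0" "\<And>k l x. k \<in> K \<Longrightarrow> l \<in> K \<Longrightarrow> k \<noteq> l \<Longrightarrow>
    \<exists>a\<in>kernel_multiples N k. \<exists>b\<in>kernel_multiples N l. (N * c) *s x = a + b"
proof -
  have fin: "finite K" and hom: "\<And>k. k \<in> K \<Longrightarrow> lattice_hom k" using K by (auto simp: directions_def)
  have "\<forall>k\<in>K. \<forall>l\<in>K. k \<noteq> l \<longrightarrow> (\<exists>u. l u = 0 \<and> k u \<noteq> 0)" using K by (simp add: directions_def)
  then obtain u where u: "\<And>k l. k \<in> K \<Longrightarrow> l \<in> K \<Longrightarrow> k \<noteq> l \<Longrightarrow> l (u k l) = 0 \<and> k (u k l) \<noteq> 0" by metis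
  define d where "d p = (case p of (k, l) \<Rightarrow> if k = l then 1 else \<bar>k (u k l)\<bar>)" for p
  define c where "c = (\<Prod>p\<in>K \<times> K. d p)"
  show thesis
  proof (rule that[of c])
    show "c > 0" unfolding c_def using u by (intro prod_pos) (auto simp: d_def)
    fix k l x assume kl: "k \<in> K" "l \<in> K" "k \<noteq> l"
    define v where "v = u k l"
    have v: "l v = 0" "k v \<noteq> 0" using u[OF kl] by (simp_all add: v_def)
    have "\<bar>k v\<bar> dvd c"
      unfolding c_def using dvd_prodI[of "K \<times> K" "(k, l)" d] fin kl by (simp add: d_def v_def)
    then have "k v dvd c" by simp
    then obtain q where q: "c = k v * q" by (elim dvdE)
    define y where "y = k v *s (q *s x) - k (q *s x) *s v"
    have "k y = 0" by (simp only: y_def lattice_hom_simps[OF hom[OF kl(1)]]) simp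
    then have "N *s y \<in> kernel_multiples N k" by (auto simp: kernel_multiples_def)
    moreover have "l (k (q *s x) *s v) = 0" using v(1) by (simp add: lattice_hom_scale[OF hom[OF kl(2)]])
    then have "N *s (k (q *s x) *s v) \<in> kernel_multiples N l" unfolding kernel_multiples_def by blast
    moreover have "(N * c) *s x = N *s y + N *s (k (q *s x) *s v)"
      by (simp add: y_def q vec_eq_iff algebra_simps)
    ultimately show "\<exists>a\<in>kernel_multiples N k. \<exists>b\<in>kernel_multiples N l. (N * c) *s x = a + b" by blast
  qed
qed

lemma sorted_wrt_of_distinct:
  assumes "distinct xs" "\<And>x y. x \<in> set xs \<Longrightarrow> y \<in> set xs \<Longrightarrow> x \<noteq> y \<Longrightarrow> P x y"
  shows "sorted_wrt P xs"
  using assms by (induction xs) auto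

lemma rational_affine_circles_directions:
  fixes \<C> :: "('d::finite lattice \<Rightarrow> complex) set set"
  assumes fin: "finite \<C>" and circles: "\<forall>C\<in>\<C>. rational_affine_circle C"
  obtains K N where "directions K" "K \<noteq> {}" "N > (0::int)"
    "\<And>C. C \<in> \<C> \<Longrightarrow> \<exists>k\<in>K. \<forall>\<theta>\<in>C. \<forall>h\<in>kernel_multiples N k. \<theta> h = 1"
proof -
  define level where "level C k n \<longleftrightarrow> lattice_hom k \<and> (\<exists>x. k x \<noteq> 0) \<and> n > (0::nat) \<and>
    (\<forall>\<theta>\<in>C. \<forall>x. k x = 0 \<longrightarrow> \<theta> (int n *s x) = 1)" for C :: "('d lattice \<Rightarrow> complex) set" and k n
  have "\<exists>k n. level C k n" if "C \<in> \<C>" for C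
  proof -
    have "rational_affine_circle C" using circles that by blast
    from rational_affine_circle_level[OF this] show ?thesis unfolding level_def by metis
  qed
  then obtain k n where "\<And>C. C \<in> \<C> \<Longrightarrow> level C (k C) (n C)" by metis
  then have kn: "\<And>C. C \<in> \<C> \<Longrightarrow> lattice_hom (k C) \<and> (\<exists>x. k C x \<noteq> 0)" "\<And>C. C \<in> \<C> \<Longrightarrow> n C > (0::nat)"
    "\<And>C \<theta> x. C \<in> \<C> \<Longrightarrow> \<theta> \<in> C \<Longrightarrow> k C x = 0 \<Longrightarrow> \<theta> (int (n C) *s x) = 1"
    unfolding level_def by blast+
  \<comment> \<open>A coordinate, at an arbitrary index, joins the level functions so that
    \<open>K\<close> is nonempty even without circles.\<close>
  define e where "e x = x $ undefined" for x :: "'d lattice"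
  have e: "lattice_hom e" "e 1 \<noteq> 0" by (simp_all add: lattice_hom_def e_def)
  have hom: "lattice_hom l \<and> (\<exists>x. l x \<noteq> 0)" if "l \<in> insert e (k ` \<C>)" for l
    using that kn(1) e by blast
  obtain K where K: "directions K" "\<And>l. l \<in> insert e (k ` \<C>) \<Longrightarrow> \<exists>k'\<in>K. \<forall>x. k' x = 0 \<longleftrightarrow> l x = 0"
    using ex_directions[of "insert e (k ` \<C>)", OF _ hom] fin by blast
  define N where "N = (\<Prod>C\<in>\<C>. int (n C))"
  show thesis
  proof (rule that[OF K(1)])
    show "K \<noteq> {}" using K(2)[of e] by blast
    show "N > 0" unfolding N_def using kn(2) by (intro prod_pos) auto
    fix C assume C: "C \<in> \<C>"
    obtain k' where k': "k' \<in> K" "\<And>x. k' x = 0 \<longleftrightarrow> k C x = 0" using K(2)[of "k C"] C by blast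
    have "int (n C) dvd N" unfolding N_def using fin C by (intro dvd_prodI)
    then obtain m where m: "N = int (n C) * m" by (elim dvdE)
    have "\<theta> (N *s x) = 1" if "\<theta> \<in> C" "k' x = 0" for \<theta> x
    proof -
      have "k C (m *s x) = 0" using that(2) k'(2) kn(1)[OF C] by (simp add: lattice_hom_scale[of "k C"])
      from kn(3)[OF C that(1) this] show ?thesis by (simp add: m)
    qed
    then show "\<exists>k\<in>K. \<forall>\<theta>\<in>C. \<forall>h\<in>kernel_multiples N k. \<theta> h = 1"
      using k'(1) by (auto simp: kernel_multiples_def)
  qed
qed

context tiling_system
begin

lemma periodic_tiling_of_directions:
  assumes F: "finite F" "F \<noteq> {}" and K: "directions K" "K \<noteq> {}" and N: "N > 0"
    and kill: "\<And>\<theta>. \<theta> \<in> measure_support \<sigma> \<Longrightarrow> \<exists>k\<in>K. \<forall>h\<in>kernel_multiples N k. \<theta> h = 1"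
  shows "\<exists>A. tiling_complement F A \<and> fully_periodic A"
proof -
  have fin: "finite K" and hom: "\<And>k. k \<in> K \<Longrightarrow> lattice_hom k" using K by (auto simp: directions_def)
  define \<Lambda> where "\<Lambda> k = kernel_multiples N k" for k :: "'d lattice \<Rightarrow> int"
  obtain c where c: "c > 0" "\<And>k l x. k \<in> K \<Longrightarrow> l \<in> K \<Longrightarrow> k \<noteq> l \<Longrightarrow> \<exists>a\<in>\<Lambda> k. \<exists>b\<in>\<Lambda> l. (N * c) *s x = a + b"
    using kernel_multiples_sum[OF K(1), of N] unfolding \<Lambda>_def by metis
  define \<Gamma> where "\<Gamma> = range (\<lambda>x :: 'd lattice. (N * c) *s x)"
  obtain ks where ks: "set ks = K" "distinct ks" using finite_distinct_list[OF fin] by blast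
  define f where "f \<omega> = real (\<omega> 0)" for \<omega> :: "'d lattice \<Rightarrow> nat"
  have f_shift: "f (shift x \<omega>) = real (\<omega> x)" for x \<omega> by (simp add: f_def shift_def)
  have f01: "0 \<le> f \<omega> \<and> f \<omega> \<le> 1" if "\<omega> \<in> space \<mu>" for \<omega>
    using tiling_01[of \<omega> 0] that by (auto simp: f_def space_\<mu>)
  have f_int: "integrable \<mu> f"
  proof (rule integrable_const_bound[of _ 1])
    show "AE \<omega> in \<mu>. norm (f \<omega>) \<le> 1" using f01 by (intro AE_I2) auto
    show "f \<in> borel_measurable \<mu>" unfolding f_def by (rule coordinate_measurable)
  qed
  have "\<exists>\<Psi>. integrable \<mu> \<Psi> \<and> (AE \<omega> in \<mu>. f \<omega> = (\<Sum>L\<leftarrow>map \<Lambda> ks. E L f \<omega>) + \<Psi> \<omega>) \<and>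
    (\<forall>\<gamma>\<in>\<Gamma>. AE \<omega> in \<mu>. \<Psi> (shift \<gamma> \<omega>) = \<Psi> \<omega>)"
  proof (rule invariant_decomposition[OF _ _ f_int])
    show "add_subgroup L" if "L \<in> set (map \<Lambda> ks)" for L
      using that hom ks(1) by (auto simp: \<Lambda>_def intro: add_subgroup_kernel_multiples)
    have "sorted_wrt (\<lambda>k l. \<forall>\<gamma>\<in>\<Gamma>. \<exists>a\<in>\<Lambda> k. \<exists>b\<in>\<Lambda> l. \<gamma> = a + b) ks"
      using c(2) ks by (intro sorted_wrt_of_distinct) (auto simp: \<Gamma>_def)
    then show "sorted_wrt (\<lambda>L L'. \<forall>\<gamma>\<in>\<Gamma>. \<exists>a\<in>L. \<exists>b\<in>L'. \<gamma> = a + b) (map \<Lambda> ks)"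
      by (simp add: sorted_wrt_map)
    fix hs assume hs: "list_all2 (\<in>) hs (map \<Lambda> ks)"
    \<comment> \<open>The list \<open>hs\<close> has one step from each kernel, so also one from the
      kernel whose multiples \<open>\<theta>\<close> annihilates.\<close>
    have "\<exists>h\<in>set hs. \<theta> h = 1" if \<theta>: "\<theta> \<in> measure_support \<sigma>" for \<theta>
    proof -
      obtain k where k: "k \<in> K" "\<forall>h\<in>\<Lambda> k. \<theta> h = 1" using kill[OF \<theta>] unfolding \<Lambda>_def by blast
      then obtain i where "i < length ks" "ks ! i = k" using ks(1) by (metis in_set_conv_nth)
      then have "hs ! i \<in> \<Lambda> k" "i < length hs" using hs by (auto simp: list_all2_conv_all_nth)
      then show ?thesis using k(2) nth_mem by blast
    qed
    then show "AE \<omega> in \<mu>. fdiffs hs (\<lambda>x. f (shift x \<omega>)) 0 = 0"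
      unfolding f_shift by (rule fdiffs_zero_of_support)
  qed
  then obtain \<Psi> where \<Psi>: "AE \<omega> in \<mu>. f \<omega> = (\<Sum>L\<leftarrow>map \<Lambda> ks. E L f \<omega>) + \<Psi> \<omega>"
    "\<And>\<gamma>. \<gamma> \<in> \<Gamma> \<Longrightarrow> AE \<omega> in \<mu>. \<Psi> (shift \<gamma> \<omega>) = \<Psi> \<omega>" by blast
  have sum_ks: "(\<Sum>L\<leftarrow>map \<Lambda> ks. E L f \<omega>) = (\<Sum>k\<in>K. E (\<Lambda> k) f \<omega>)" for \<omega>
    using ks by (simp add: o_def sum_list_distinct_conv_sum_set)
  \<comment> \<open>\<open>good\<close> collects the almost sure properties at the origin. The
    lattice is countable, so almost every tiling has them after all translations at once; one such
    tiling turns functions on the tiling space into functions on the lattice.\<close>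
  define good where "good \<omega> \<longleftrightarrow> f \<omega> = \<Psi> \<omega> + (\<Sum>k\<in>K. E (\<Lambda> k) f \<omega>) \<and> (\<forall>\<gamma>\<in>\<Gamma>. \<Psi> (shift \<gamma> \<omega>) = \<Psi> \<omega>) \<and>
    (\<forall>k\<in>K. (0 \<le> E (\<Lambda> k) f \<omega> \<and> E (\<Lambda> k) f \<omega> \<le> 1) \<and> (E (\<Lambda> k) f \<omega> = 0 \<longrightarrow> f \<omega> = 0) \<and>
      (E (\<Lambda> k) f \<omega> = 1 \<longrightarrow> f \<omega> = 1))" for \<omega>
  have "AE \<omega> in \<mu>. good \<omega>"
    unfolding good_def
  proof (intro AE_conjI)
    show "AE \<omega> in \<mu>. f \<omega> = \<Psi> \<omega> + (\<Sum>k\<in>K. E (\<Lambda> k) f \<omega>)"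
      using \<Psi>(1) by eventually_elim (simp add: sum_ks[symmetric])
    show "AE \<omega> in \<mu>. \<forall>\<gamma>\<in>\<Gamma>. \<Psi> (shift \<gamma> \<omega>) = \<Psi> \<omega>"
      by (intro AE_ball_countable' \<Psi>(2)) auto
    show "AE \<omega> in \<mu>. \<forall>k\<in>K. (0 \<le> E (\<Lambda> k) f \<omega> \<and> E (\<Lambda> k) f \<omega> \<le> 1) \<and> (E (\<Lambda> k) f \<omega> = 0 \<longrightarrow> f \<omega> = 0) \<and>
      (E (\<Lambda> k) f \<omega> = 1 \<longrightarrow> f \<omega> = 1)"
      using f_int f01 fin
      by (intro AE_ball_countable' AE_conjI[OF E_bounds] AE_conjI[OF E_eq_0 E_eq_1]) (auto simp: countable_finite)
  qed
  then have "AE \<omega> in \<mu>. good (shift x \<omega>)" for x by (rule AE_T)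
  then have "AE \<omega> in \<mu>. \<forall>x. good (shift x \<omega>)" by (subst AE_all_countable) blast
  then have ae: "AE \<omega> in \<mu>. \<omega> \<in> space \<mu> \<and> (\<forall>x. good (shift x \<omega>))" using AE_space by eventually_elim simp
  have "\<exists>\<omega>. \<omega> \<in> space \<mu> \<and> (\<forall>x. good (shift x \<omega>))"
  proof (rule ccontr)
    assume "\<not> ?thesis"
    then have none: "\<And>\<omega>. \<omega> \<in> space \<mu> \<and> (\<forall>x. good (shift x \<omega>)) \<Longrightarrow> False" by blast
    have "AE \<omega> in \<mu>. False" by (rule eventually_mono[OF ae none])
    then show False by simp
  qed
  then obtain \<omega> where \<omega>: "\<omega> \<in> space \<mu>" and good: "\<And>x. good (shift x \<omega>)" by blast
  have \<omega>F: "\<omega> \<in> tiling_space F" using \<omega> by (simp add: space_\<mu>)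
  define a where "a x = int (\<omega> x)" for x
  define g where "g k x = E (\<Lambda> k) f (shift x \<omega>)" for k x
  have f_a: "f (shift x \<omega>) = real_of_int (a x)" for x by (simp add: f_shift a_def)
  show ?thesis
  proof (rule periodic_tiling_of_decomposition[where a = a and g = g and \<Psi> = "\<lambda>x. \<Psi> (shift x \<omega>)", OF K _ F])
    show "N * c > 0" using N c(1) by simp
    show "a x \<in> {0, 1}" for x using tiling_01[OF \<omega>F, of x] by (auto simp: a_def)
    show "(\<Sum>f\<in>F. a (x - f)) = 1" for x
    proof -
      have "(\<Sum>f\<in>F. \<omega> (x - f)) = 1" using \<omega>F by (simp add: tiling_space_def)
      then show ?thesis unfolding a_def of_nat_sum[symmetric] by simp
    qed
    show "periodic_mod (N * c) (\<lambda>x. \<Psi> (shift x \<omega>))"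
      unfolding periodic_mod_def
    proof (intro allI)
      fix x y
      have "\<Psi> (shift ((N * c) *s y) (shift x \<omega>)) = \<Psi> (shift x \<omega>)"
        using good[of x] unfolding good_def \<Gamma>_def by blast
      then show "\<Psi> (shift (x + (N * c) *s y) \<omega>) = \<Psi> (shift x \<omega>)"
        using T_add[OF \<omega>, of "(N * c) *s y" x] by (simp only: add.commute)
    qed
    fix k assume k: "k \<in> K"
    show "invariant_along (N * c) k (g k)"
      unfolding invariant_along_def
    proof (intro allI impI)
      fix x y assume "k y = 0"
      then have "k (c *s y) = 0" by (simp add: lattice_hom_scale[OF hom[OF k]])
      then have "N *s (c *s y) \<in> \<Lambda> k" unfolding \<Lambda>_def kernel_multiples_def by blast
      then have "E (\<Lambda> k) f (shift (N *s (c *s y)) (shift x \<omega>)) = E (\<Lambda> k) f (shift x \<omega>)"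
        using T_space[OF \<omega>] by (rule E_invariant)
      then show "g k (x + (N * c) *s y) = g k x"
        using T_add[OF \<omega>, of "N *s (c *s y)" x] by (simp add: g_def add.commute)
    qed
    show bounds: "0 \<le> g k x \<and> g k x \<le> 1" for x using good[of x] k by (auto simp: good_def g_def)
    show "real_of_int (a x) = g k x" if "g k x \<in> \<int>" for x
    proof -
      obtain z :: int where z: "g k x = of_int z" using \<open>g k x \<in> \<int>\<close> by (elim Ints_cases)
      then have "z = 0 \<or> z = 1" using bounds[of x] by auto
      then show ?thesis using good[of x] k z f_a[of x] by (auto simp: good_def g_def)
    qed
  next
    show "real_of_int (a x) = \<Psi> (shift x \<omega>) + (\<Sum>k\<in>K. g k x)" for x
      using good[of x] f_a[of x] by (simp add: good_def g_def)
  qed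
qed

end

theorem theorem1p2:
  fixes F :: "'d::finite lattice set"
    and \<mu> :: "('d lattice \<Rightarrow> nat) measure"
    and \<sigma> :: "('d lattice \<Rightarrow> complex) measure"
    and \<C> :: "('d lattice \<Rightarrow> complex) set set"
  assumes "CARD('d) \<ge> 2"
    and "finite F" and "F \<noteq> {}"
    and "borel_prob_on_tilings F \<mu>"
    and "shift_invariant \<mu>" and "shift_ergodic \<mu>"
    and "is_spectral_measure \<mu> (indicator {a \<in> tiling_space F. a 0 = 1}) \<sigma>"
    and "finite \<C>" and "\<forall>C\<in>\<C>. rational_affine_circle C"
    and "measure_support \<sigma> \<subseteq> \<Union>\<C>"
  shows "\<exists>A. tiling_complement F A \<and> fully_periodic A"
proof -
  interpret tiling_system F \<mu> \<sigma> using assms(4,5,7) by unfold_locales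
  obtain K N where K: "directions K" "K \<noteq> {}" "N > (0::int)"
    "\<And>C. C \<in> \<C> \<Longrightarrow> \<exists>k\<in>K. \<forall>\<theta>\<in>C. \<forall>h\<in>kernel_multiples N k. \<theta> h = 1"
    using rational_affine_circles_directions[OF assms(8,9)] by metis
  show ?thesis
  proof (rule periodic_tiling_of_directions[OF assms(2,3) K(1-3)])
    fix \<theta> assume "\<theta> \<in> measure_support \<sigma>"
    then obtain C where "C \<in> \<C>" "\<theta> \<in> C" using assms(10) by blast
    then show "\<exists>k\<in>K. \<forall>h\<in>kernel_multiples N k. \<theta> h = 1" using K(4) by blast
  qed
qed

end
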